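(* Let $p$ be an odd prime and let $S$ be a finite $p$-group such that the quotient group $S/\mathfrak{X}(S)$ satisfies at least one of the following conditions: (1) its nilpotence class is at most four; (2) it is metabelian; (3) it is of maximal class; (4) its $p$-rank is at most $p$. Then $J(S) \leq \mathfrak{X}(S)$.
   Context: Let $p$ be an odd prime and $S$ a finite $p$-group. Commutators: $[a,b]=a^{-1}b^{-1}ab$; for subgroups $H,K$, $[H,K]$ is the subgroup generated by all $[h,k]$ with $h\in H$, $k\in K$; and $[H,K;1]=[H,K]$, $[H,K;n]=[[H,K;n-1],K]$ for $n\geq 2$. For a $p$-group $P$, $\Omega_1(P)$ is the subgroup generated by the elements of order dividing $p$. A normal subgroup $Q$ of $S$ has a $Q$-series if there are an integer $n\geq 1$ and a series $1=Q_0\leq Q_1\leq\dots\leq Q_n=Q$ of normal subgroups $Q_i$ of $S$ such that $[\Omega_1(C_S(Q_{i-1})),Q_i;p-1]=1$ for all $1\leq i\leq n$. The Oliver subgroup $\mathfrak{X}(S)$ is the largest normal subgroup of $S$ that has a $Q$-series (such a largest one exists and is a characteristic subgroup of $S$). The Thompson subgroup $J(S)$ is the subgroup of $S$ generated by the elementary abelian subgroups of $S$ of greatest rank. The rank of an elementary abelian $p$-group is its dimension as an $\mathbb{F}_p$-vector space; the $p$-rank of a finite group is the maximum of the ranks of its elementary abelian $p$-subgroups. A group is metabelian if its derived subgroup is abelian. A group of order $p^n$ ($n\geq 2$) is of maximal class if its nilpotence class is $n-1$ (so groups of order $p^2$ are of maximal class). *)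

theory Defs
  imports
    "HOL-Algebra.Algebra"
    "HOL-Number_Theory.Residues"
    "Jordan_Normal_Form.Missing_VectorSpace"
begin

definition finite_p_group :: "nat \<Rightarrow> ('a, 'b) monoid_scheme \<Rightarrow> bool" where
  "finite_p_group p G \<longleftrightarrow> group G \<and> finite (carrier G) \<and> (\<exists>n. order G = p ^ n)"

definition comm_elt :: "('a, 'b) monoid_scheme \<Rightarrow> 'a \<Rightarrow> 'a \<Rightarrow> 'a" where
  "comm_elt G a b = inv\<^bsub>G\<^esub> a \<otimes>\<^bsub>G\<^esub> inv\<^bsub>G\<^esub> b \<otimes>\<^bsub>G\<^esub> a \<otimes>\<^bsub>G\<^esub> b"

definition comm_subgroup :: "('a, 'b) monoid_scheme \<Rightarrow> 'a set \<Rightarrow> 'a set \<Rightarrow> 'a set" where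
  "comm_subgroup G H K = generate G {comm_elt G h k | h k. h \<in> H \<and> k \<in> K}"

text \<open>
  \<open>iter_comm G H K n\<close> is \<open>[H,K;n]\<close>. The usual recursion starts at \<open>[H,K;1] = [H,K]\<close>; the
  convention \<open>[H,K;0] = H\<close> used here yields the same groups for all \<open>n \<ge> 1\<close>.
\<close>

primrec iter_comm :: "('a, 'b) monoid_scheme \<Rightarrow> 'a set \<Rightarrow> 'a set \<Rightarrow> nat \<Rightarrow> 'a set" where
  "iter_comm G H K 0 = H"
| "iter_comm G H K (Suc n) = comm_subgroup G (iter_comm G H K n) K"

definition centralizer :: "('a, 'b) monoid_scheme \<Rightarrow> 'a set \<Rightarrow> 'a set" where
  "centralizer G A = {g \<in> carrier G. \<forall>a\<in>A. g \<otimes>\<^bsub>G\<^esub> a = a \<otimes>\<^bsub>G\<^esub> g}"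

definition Omega1 :: "nat \<Rightarrow> ('a, 'b) monoid_scheme \<Rightarrow> 'a set \<Rightarrow> 'a set" where
  "Omega1 p G P = generate G {x \<in> P. x [^]\<^bsub>G\<^esub> p = \<one>\<^bsub>G\<^esub>}"

definition has_Q_series :: "nat \<Rightarrow> ('a, 'b) monoid_scheme \<Rightarrow> 'a set \<Rightarrow> bool" where
  "has_Q_series p S Q \<longleftrightarrow>
     (\<exists>(n::nat) (F :: nat \<Rightarrow> 'a set).
        n \<ge> 1 \<and> F 0 = {\<one>\<^bsub>S\<^esub>} \<and> F n = Q \<and>
        (\<forall>i\<le>n. F i \<lhd> S) \<and>
        (\<forall>i\<in>{1..n}. F (i - 1) \<subseteq> F i) \<and>
        (\<forall>i\<in>{1..n}. iter_comm S (Omega1 p S (centralizer S (F (i - 1)))) (F i) (p - 1)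
                      = {\<one>\<^bsub>S\<^esub>}))"

text \<open>
  For \<open>p\<close> an odd prime and \<open>S\<close> a finite \<open>p\<close>-group the product of two normal subgroups with a
  Q-series again has one, so that the greatest element with respect to inclusion exists.
\<close>

definition oliver_subgroup :: "nat \<Rightarrow> ('a, 'b) monoid_scheme \<Rightarrow> 'a set" where
  "oliver_subgroup p S = (GREATEST Q. Q \<lhd> S \<and> has_Q_series p S Q)"

definition elementary_abelian :: "nat \<Rightarrow> ('a, 'b) monoid_scheme \<Rightarrow> 'a set \<Rightarrow> bool" where
  "elementary_abelian p G E \<longleftrightarrow>
     subgroup E G \<and> comm_group (G\<lparr>carrier := E\<rparr>) \<and> (\<forall>x\<in>E. x [^]\<^bsub>G\<^esub> p = \<one>\<^bsub>G\<^esub>)"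

text \<open>
  The vector space over \<open>residue_ring p\<close> underlying an elementary abelian subgroup, written
  additively. The fields \<open>mult\<close> and \<open>one\<close> of the record are irrelevant for modules.
\<close>

definition F_p_space :: "('a, 'b) monoid_scheme \<Rightarrow> 'a set \<Rightarrow> (int, 'a) module" where
  "F_p_space G E =
     \<lparr>carrier = E, monoid.mult = undefined, one = undefined, ring.zero = \<one>\<^bsub>G\<^esub>, ring.add = (\<otimes>\<^bsub>G\<^esub>),
      smult = (\<lambda>k x. x [^]\<^bsub>G\<^esub> k)\<rparr>"

definition elab_rank :: "nat \<Rightarrow> ('a, 'b) monoid_scheme \<Rightarrow> 'a set \<Rightarrow> nat" where
  "elab_rank p G E = vectorspace.dim (residue_ring (int p)) (F_p_space G E)"

lemma vectorspace_F_p_space: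
  assumes "group G" "Factorial_Ring.prime p" "elementary_abelian p G E"
  shows "vectorspace (residue_ring (int p)) (F_p_space G E)"
proof -
  interpret G: group G by fact
  have sub: "subgroup E G" and cg: "comm_group (G\<lparr>carrier := E\<rparr>)"
    and ex: "\<And>x. x \<in> E \<Longrightarrow> x [^]\<^bsub>G\<^esub> p = \<one>\<^bsub>G\<^esub>"
    using assms(3) by (auto simp: elementary_abelian_def)
  interpret C: comm_group "G\<lparr>carrier := E\<rparr>" by (rule cg)
  have EG: "x \<in> carrier G" if "x \<in> E" for x using subgroup.subset[OF sub] that by auto
  have ZE: "x [^]\<^bsub>G\<^esub> k \<in> E" if "x \<in> E" for x and k :: int
    using G.subgroup_int_pow_closed[OF sub that] .
  interpret R: residues_prime p "residue_ring (int p)"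
    using assms(2) by (unfold_locales) auto
  have modp: "x [^]\<^bsub>G\<^esub> (k mod int p) = x [^]\<^bsub>G\<^esub> k" if x: "x \<in> E" for x and k :: int
  proof -
    have "x [^]\<^bsub>G\<^esub> k = x [^]\<^bsub>G\<^esub> (int p * (k div int p) + k mod int p)" by simp
    also have "\<dots> = (x [^]\<^bsub>G\<^esub> int p) [^]\<^bsub>G\<^esub> (k div int p) \<otimes>\<^bsub>G\<^esub> x [^]\<^bsub>G\<^esub> (k mod int p)"
      using EG[OF x] by (simp only: G.int_pow_mult G.int_pow_pow)
    also have "x [^]\<^bsub>G\<^esub> int p = \<one>\<^bsub>G\<^esub>" using ex[OF x] by (simp add: int_pow_int)
    finally show ?thesis using EG[OF x] by simp
  qed
  have comm: "x \<otimes>\<^bsub>G\<^esub> y = y \<otimes>\<^bsub>G\<^esub> x" if "x \<in> E" "y \<in> E" for x y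
    using C.m_comm[of x y] that by simp
  have "Module.module (residue_ring (int p)) (F_p_space G E)"
  proof (rule moduleI, goal_cases)
    case 1 show ?case by (rule R.cring)
  next
    case 2 show ?case
    proof (rule abelian_groupI, goal_cases)
      case (4 x y)
      then show ?case using comm by (simp add: F_p_space_def)
    next
      case (6 x)
      then show ?case
        using subgroup.m_inv_closed[OF sub, of x] EG[of x]
        by (intro bexI[of _ "inv\<^bsub>G\<^esub> x"]) (auto simp: F_p_space_def)
    qed (use sub EG in \<open>auto simp: F_p_space_def subgroup.m_closed subgroup.one_closed G.m_assoc\<close>)
  next
    case (5 a x y)
    then show ?case using EG comm by (auto simp: F_p_space_def intro!: G.int_pow_mult_distrib)
  next
    case (6 a b x)
    then show ?case using EG modp[of x "a * b"]
      by (simp add: F_p_space_def R.res_mult_eq G.int_pow_pow mult.commute)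
  qed (use ZE EG modp in \<open>auto simp: F_p_space_def R.res_add_eq R.res_one_eq G.int_pow_mult\<close>)
  then show ?thesis using R.is_field by (simp add: vectorspace_def)
qed

definition p_rank :: "nat \<Rightarrow> ('a, 'b) monoid_scheme \<Rightarrow> nat" where
  "p_rank p G = Max (elab_rank p G ` {E. elementary_abelian p G E})"

definition thompson_subgroup :: "nat \<Rightarrow> ('a, 'b) monoid_scheme \<Rightarrow> 'a set" where
  "thompson_subgroup p S =
     generate S (\<Union>{E. elementary_abelian p S E \<and>
                       (\<forall>E'. elementary_abelian p S E' \<longrightarrow> elab_rank p S E' \<le> elab_rank p S E)})"

text \<open>
  \<open>iter_comm G (carrier G) (carrier G) c\<close> is the term \<open>\<gamma>\<^sub>c\<^sub>+\<^sub>1(G)\<close> of the lower central series.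
  The definition is meaningful for nilpotent groups only, in particular for finite \<open>p\<close>-groups.
\<close>

definition nilpotency_class :: "('a, 'b) monoid_scheme \<Rightarrow> nat" where
  "nilpotency_class G = (LEAST c. iter_comm G (carrier G) (carrier G) c = {\<one>\<^bsub>G\<^esub>})"

definition metabelian :: "('a, 'b) monoid_scheme \<Rightarrow> bool" where
  "metabelian G \<longleftrightarrow> comm_group (G\<lparr>carrier := derived G (carrier G)\<rparr>)"

definition maximal_class :: "nat \<Rightarrow> ('a, 'b) monoid_scheme \<Rightarrow> bool" where
  "maximal_class p G \<longleftrightarrow> (\<exists>n\<ge>2. order G = p ^ n \<and> nilpotency_class G = n - 1)"

end

theory Submission
  imports Defs
begin

text \<open>
  Let \<open>X\<close> be the Oliver subgroup, \<open>G = S/X\<close> and \<open>V = \<Omega>\<^sub>1(C\<^sub>S(X))\<close>. Maximality of \<open>X\<close> yields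
  \<open>C\<^sub>S(X) \<le> X\<close> and \<open>C\<^sub>S(V) = X\<close>, so \<open>V\<close> is a faithful \<open>G\<close>-module, and \<open>(z - 1)\<^sup>p\<^sup>-\<^sup>1 \<noteq> 0\<close> on \<open>V\<close>
  for every central \<open>z \<noteq> 1\<close> of \<open>G\<close>. An elementary abelian subgroup \<open>A\<close> of largest rank that is not
  contained in \<open>X\<close> gives an offender \<open>E = AX/X\<close>, that is \<open>\<bar>E\<bar> \<bar>C\<^sub>V(E)\<bar> \<ge> \<bar>V\<bar>\<close>, and by
  replacement \<open>E\<close> may be taken to act quadratically. Such offenders are ruled out as follows.

  Central quadratic elements are trivial, and if \<open>x\<close> is quadratic and commutes with \<open>z = [x, y]\<close>,
  which commutes with \<open>y\<close>, then \<open>z\<close> is quadratic. An abelian normal subgroup contains no offender.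
  If \<open>G\<close> has class at most four or is metabelian, quadratic elements centralize all commutators, hence
  the conjugates of \<open>E\<close> generate an abelian normal subgroup. For \<open>p\<close>-rank at most \<open>p\<close>, the bound
  \<open>\<bar>V : C\<^sub>V(E)\<bar> \<ge> p\<^sup>p\<^sup>-\<^sup>1\<close> shows that \<open>E\<close> and the centre exhaust the rank, which is contradicted
  above a maximal cyclic normal subgroup. In a non-metabelian group of maximal class the largest elementary
  abelian term \<open>Z\<^sub>k\<close> of the upper central series has \<open>k \<le> p\<close>, by the two-step centralizers, while the
  lowest term \<open>Z\<^sub>r\<close> containing a non-trivial quadratic element has \<open>p - 1 \<le> r \<le> k\<close>. If \<open>r = k\<close>, then
  \<open>E \<le> Z\<^sub>k\<close>; otherwise \<open>E\<close> is too small for the above bound.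
\<close>

section \<open>Commutators and fixed points\<close>

text \<open>Everything known about X enters through one principle: a normal subgroup Q containing X
  with [V, Q; p-1] = 1 could be appended to a series of X, so Q = X. For the preimage Q of a central
  cyclic subgroup generated by z, [V, Q; i] lies in (z - 1)^i V, and this is where the exponent p -
  1 on V comes from. As p is odd, 2 <= p - 1, so operators of square zero fall under the principle.
  The offender inequality results from comparing A with (A \<inter> X)V, which is elementary abelian
  because X centralizes V, and so has at most the order of A.

  The obstacle is that quadratic elements need not lie near the centre, while only central ones are
  controlled. The bridge is the commutator rule, whose proviso is that the commutator commutes with
  both entries. Each case arranges the proviso differently: by the length of the central series, by
  an abelian derived subgroup, or by a counterexample chosen as low as possible.

  The rank p splits as (p - 1) + 1: a non-trivial offender has order at least p^(p-1), and it meets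
  a central subgroup of order p trivially when it is quadratic.\<close>

context group
begin

lemma cancel_left [simp]:
  assumes "x \<in> carrier G" "y \<in> carrier G"
  shows "inv x \<otimes> (x \<otimes> y) = y" "x \<otimes> (inv x \<otimes> y) = y"
  using assms by (simp_all add: m_assoc [symmetric])

lemmas word_simps = m_assoc inv_mult_group comm_elt_def

lemma comm_elt_closed [simp]:
  "a \<in> carrier G \<Longrightarrow> b \<in> carrier G \<Longrightarrow> comm_elt G a b \<in> carrier G"
  by (simp add: comm_elt_def)

lemma comm_elt_one [simp]:
  "a \<in> carrier G \<Longrightarrow> comm_elt G a \<one> = \<one>" "a \<in> carrier G \<Longrightarrow> comm_elt G \<one> a = \<one>"
  by (simp_all add: comm_elt_def)

lemma conj_eq_comm_elt:
  "a \<in> carrier G \<Longrightarrow> g \<in> carrier G \<Longrightarrow> inv g \<otimes> a \<otimes> g = a \<otimes> comm_elt G a g"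
  by (simp add: word_simps)

lemma comm_elt_eq_one_iff:
  assumes "a \<in> carrier G" "b \<in> carrier G"
  shows "comm_elt G a b = \<one> \<longleftrightarrow> a \<otimes> b = b \<otimes> a"
proof -
  have eq: "b \<otimes> a \<otimes> comm_elt G a b = a \<otimes> b" using assms by (simp add: word_simps)
  show ?thesis
  proof
    assume "comm_elt G a b = \<one>"
    then show "a \<otimes> b = b \<otimes> a" using eq assms by simp
  next
    assume "a \<otimes> b = b \<otimes> a"
    then have "b \<otimes> a \<otimes> comm_elt G a b = b \<otimes> a \<otimes> \<one>" using eq assms by simp
    then show "comm_elt G a b = \<one>" using assms l_cancel[of "b \<otimes> a" "comm_elt G a b" \<one>] by simp
  qed
qed

lemma inv_comm_elt:
  "a \<in> carrier G \<Longrightarrow> b \<in> carrier G \<Longrightarrow> inv (comm_elt G a b) = comm_elt G b a"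
  by (simp add: word_simps)

lemma comm_elt_mult_right:
  "\<lbrakk>a \<in> carrier G; b \<in> carrier G; c \<in> carrier G\<rbrakk>
    \<Longrightarrow> comm_elt G a (b \<otimes> c) = comm_elt G a c \<otimes> (inv c \<otimes> comm_elt G a b \<otimes> c)"
  by (simp add: word_simps)

lemma comm_elt_mult_left:
  "\<lbrakk>a \<in> carrier G; b \<in> carrier G; c \<in> carrier G\<rbrakk>
    \<Longrightarrow> comm_elt G (a \<otimes> b) c = (inv b \<otimes> comm_elt G a c \<otimes> b) \<otimes> comm_elt G b c"
  by (simp add: word_simps)

lemma comm_elt_inv_right:
  "\<lbrakk>a \<in> carrier G; b \<in> carrier G\<rbrakk> \<Longrightarrow> comm_elt G a (inv b) = b \<otimes> comm_elt G b a \<otimes> inv b"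
  by (simp add: word_simps)

lemma comm_elt_inv_left:
  "\<lbrakk>a \<in> carrier G; b \<in> carrier G\<rbrakk> \<Longrightarrow> comm_elt G (inv a) b = a \<otimes> comm_elt G b a \<otimes> inv a"
  by (simp add: word_simps)

lemma conj_comm_elt:
  "\<lbrakk>a \<in> carrier G; b \<in> carrier G; g \<in> carrier G\<rbrakk> \<Longrightarrow>
    inv g \<otimes> comm_elt G a b \<otimes> g = comm_elt G (inv g \<otimes> a \<otimes> g) (inv g \<otimes> b \<otimes> g)"
  by (simp add: word_simps)

lemma hall_witt:
  "\<lbrakk>a \<in> carrier G; b \<in> carrier G; c \<in> carrier G\<rbrakk> \<Longrightarrow>
    (inv b \<otimes> comm_elt G (comm_elt G a (inv b)) c \<otimes> b) \<otimes>
    (inv c \<otimes> comm_elt G (comm_elt G b (inv c)) a \<otimes> c) \<otimes>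
    (inv a \<otimes> comm_elt G (comm_elt G c (inv a)) b \<otimes> a) = \<one>"
  by (simp add: word_simps)

lemma normal_conj:
  assumes "N \<lhd> G" "x \<in> N" "g \<in> carrier G"
  shows "inv g \<otimes> x \<otimes> g \<in> N" "g \<otimes> x \<otimes> inv g \<in> N"
  using normal.inv_op_closed1 [OF assms(1)] normal.inv_op_closed2 [OF assms(1)] assms by auto

lemma normal_conj_iff:
  assumes "N \<lhd> G" "x \<in> carrier G" "g \<in> carrier G"
  shows "inv g \<otimes> x \<otimes> g \<in> N \<longleftrightarrow> x \<in> N"
proof
  assume "inv g \<otimes> x \<otimes> g \<in> N"
  then have "g \<otimes> (inv g \<otimes> x \<otimes> g) \<otimes> inv g \<in> N" using normal_conj assms by blast
  then show "x \<in> N" using assms by (simp add: m_assoc)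
qed (use normal_conj assms in blast)

lemma normalI':
  assumes "subgroup N G" "\<And>x g. x \<in> N \<Longrightarrow> g \<in> carrier G \<Longrightarrow> inv g \<otimes> x \<otimes> g \<in> N"
  shows "N \<lhd> G"
  unfolding normal_inv_iff
proof (intro conjI ballI)
  fix g x assume "g \<in> carrier G" "x \<in> N"
  then show "g \<otimes> x \<otimes> inv g \<in> N" using assms(2)[of x "inv g"] by simp
qed (fact assms)

lemma normal_generate_conj:
  assumes "K \<subseteq> carrier G" and "\<And>x g. x \<in> K \<Longrightarrow> g \<in> carrier G \<Longrightarrow> inv g \<otimes> x \<otimes> g \<in> K"
  shows "generate G K \<lhd> G"
proof (rule normal_generateI[OF assms(1)])
  fix h g assume "h \<in> K" "g \<in> carrier G"
  then show "g \<otimes> h \<otimes> inv g \<in> K" using assms(2)[of h "inv g"] by simp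
qed

lemma normal_comm_elt:
  assumes "N \<lhd> G" "a \<in> carrier G" "b \<in> carrier G" "a \<in> N \<or> b \<in> N"
  shows "comm_elt G a b \<in> N"
proof -
  have sub: "subgroup N G" using assms normal_imp_subgroup by blast
  have "comm_elt G a b = inv a \<otimes> (inv b \<otimes> a \<otimes> b)" "comm_elt G a b = (inv a \<otimes> inv b \<otimes> a) \<otimes> b"
    using assms by (simp_all add: word_simps)
  then show ?thesis using assms normal_conj[OF assms(1)] subgroup.m_closed[OF sub] subgroup.m_inv_closed[OF sub]
    by metis
qed

lemma normal_comm_elt_subst:
  assumes N: "N \<lhd> G" and c: "a \<in> carrier G" "b \<in> carrier G" "c \<in> carrier G"
  shows "comm_elt G a b \<in> N \<Longrightarrow> comm_elt G a c \<in> N \<Longrightarrow> comm_elt G a (b \<otimes> c) \<in> N"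
    and "comm_elt G a b \<in> N \<Longrightarrow> comm_elt G a (inv b) \<in> N"
    and "comm_elt G a b \<in> N \<Longrightarrow> comm_elt G b a \<in> N"
    and "comm_elt G b a \<in> N \<Longrightarrow> comm_elt G c a \<in> N \<Longrightarrow> comm_elt G (b \<otimes> c) a \<in> N"
    and "comm_elt G b a \<in> N \<Longrightarrow> comm_elt G (inv b) a \<in> N"
proof -
  have sub: "subgroup N G" using assms normal_imp_subgroup by blast
  show s: "comm_elt G a b \<in> N \<Longrightarrow> comm_elt G b a \<in> N"
    using c inv_comm_elt subgroup.m_inv_closed[OF sub] by metis
  show "comm_elt G a b \<in> N \<Longrightarrow> comm_elt G a c \<in> N \<Longrightarrow> comm_elt G a (b \<otimes> c) \<in> N"
    using c normal_conj[OF N] subgroup.m_closed[OF sub] by (simp add: comm_elt_mult_right)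
  show "comm_elt G b a \<in> N \<Longrightarrow> comm_elt G c a \<in> N \<Longrightarrow> comm_elt G (b \<otimes> c) a \<in> N"
    using c normal_conj[OF N] subgroup.m_closed[OF sub] by (simp add: comm_elt_mult_left)
  show "comm_elt G a b \<in> N \<Longrightarrow> comm_elt G a (inv b) \<in> N"
    using c s normal_conj[OF N] by (simp add: comm_elt_inv_right)
  show "comm_elt G b a \<in> N \<Longrightarrow> comm_elt G (inv b) a \<in> N"
    using c normal_conj[OF N] inv_comm_elt[of b a] subgroup.m_inv_closed[OF sub]
    by (metis comm_elt_inv_left)
qed

text \<open>Hall-Witt for \<open>inv a\<close>, \<open>b\<close>, \<open>c\<close> has two factors
  in \<open>N\<close>, and the third is a conjugate of \<open>[[c, a], b]\<close>. Stating it for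
  single commutators spares all generated commutator subgroups.\<close>

lemma three_subgroups:
  assumes N: "N \<lhd> G"
    and sub: "subgroup A G" "subgroup B G" "subgroup C G"
    and 1: "\<And>a b c. \<lbrakk>a \<in> A; b \<in> B; c \<in> C\<rbrakk> \<Longrightarrow> comm_elt G (comm_elt G a b) c \<in> N"
    and 2: "\<And>a b c. \<lbrakk>a \<in> A; b \<in> B; c \<in> C\<rbrakk> \<Longrightarrow> comm_elt G (comm_elt G b c) a \<in> N"
    and mem: "a \<in> A" "b \<in> B" "c \<in> C"
  shows "comm_elt G (comm_elt G c a) b \<in> N"
proof -
  have subN: "subgroup N G" using N normal_imp_subgroup by blast
  have c: "a \<in> carrier G" "b \<in> carrier G" "c \<in> carrier G"
    using mem subgroup.mem_carrier[OF sub(1)] subgroup.mem_carrier[OF sub(2)]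
      subgroup.mem_carrier[OF sub(3)] by auto
  have i: "inv a \<in> A" "inv b \<in> B" "inv c \<in> C" using mem subgroup.m_inv_closed[OF sub(1)] subgroup.m_inv_closed[OF sub(2)]
      subgroup.m_inv_closed[OF sub(3)] by auto
  define U where "U = inv b \<otimes> comm_elt G (comm_elt G (inv a) (inv b)) c \<otimes> b"
  define Y where "Y = inv c \<otimes> comm_elt G (comm_elt G b (inv c)) (inv a) \<otimes> c"
  define Z where "Z = a \<otimes> comm_elt G (comm_elt G c a) b \<otimes> inv a"
  have "U \<otimes> Y \<otimes> Z = \<one>" using hall_witt[of "inv a" b c] c unfolding U_def Y_def Z_def by simp
  moreover have UN: "U \<in> N" "Y \<in> N" unfolding U_def Y_def using 1 2 i mem c normal_conj[OF N] by auto
  moreover have cl: "U \<in> carrier G" "Y \<in> carrier G" "Z \<in> carrier G"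
    unfolding U_def Y_def Z_def using c by auto
  ultimately have "Z = inv (U \<otimes> Y)" by (metis inv_equality inv_inv m_closed)
  then have "Z \<in> N" using UN subgroup.m_closed[OF subN] subgroup.m_inv_closed[OF subN] by simp
  then have "inv a \<otimes> Z \<otimes> a \<in> N" using normal_conj[OF N] c by blast
  then show ?thesis using c unfolding Z_def by (simp add: m_assoc)
qed

end

section \<open>The product formula and p-groups acting on finite sets\<close>

lemma (in group) card_set_mult_Int:
  assumes H: "subgroup H G" and K: "subgroup K G" and fin: "finite H" "finite K"
  shows "card (H <#> K) * card (H \<inter> K) = card H * card K"
proof -
  define f where "f = (\<lambda>(h, k). h \<otimes> k)"
  have img: "f ` (H \<times> K) = H <#> K" unfolding f_def set_mult_def by auto
  have HC: "\<And>h. h \<in> H \<Longrightarrow> h \<in> carrier G" "\<And>h. h \<in> K \<Longrightarrow> h \<in> carrier G"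
    using subgroup.mem_carrier[OF H] subgroup.mem_carrier[OF K] by auto
  have fib: "card {x \<in> H \<times> K. f x = y} = card (H \<inter> K)" if y: "y \<in> f ` (H \<times> K)" for y
  proof -
    obtain h k where hk: "h \<in> H" "k \<in> K" "y = h \<otimes> k" using y unfolding f_def by auto
    have "bij_betw (\<lambda>t. (h \<otimes> t, inv t \<otimes> k)) (H \<inter> K) {x \<in> H \<times> K. f x = y}"
    proof (rule bij_betwI[where g = "\<lambda>(a, b). inv h \<otimes> a"], goal_cases)
      case 1
      then show ?case using hk HC H K by (auto simp: f_def m_assoc subgroup.m_closed subgroup.m_inv_closed)
    next
      case 2
      show ?case
      proof (rule Pi_I)
        fix w assume "w \<in> {w \<in> H \<times> K. f w = y}"
        then obtain a b where w: "w = (a, b)" and ab: "a \<in> H" "b \<in> K" "f (a, b) = y" by auto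
        then have e: "a \<otimes> b = h \<otimes> k" using hk by (simp add: f_def)
        have "inv h \<otimes> a = k \<otimes> inv b"
          using e hk ab HC by (metis (no_types) cancel_left(1) inv_solve_right m_assoc inv_closed m_closed)
        then show "(case w of (a, b) \<Rightarrow> inv h \<otimes> a) \<in> H \<inter> K"
          unfolding w using H K hk ab by (simp, metis subgroup.m_closed subgroup.m_inv_closed)
      qed
    next
      case (3 x)
      then show ?case using hk HC by auto
    next
      case (4 y')
      then obtain a b where ab: "y' = (a, b)" "a \<in> H" "b \<in> K" "a \<otimes> b = h \<otimes> k"
        using hk by (auto simp: f_def)
      have "inv (inv h \<otimes> a) \<otimes> k = b"
        using ab hk HC by (simp add: inv_mult_group m_assoc flip: ab(4))
      then show ?case using ab hk HC by auto
    qed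
    then have "card (H \<inter> K) = card {x \<in> H \<times> K. f x = y}" by (rule bij_betw_same_card)
    then show ?thesis by (rule sym)
  qed
  have "card (H \<times> K) = (\<Sum>y\<in>f ` (H \<times> K). card {x \<in> H \<times> K. f x = y})"
    unfolding card_eq_sum by (rule sum.image_gen) (use fin in simp)
  also have "\<dots> = card (H <#> K) * card (H \<inter> K)"
    using fib sum.cong[OF refl, of "f ` (H \<times> K)" "\<lambda>y. card {x \<in> H \<times> K. f x = y}" "\<lambda>_. card (H \<inter> K)"]
    by (simp only: sum_constant img of_nat_id)
  finally show ?thesis by (simp add: card_cartesian_product)
qed

text \<open>Orbits have p-power length by the orbit-stabilizer theorem, so every orbit that is not a
  single fixed point contributes a multiple of p.\<close>

lemma fixed_points_cong:
  fixes G (structure) and T :: "'x set"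
  assumes grp: "group G" and p: "Factorial_Ring.prime (p::nat)" and ord: "order G = p ^ n"
    and fin: "finite T"
    and act: "\<And>g x. g \<in> carrier G \<Longrightarrow> x \<in> T \<Longrightarrow> act g x \<in> T"
      "\<And>x. x \<in> T \<Longrightarrow> act \<one> x = x"
      "\<And>g h x. g \<in> carrier G \<Longrightarrow> h \<in> carrier G \<Longrightarrow> x \<in> T \<Longrightarrow> act (g \<otimes> h) x = act g (act h x)"
  shows "[card T = card {x \<in> T. \<forall>g\<in>carrier G. act g x = x}] (mod p)"
proof -
  interpret group G by fact
  \<comment> \<open>\<open>BijGroup\<close> consists of extensional functions, hence the restriction
    to \<open>T\<close>.\<close>
  define \<phi> where "\<phi> = (\<lambda>g. \<lambda>x\<in>T. act g x)"
  have bij: "\<phi> g \<in> Bij T" if g: "g \<in> carrier G" for g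
  proof -
    have "bij_betw (\<phi> g) T T"
      by (rule bij_betwI[where g = "\<phi> (inv g)"])
        (use g act act(3)[symmetric] in \<open>auto simp: \<phi>_def\<close>)
    then show ?thesis unfolding Bij_def \<phi>_def by auto
  qed
  have "\<phi> \<in> hom G (BijGroup T)"
  proof (rule homI)
    fix g h assume gh: "g \<in> carrier G" "h \<in> carrier G"
    show "\<phi> (g \<otimes> h) = \<phi> g \<otimes>\<^bsub>BijGroup T\<^esub> \<phi> h"
      using bij[OF gh(1)] bij[OF gh(2)] gh act
      by (auto simp: BijGroup_def \<phi>_def compose_def fun_eq_iff)
  qed (use bij in \<open>simp add: BijGroup_def\<close>)
  then interpret A: group_action G T \<phi>
    by (simp add: group_action_def group_hom_def group_hom_axioms_def group_BijGroup is_group)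
  define O1 where "O1 = orbits G T \<phi>"
  define F where "F = {x \<in> T. \<forall>g\<in>carrier G. act g x = x}"
  have finO: "finite O1" unfolding O1_def orbits_def using fin by auto
  have orbX: "orbit G \<phi> x = (\<lambda>g. act g x) ` carrier G" if "x \<in> T" for x
    using that unfolding orbit_def \<phi>_def by auto
  have cardX: "card T = (\<Sum>orb\<in>O1. card orb)"
    using A.disjoint_sum[OF fin, of "\<lambda>_. 1::nat"] unfolding O1_def by simp
  have cong1: "[card orb = (if \<exists>x\<in>F. orb = {x} then 1 else 0)] (mod p)" if orb: "orb \<in> O1" for orb
  proof -
    obtain x where x: "x \<in> T" "orb = orbit G \<phi> x" using orb unfolding O1_def orbits_def by auto
    have "card orb dvd p ^ n" using A.orbit_stabilizer_theorem[OF x(1)] x(2) ord by (metis dvdI)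
    then obtain i where i: "card orb = p ^ i" using p divides_primepow_nat by blast
    show ?thesis
    proof (cases "i = 0")
      case True
      then have "card orb = 1" using i by simp
      then obtain y where y: "orb = {y}" using card_1_singletonE by blast
      have xorb: "x \<in> orb" using x act(2) orbX by (metis image_eqI one_closed)
      then have "y = x" using y by simp
      then have "x \<in> F" unfolding F_def using x y orbX[OF x(1)] by auto
      then show ?thesis using y \<open>y = x\<close> by auto
    next
      case False
      then have "card orb \<noteq> 1" using i p by (metis nat_power_eq_Suc_0_iff One_nat_def not_prime_1)
      then have "\<not> (\<exists>x\<in>F. orb = {x})" by auto
      moreover have "p dvd card orb" using i False by simp
      ultimately show ?thesis by (simp add: cong_0_iff)
    qed
  qed
  have "[(\<Sum>orb\<in>O1. card orb) = (\<Sum>orb\<in>O1. if \<exists>x\<in>F. orb = {x} then 1 else 0)] (mod p)"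
    by (rule cong_sum) (use cong1 in auto)
  also have "(\<Sum>orb\<in>O1. if \<exists>x\<in>F. orb = {x} then 1 else 0) = card {orb \<in> O1. \<exists>x\<in>F. orb = {x}}"
    using finO by (simp add: sum.If_cases Int_def)
  also have "{orb \<in> O1. \<exists>x\<in>F. orb = {x}} = (\<lambda>x. {x}) ` F"
  proof -
    have "{x} \<in> O1" if "x \<in> F" for x
    proof -
      have xX: "x \<in> T" and fx: "\<And>g. g \<in> carrier G \<Longrightarrow> act g x = x" using that unfolding F_def by auto
      have "orbit G \<phi> x = {x}" using orbX[OF xX] fx one_closed by auto
      then show ?thesis unfolding O1_def orbits_def using xX by blast
    qed
    then show ?thesis by auto
  qed
  also have "card ((\<lambda>x. {x}) ` F) = card F" by (simp add: card_image)
  finally show ?thesis using cardX F_def by simp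
qed

text \<open>Applied to the cosets of \<open>F\<close>, the fixed point congruence produces an element outside \<open>F\<close>.\<close>

lemma fixed_point_outside_subgroup:
  fixes G (structure) and H (structure)
  assumes G: "group G" "order G = p ^ n" and p: "Factorial_Ring.prime (p::nat)"
    and H: "group H" "order H = p ^ m" and F: "subgroup F H" "F \<noteq> carrier H"
    and hom: "\<And>g. g \<in> carrier G \<Longrightarrow> \<rho> g \<in> hom H H"
    and one: "\<And>x. x \<in> carrier H \<Longrightarrow> \<rho> \<one> x = x"
    and mult: "\<And>g h x. g \<in> carrier G \<Longrightarrow> h \<in> carrier G \<Longrightarrow> x \<in> carrier H \<Longrightarrow> \<rho> (g \<otimes> h) x = \<rho> g (\<rho> h x)"
    and inv: "\<And>g x. g \<in> carrier G \<Longrightarrow> x \<in> F \<Longrightarrow> \<rho> g x \<in> F"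
  obtains v where "v \<in> carrier H" "v \<notin> F" "\<And>g. g \<in> carrier G \<Longrightarrow> \<rho> g v \<otimes>\<^bsub>H\<^esub> inv\<^bsub>H\<^esub> v \<in> F"
proof -
  interpret H: group H by fact
  interpret G: group G by fact
  interpret F: subgroup F H by fact
  have p1: "p > 1" using p prime_gt_1_nat by blast
  have finH: "finite (carrier H)" using H(2) p1 H.order_gt_0_iff_finite by simp
  define T where "T = rcosets\<^bsub>H\<^esub> F"
  have homD: "\<rho> g (x \<otimes>\<^bsub>H\<^esub> y) = \<rho> g x \<otimes>\<^bsub>H\<^esub> \<rho> g y" "\<rho> g x \<in> carrier H"
    if "g \<in> carrier G" "x \<in> carrier H" "y \<in> carrier H" for g x y
    using hom[OF that(1)] that by (auto simp: hom_def)
  have FC: "\<And>f. f \<in> F \<Longrightarrow> f \<in> carrier H" by (rule F.mem_carrier)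
  have img: "\<rho> g ` (F #>\<^bsub>H\<^esub> v) = F #>\<^bsub>H\<^esub> \<rho> g v" if g: "g \<in> carrier G" and v: "v \<in> carrier H" for g v
  proof
    show "\<rho> g ` (F #>\<^bsub>H\<^esub> v) \<subseteq> F #>\<^bsub>H\<^esub> \<rho> g v"
      using g v inv homD FC unfolding r_coset_def by auto
    show "F #>\<^bsub>H\<^esub> \<rho> g v \<subseteq> \<rho> g ` (F #>\<^bsub>H\<^esub> v)"
    proof
      fix y assume "y \<in> F #>\<^bsub>H\<^esub> \<rho> g v"
      then obtain f where f: "f \<in> F" "y = f \<otimes>\<^bsub>H\<^esub> \<rho> g v" unfolding r_coset_def by auto
      have f': "\<rho> (inv\<^bsub>G\<^esub> g) f \<in> F" using inv f g by simp
      have "\<rho> g (\<rho> (inv\<^bsub>G\<^esub> g) f \<otimes>\<^bsub>H\<^esub> v) = y"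
        using f f' v g FC homD mult[of g "inv\<^bsub>G\<^esub> g" f] one by simp
      then show "y \<in> \<rho> g ` (F #>\<^bsub>H\<^esub> v)" using f' unfolding r_coset_def by blast
    qed
  qed
  have finX: "finite T" unfolding T_def using finH by (simp add: RCOSETS_def)
  have X_E: "\<exists>v\<in>carrier H. C = F #>\<^bsub>H\<^esub> v" if "C \<in> T" for C using that unfolding T_def RCOSETS_def by auto
  have X_I: "F #>\<^bsub>H\<^esub> v \<in> T" if "v \<in> carrier H" for v using that unfolding T_def RCOSETS_def by auto
  have cong: "[card T = card {C \<in> T. \<forall>g\<in>carrier G. \<rho> g ` C = C}] (mod p)"
  proof (rule fixed_points_cong[OF G(1) p G(2) finX, of "\<lambda>g C. \<rho> g ` C"], goal_cases)
    case (1 g C)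
    then obtain v where v: "v \<in> carrier H" "C = F #>\<^bsub>H\<^esub> v" using X_E by blast
    then show ?case using 1 img[of g v] X_I[of "\<rho> g v"] homD(2)[of g v v] by simp
  next
    case (2 C)
    then obtain v where v: "v \<in> carrier H" "C = F #>\<^bsub>H\<^esub> v" using X_E by blast
    then have "C \<subseteq> carrier H" using H.r_coset_subset_G F.subset by blast
    then have "\<And>x. x \<in> C \<Longrightarrow> \<rho> \<one>\<^bsub>G\<^esub> x = x" using one by blast
    then show ?case by simp
  next
    case (3 g h C)
    then obtain v where v: "v \<in> carrier H" "C = F #>\<^bsub>H\<^esub> v" using X_E by blast
    then have "C \<subseteq> carrier H" using H.r_coset_subset_G F.subset by blast
    then have "\<And>x. x \<in> C \<Longrightarrow> \<rho> (g \<otimes>\<^bsub>G\<^esub> h) x = \<rho> g (\<rho> h x)" using 3 mult by blast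
    then show ?case unfolding image_image by (rule image_cong[OF refl])
  qed
  have lag: "card T * card F = p ^ m" using H.lagrange[OF F(1)] H(2) unfolding T_def by simp
  have "card T \<noteq> 1"
  proof
    assume "card T = 1"
    then have "card F = card (carrier H)" using lag H(2) by (simp add: order_def)
    then show False using F(2) finH F.subset card_subset_eq by metis
  qed
  moreover obtain i where "card T = p ^ i" using lag p divides_primepow_nat by (metis dvdI)
  ultimately have "p dvd card T" by (cases i) auto
  then have dvd: "p dvd card {C \<in> T. \<forall>g\<in>carrier G. \<rho> g ` C = C}"
    using cong by (meson cong_dvd_iff)
  \<comment> \<open>\<open>F\<close> itself is a fixed coset; since p divides the number of fixed
    cosets, there is a second one.\<close>
  have FX: "F \<in> {C \<in> T. \<forall>g\<in>carrier G. \<rho> g ` C = C}"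
    using X_I[of "\<one>\<^bsub>H\<^esub>"] img[of _ "\<one>\<^bsub>H\<^esub>"] H.coset_mult_one[OF F.subset] hom_one[OF hom H(1) H(1)]
    by auto
  have "{C \<in> T. \<forall>g\<in>carrier G. \<rho> g ` C = C} \<noteq> {F}" 
  proof
    assume "{C \<in> T. \<forall>g\<in>carrier G. \<rho> g ` C = C} = {F}"
    then show False using dvd p1 by simp
  qed
  then obtain C where C: "C \<in> T" "\<forall>g\<in>carrier G. \<rho> g ` C = C" "C \<noteq> F" using FX by blast
  obtain v where v: "v \<in> carrier H" "C = F #>\<^bsub>H\<^esub> v" using C(1) X_E by blast
  have vF: "v \<notin> F" using v C(3) H.coset_join2[OF v(1) F(1)] by auto
  have "\<rho> g v \<otimes>\<^bsub>H\<^esub> inv\<^bsub>H\<^esub> v \<in> F" if g: "g \<in> carrier G" for g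
  proof -
    have "v \<in> C" using v H.rcos_self[OF _ F(1)] by simp
    then have "\<rho> g v \<in> F #>\<^bsub>H\<^esub> v" using C(2) g v by blast
    then show ?thesis using F.rcos_module_imp[OF H(1) v(1)] by blast
  qed
  then show ?thesis using that v vF by blast
qed

section \<open>Finite p-groups\<close>

locale p_group = group G for G (structure) + fixes p :: nat
  assumes p: "Factorial_Ring.prime p" and order_pow: "\<exists>n. order G = p ^ n"
begin

lemma p_gt_1: "p > 1" using p prime_gt_1_nat by blast

lemma fin: "finite (carrier G)"
  using order_pow p_gt_1 order_gt_0_iff_finite by force

lemma fin_subgroup: "subgroup H G \<Longrightarrow> finite H"
  using fin subgroup.subset finite_subset by metis

lemma card_subgroup_pow:
  assumes "subgroup H G" obtains i where "card H = p ^ i"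
proof -
  obtain n where "order G = p ^ n" using order_pow by blast
  then have "card H dvd p ^ n" using lagrange[OF assms] by (metis dvd_triv_right)
  then show ?thesis using that p divides_primepow_nat by blast
qed

lemma card_subgroup_pos: "subgroup H G \<Longrightarrow> card H > 0"
  by (metis card_gt_0_iff empty_iff fin_subgroup subgroup.one_closed)

lemma sq_one_odd:
  assumes "odd p" "x \<in> carrier G" "x \<otimes> x = \<one>" shows "x = \<one>"
proof -
  obtain m where m: "order G = p ^ m" using order_pow by blast
  then have "odd (order G)" using assms by simp
  then obtain k where k: "order G = 2 * k + 1" using oddE by blast
  have "x [^] (2::nat) = \<one>" using assms by (simp add: numeral_2_eq_2)
  then have "x [^] (2 * k) = \<one>" using assms nat_pow_pow[of x 2 k] by simp
  then have "x [^] order G = x" using k assms by simp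
  then show ?thesis using pow_order_eq_1 assms by simp
qed

text \<open>\<open>G\<close> acts by conjugation on the non-trivial p-group N/(M \<inter> N) and
  therefore has a non-trivial fixed point there.\<close>

lemma central_step:
  assumes M: "M \<lhd> G" and N: "N \<lhd> G" and "\<not> N \<subseteq> M"
  obtains n where "n \<in> N" "n \<notin> M" "\<And>g. g \<in> carrier G \<Longrightarrow> comm_elt G n g \<in> M"
proof -
  have subM: "subgroup M G" and subN: "subgroup N G" using M N normal_imp_subgroup by auto
  have NC: "\<And>x. x \<in> N \<Longrightarrow> x \<in> carrier G" using subgroup.mem_carrier[OF subN] .
  obtain n where n: "order G = p ^ n" using order_pow by blast
  obtain m where m: "card N = p ^ m" using card_subgroup_pow[OF subN] .
  have subMN: "subgroup (M \<inter> N) (G\<lparr>carrier := N\<rparr>)"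
    using subgroups_Inter_pair[OF subM subN] subN by (simp add: subgroup_incl)
  obtain v where v: "v \<in> N" "v \<notin> M"
    "\<And>g. g \<in> carrier G \<Longrightarrow> (g \<otimes> v \<otimes> inv g) \<otimes> inv\<^bsub>G\<lparr>carrier := N\<rparr>\<^esub> v \<in> M \<inter> N"
  proof (rule fixed_point_outside_subgroup[OF is_group n p, of "G\<lparr>carrier := N\<rparr>" m "M \<inter> N" "\<lambda>g x. g \<otimes> x \<otimes> inv g"], goal_cases)
    case 1 show ?case by (rule subgroup_imp_group[OF subN])
  next
    case 2 show ?case using m by (simp add: order_def)
  next
    case 3 show ?case by (rule subMN)
  next
    case 4 then show ?case using assms(3) by auto
  next
    case (5 g)
    then show ?case using normal_conj[OF N] NC by (auto intro!: homI simp: m_assoc)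
  next
    case (6 x)
    then show ?case using NC by simp
  next
    case (7 g h x)
    then show ?case using NC by (simp add: m_assoc inv_mult_group)
  next
    case (8 g x)
    then show ?case using normal_conj[OF N] normal_conj[OF M] by auto
  next
    case (9 v)
    then show ?case using that by auto
  qed
  have "comm_elt G v g \<in> M" if g: "g \<in> carrier G" for g
  proof -
    have "(inv g \<otimes> v \<otimes> g) \<otimes> inv v \<in> M"
      using v(3)[of "inv g"] g v(1) subN m_inv_consistent by simp
    then have "inv v \<otimes> ((inv g \<otimes> v \<otimes> g) \<otimes> inv v) \<otimes> v \<in> M"
      using normal_conj[OF M] NC v by blast
    then show ?thesis using NC v g by (simp add: word_simps)
  qed
  then show ?thesis using that v by blast
qed

text \<open>The last p-power of the element from \<open>central_step\<close> that is still outside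
  \<open>M\<close> will do, since being central modulo \<open>M\<close> passes to powers.\<close>

lemma central_step_pow:
  assumes M: "M \<lhd> G" and N: "N \<lhd> G" and "\<not> N \<subseteq> M"
  obtains n where "n \<in> N" "n \<notin> M" "\<And>g. g \<in> carrier G \<Longrightarrow> comm_elt G n g \<in> M" "n [^] p \<in> M"
proof -
  have subM: "subgroup M G" and subN: "subgroup N G" using M N normal_imp_subgroup by auto
  obtain x where x: "x \<in> N" "x \<notin> M" "\<And>g. g \<in> carrier G \<Longrightarrow> comm_elt G x g \<in> M"
    using central_step[OF assms] by blast
  have xC: "x \<in> carrier G" using x subgroup.mem_carrier[OF subN] by blast
  obtain n where n: "order G = p ^ n" using order_pow by blast
  have top: "x [^] (p ^ n) \<in> M"
    using pow_order_eq_1[OF xC] n subgroup.one_closed[OF subM] by simp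
  define j where "j = (LEAST j. x [^] (p ^ j) \<in> M)"
  have j: "x [^] (p ^ j) \<in> M" unfolding j_def by (rule LeastI[where P = "\<lambda>j. x [^] (p ^ j) \<in> M"]) (rule top)
  have "j \<noteq> 0" using j x(2) xC by (metis nat_pow_eone power_0)
  then obtain k where k: "j = Suc k" using not0_implies_Suc by blast
  define y where "y = x [^] (p ^ k)"
  have yM: "y \<notin> M" unfolding y_def using not_less_Least[of k "\<lambda>j. x [^] (p ^ j) \<in> M"] k j_def by auto
  have yp: "y [^] p \<in> M" unfolding y_def using j k xC by (simp add: nat_pow_pow mult.commute)
  have "x [^] i \<in> N \<and> (\<forall>g\<in>carrier G. comm_elt G (x [^] i) g \<in> M)" for i :: nat
  proof (induction i)
    case 0
    then show ?case using subgroup.one_closed[OF subM] subgroup.one_closed[OF subN] by simp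
  next
    case (Suc i)
    then show ?case
      using subgroup.m_closed[OF subN] x xC normal_comm_elt_subst(4)[OF M] by simp
  qed
  then show ?thesis using that yM yp unfolding y_def by blast
qed

lemma normal_meets_center:
  assumes N: "N \<lhd> G" and "N \<noteq> {\<one>}"
  obtains z where "z \<in> N" "z \<noteq> \<one>" "\<And>g. g \<in> carrier G \<Longrightarrow> z \<otimes> g = g \<otimes> z"
proof -
  have subN: "subgroup N G" using N normal_imp_subgroup by auto
  have "\<not> N \<subseteq> {\<one>}" using assms subgroup.one_closed[OF subN] by auto
  then obtain n where n: "n \<in> N" "n \<notin> {\<one>}" "\<And>g. g \<in> carrier G \<Longrightarrow> comm_elt G n g \<in> {\<one>}"
    using central_step[OF one_is_normal N] by metis
  have nC: "n \<in> carrier G" using n subgroup.mem_carrier[OF subN] by blast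
  show ?thesis
  proof (rule that)
    show "n \<otimes> g = g \<otimes> n" if "g \<in> carrier G" for g
      using n(3)[OF that] comm_elt_eq_one_iff[OF nC that] by simp
  qed (use n in auto)
qed

lemma eq_if_card_le: "subgroup H G \<Longrightarrow> K \<subseteq> H \<Longrightarrow> card H \<le> card K \<Longrightarrow> K = H"
  using fin_subgroup card_seteq by blast

end

text \<open>Replaces the homomorphism theorem for index estimates; the map may be far from a
  homomorphism, as in \<open>replacement_one\<close>.\<close>

lemma card_le_fibers:
  assumes "finite A" "finite B" "f ` A \<subseteq> B" "\<And>y. card {x \<in> A. f x = y} \<le> k"
  shows "card A \<le> card B * k"
proof -
  have "card A = (\<Sum>y\<in>f ` A. card {x \<in> A. f x = y})"
    unfolding card_eq_sum by (rule sum.image_gen) (fact assms)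
  also have "\<dots> \<le> card (f ` A) * k" using sum_bounded_above[of "f ` A" "\<lambda>y. card {x \<in> A. f x = y}" k] assms by simp
  also have "\<dots> \<le> card B * k" using card_mono[OF assms(2,3)] by simp
  finally show ?thesis .
qed

lemma (in group) commute_inv:
  assumes "x \<in> carrier G" "y \<in> carrier G" "x \<otimes> y = y \<otimes> x"
  shows "inv x \<otimes> y = y \<otimes> inv x"
proof -
  have "inv x \<otimes> y = inv x \<otimes> (y \<otimes> x) \<otimes> inv x" using assms(1,2) by (simp add: m_assoc)
  also have "\<dots> = y \<otimes> inv x" unfolding assms(3)[symmetric] using assms(1,2) by (simp add: m_assoc)
  finally show ?thesis .
qed

section \<open>Modules and quadratic elements\<close>

text \<open>The division by two needed in \<open>quad_comm_elt\<close>: the product of both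
  equations gives equal squares of \<open>a \<otimes> c\<close> and \<open>b \<otimes> b\<close>,
  and squaring is injective when there are no involutions.\<close>

lemma (in comm_group) mult_eq_square:
  assumes "a \<in> carrier G" "b \<in> carrier G" "c \<in> carrier G" "v \<in> carrier G" "w \<in> carrier G"
    and 1: "a \<otimes> a \<otimes> w = b \<otimes> b \<otimes> v" and 2: "c \<otimes> c \<otimes> v = b \<otimes> b \<otimes> w"
    and odd: "\<And>x. x \<in> carrier G \<Longrightarrow> x \<otimes> x = \<one> \<Longrightarrow> x = \<one>"
  shows "a \<otimes> c = b \<otimes> b"
proof -
  have "(a \<otimes> c) \<otimes> (a \<otimes> c) \<otimes> (w \<otimes> v) = (a \<otimes> a \<otimes> w) \<otimes> (c \<otimes> c \<otimes> v)" using assms(1-5) by (simp add: m_ac)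
  also have "\<dots> = (b \<otimes> b) \<otimes> (b \<otimes> b) \<otimes> (w \<otimes> v)" unfolding 1 2 using assms(1-5) by (simp add: m_ac)
  finally have sq: "(a \<otimes> c) \<otimes> (a \<otimes> c) = (b \<otimes> b) \<otimes> (b \<otimes> b)"
    using assms(1-5) r_cancel[of "(a \<otimes> c) \<otimes> (a \<otimes> c)" "w \<otimes> v" "(b \<otimes> b) \<otimes> (b \<otimes> b)"] by simp
  define u where "u = (a \<otimes> c) \<otimes> inv (b \<otimes> b)"
  have uC: "u \<in> carrier G" unfolding u_def using assms(1-5) by simp
  have "u \<otimes> u = ((a \<otimes> c) \<otimes> (a \<otimes> c)) \<otimes> inv ((b \<otimes> b) \<otimes> (b \<otimes> b))"
    unfolding u_def using assms(1-5) by (simp add: m_ac inv_mult)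
  also have "\<dots> = \<one>" unfolding sq using assms(1-5) r_inv[of "(b \<otimes> b) \<otimes> (b \<otimes> b)"] by simp
  finally have "u = \<one>" using odd uC by blast
  then show ?thesis unfolding u_def using assms(1-5)
    by (metis inv_closed inv_equality inv_inv m_closed)
qed

locale p_module = G: p_group G p + V: comm_group V
  for G (structure) and p and V :: "('v, 'w) monoid_scheme" +
  fixes \<rho> :: "'a \<Rightarrow> 'v \<Rightarrow> 'v"
  assumes V_order: "\<exists>m. order V = p ^ m"
    and V_exp: "\<And>v. v \<in> carrier V \<Longrightarrow> v [^]\<^bsub>V\<^esub> p = \<one>\<^bsub>V\<^esub>"
    and p_odd: "odd p"
    and hom: "\<And>g. g \<in> carrier G \<Longrightarrow> \<rho> g \<in> hom V V"
    and act_one: "\<And>v. v \<in> carrier V \<Longrightarrow> \<rho> \<one> v = v"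
    and act_mult: "\<And>g h v. \<lbrakk>g \<in> carrier G; h \<in> carrier G; v \<in> carrier V\<rbrakk> \<Longrightarrow> \<rho> (g \<otimes> h) v = \<rho> g (\<rho> h v)"
    and faithful: "\<And>g. g \<in> carrier G \<Longrightarrow> (\<And>v. v \<in> carrier V \<Longrightarrow> \<rho> g v = v) \<Longrightarrow> g = \<one>"
begin

abbreviation vmult (infixl "\<star>" 70) where "x \<star> y \<equiv> x \<otimes>\<^bsub>V\<^esub> y"
abbreviation vone ("\<epsilon>") where "\<epsilon> \<equiv> \<one>\<^bsub>V\<^esub>"
abbreviation vinv where "vinv x \<equiv> inv\<^bsub>V\<^esub> x"

text \<open>As \<open>V\<close> is written multiplicatively, \<open>dl g\<close> is the operator \<open>g - 1\<close>, and \<open>quad g\<close> says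
  that \<open>(g - 1)\<^sup>2 = 0\<close>. A subgroup \<open>E\<close> is an offender if \<open>j E \<ge> \<bar>V\<bar> = j {\<one>}\<close>.\<close>

definition dl :: "'a \<Rightarrow> 'v \<Rightarrow> 'v" where "dl g v = \<rho> g v \<star> vinv v"
definition Fix :: "'a set \<Rightarrow> 'v set" where "Fix E = {v \<in> carrier V. \<forall>g\<in>E. \<rho> g v = v}"
definition j :: "'a set \<Rightarrow> nat" where "j E = card E * card (Fix E)"
definition quad :: "'a \<Rightarrow> bool" where "quad g \<longleftrightarrow> (\<forall>v\<in>carrier V. \<rho> g (dl g v) = dl g v)"

sublocale VP: p_group V p
  using V_order G.p by unfold_locales auto

lemma p_ge_3: "p \<ge> 3"
  using p_odd G.p_gt_1 by presburger

lemma act_closed [simp]: "g \<in> carrier G \<Longrightarrow> v \<in> carrier V \<Longrightarrow> \<rho> g v \<in> carrier V"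
  using hom by (auto simp: hom_def)

lemma act_vmult [simp]: "\<lbrakk>g \<in> carrier G; v \<in> carrier V; w \<in> carrier V\<rbrakk> \<Longrightarrow> \<rho> g (v \<star> w) = \<rho> g v \<star> \<rho> g w"
  using hom by (auto simp: hom_def)

lemma act_vone [simp]: "g \<in> carrier G \<Longrightarrow> \<rho> g \<epsilon> = \<epsilon>"
  using hom_one[OF hom V.is_group V.is_group] by simp

lemma act_vinv [simp]:
  assumes "g \<in> carrier G" "v \<in> carrier V" shows "\<rho> g (vinv v) = vinv (\<rho> g v)"
  using group_hom.hom_inv[of V V "\<rho> g" v] hom assms V.is_group
  by (simp add: group_hom_def group_hom_axioms_def)

declare act_one [simp]

lemma act_inv_cancel [simp]:
  assumes "g \<in> carrier G" "v \<in> carrier V"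
  shows "\<rho> g (\<rho> (inv g) v) = v" "\<rho> (inv g) (\<rho> g v) = v"
  using assms by (simp_all flip: act_mult)

lemma act_inj: "\<lbrakk>g \<in> carrier G; v \<in> carrier V; w \<in> carrier V; \<rho> g v = \<rho> g w\<rbrakk> \<Longrightarrow> v = w"
  by (metis act_inv_cancel(2))

lemma act_comm:
  assumes "g \<in> carrier G" "h \<in> carrier G" "g \<otimes> h = h \<otimes> g" "v \<in> carrier V"
  shows "\<rho> g (\<rho> h v) = \<rho> h (\<rho> g v)"
  using assms by (metis act_mult)

lemma dl_closed [simp]: "g \<in> carrier G \<Longrightarrow> v \<in> carrier V \<Longrightarrow> dl g v \<in> carrier V"
  by (simp add: dl_def)

lemma dl_vmult: "\<lbrakk>g \<in> carrier G; v \<in> carrier V; w \<in> carrier V\<rbrakk> \<Longrightarrow> dl g (v \<star> w) = dl g v \<star> dl g w"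
  by (simp add: dl_def V.inv_mult V.m_ac)

lemma dl_vone [simp]: "g \<in> carrier G \<Longrightarrow> dl g \<epsilon> = \<epsilon>"
  by (simp add: dl_def)

lemma dl_hom: "g \<in> carrier G \<Longrightarrow> dl g \<in> hom V V"
  by (rule homI) (simp_all add: dl_vmult)

lemma dl_vinv: "g \<in> carrier G \<Longrightarrow> v \<in> carrier V \<Longrightarrow> dl g (vinv v) = vinv (dl g v)"
  by (simp add: dl_def V.inv_mult)

lemma dl_eq_one_iff: "g \<in> carrier G \<Longrightarrow> v \<in> carrier V \<Longrightarrow> dl g v = \<epsilon> \<longleftrightarrow> \<rho> g v = v"
  unfolding dl_def by (metis V.inv_closed V.inv_equality V.inv_inv V.r_inv act_closed)

lemma act_eq_dl: "g \<in> carrier G \<Longrightarrow> v \<in> carrier V \<Longrightarrow> \<rho> g v = dl g v \<star> v"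
  by (simp add: dl_def V.m_assoc)

lemma act_dl_comm:
  assumes "g \<in> carrier G" "h \<in> carrier G" "g \<otimes> h = h \<otimes> g" "v \<in> carrier V"
  shows "\<rho> g (dl h v) = dl h (\<rho> g v)"
  using assms act_comm[OF assms] by (simp add: dl_def)

lemma dl_mult: "\<lbrakk>g \<in> carrier G; h \<in> carrier G; v \<in> carrier V\<rbrakk> \<Longrightarrow> dl (g \<otimes> h) v = \<rho> g (dl h v) \<star> dl g v"
  by (simp add: dl_def act_mult V.m_assoc)

lemma dl_funpow_closed [simp]: "z \<in> carrier G \<Longrightarrow> v \<in> carrier V \<Longrightarrow> (dl z ^^ k) v \<in> carrier V"
  by (induction k) auto

lemma dl_funpow_vone [simp]: "z \<in> carrier G \<Longrightarrow> (dl z ^^ k) \<epsilon> = \<epsilon>"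
  by (induction k) auto

lemma dl_funpow_vmult:
  "\<lbrakk>z \<in> carrier G; v \<in> carrier V; w \<in> carrier V\<rbrakk> \<Longrightarrow> (dl z ^^ k) (v \<star> w) = (dl z ^^ k) v \<star> (dl z ^^ k) w"
  by (induction k) (auto simp: dl_vmult)

lemma act_dl_funpow:
  assumes z: "z \<in> carrier G" and g: "g \<in> carrier G" and c: "z \<otimes> g = g \<otimes> z" and v: "v \<in> carrier V"
  shows "\<rho> g ((dl z ^^ k) v) = (dl z ^^ k) (\<rho> g v)"
  using act_dl_comm[OF g z c[symmetric]] z g v by (induction k) auto

text \<open>Rewrites (g - 1)^2 = 0 as g^2 + 1 = 2g, which is free of inverses and easy to transport
  along conjugation.\<close>

lemma quad_iff:
  assumes g: "g \<in> carrier G"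
  shows "quad g \<longleftrightarrow> (\<forall>v\<in>carrier V. \<rho> g (\<rho> g v) \<star> v = \<rho> g v \<star> \<rho> g v)"
proof -
  have "\<rho> g (dl g v) = dl g v \<longleftrightarrow> \<rho> g (\<rho> g v) \<star> v = \<rho> g v \<star> \<rho> g v" if v: "v \<in> carrier V" for v
  proof -
    have l: "\<rho> g (dl g v) \<star> (\<rho> g v \<star> v) = \<rho> g (\<rho> g v) \<star> v"
      using g v by (simp add: dl_def V.m_ac)
    have r: "dl g v \<star> (\<rho> g v \<star> v) = \<rho> g v \<star> \<rho> g v"
      using g v by (simp add: dl_def V.m_ac)
    show ?thesis using l r g v V.r_cancel[of "\<rho> g (dl g v)" "\<rho> g v \<star> v" "dl g v"] by auto
  qed
  then show ?thesis unfolding quad_def by auto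
qed

lemma quad_conj:
  assumes "quad x" "x \<in> carrier G" "g \<in> carrier G"
  shows "quad (inv g \<otimes> x \<otimes> g)"
proof -
  have "\<rho> (inv g) (\<rho> x (\<rho> x (\<rho> g v))) \<star> v = \<rho> (inv g) (\<rho> x (\<rho> g v)) \<star> \<rho> (inv g) (\<rho> x (\<rho> g v))"
    if v: "v \<in> carrier V" for v
  proof -
    have "\<rho> x (\<rho> x (\<rho> g v)) \<star> \<rho> g v = \<rho> x (\<rho> g v) \<star> \<rho> x (\<rho> g v)"
      using assms v by (simp add: quad_iff)
    then have "\<rho> (inv g) (\<rho> x (\<rho> x (\<rho> g v)) \<star> \<rho> g v) = \<rho> (inv g) (\<rho> x (\<rho> g v) \<star> \<rho> x (\<rho> g v))" by simp
    then show ?thesis using assms v by simp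
  qed
  then show ?thesis using assms by (simp add: quad_iff act_mult)
qed

lemma quad_inv:
  assumes "quad x" "x \<in> carrier G" shows "quad (inv x)"
proof -
  have "\<rho> (inv x) (\<rho> (inv x) v) \<star> v = \<rho> (inv x) v \<star> \<rho> (inv x) v" if v: "v \<in> carrier V" for v
  proof -
    have "\<rho> x (\<rho> x (\<rho> (inv x) (\<rho> (inv x) v))) \<star> \<rho> (inv x) (\<rho> (inv x) v)
        = \<rho> x (\<rho> (inv x) (\<rho> (inv x) v)) \<star> \<rho> x (\<rho> (inv x) (\<rho> (inv x) v))"
      by (rule bspec[OF iffD1[OF quad_iff[OF assms(2)] assms(1)]]) (use assms v in simp)
    then show ?thesis using assms(2) v by (simp add: V.m_comm)
  qed
  then show ?thesis using assms by (simp add: quad_iff)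
qed

text \<open>Since \<open>x\<close>, \<open>x z\<close> and \<open>x z\<inverse>\<close> are conjugate, all three satisfy the quadratic identity; comparing
  the three identities gives \<open>2 x (z - 1)\<^sup>2 = 0\<close>.\<close>

lemma quad_comm_elt:
  assumes x: "x \<in> carrier G" and y: "y \<in> carrier G" and q: "quad x"
    and z: "z = comm_elt G x y" and xz: "x \<otimes> z = z \<otimes> x" and yz: "y \<otimes> z = z \<otimes> y"
  shows "quad z"
proof -
  have zC: "z \<in> carrier G" using x y z by simp
  have "inv y \<otimes> x \<otimes> y = x \<otimes> z" using x y z by (simp add: G.conj_eq_comm_elt)
  then have q2: "quad (x \<otimes> z)" using quad_conj[OF q x y] by simp
  have "y \<otimes> x \<otimes> inv y = x \<otimes> inv z"
  proof -
    have c: "inv y \<otimes> z = z \<otimes> inv y"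
      using G.commute_inv[OF y zC yz] .
    have "x = y \<otimes> (inv y \<otimes> x \<otimes> y) \<otimes> inv y" using x y by (simp add: G.m_assoc)
    also have "inv y \<otimes> x \<otimes> y = x \<otimes> z" by fact
    also have "y \<otimes> (x \<otimes> z) \<otimes> inv y = (y \<otimes> x \<otimes> inv y) \<otimes> z"
      using x y zC c by (simp add: G.m_assoc)
    finally show ?thesis using x y zC by (simp add: G.inv_solve_right)
  qed
  then have q3: "quad (x \<otimes> inv z)" using quad_conj[OF q x, of "inv y"] y by simp
  have "\<rho> z (\<rho> z v) \<star> v = \<rho> z v \<star> \<rho> z v" if v: "v \<in> carrier V" for v
  proof -
    let ?X = "\<rho> x" and ?Z = "\<rho> z"
    have com: "?Z (?X w) = ?X (?Z w)" if "w \<in> carrier V" for w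
      using act_comm[OF zC x xz[symmetric] that] .
    define w where "w = ?Z (?Z v)"
    have C: "?X v \<in> carrier V" "?X (?Z v) \<in> carrier V" "?X w \<in> carrier V" "w \<in> carrier V" "?X (?X v) \<in> carrier V" "?X (?X w) \<in> carrier V"
      unfolding w_def using x zC v by auto
    have e1: "?X (?X v) \<star> v = ?X v \<star> ?X v" using q v x by (simp add: quad_iff)
    have e1': "?X (?X w) \<star> w = ?X w \<star> ?X w" using q C x by (simp add: quad_iff)
    have e2: "?X (?X w) \<star> v = ?X (?Z v) \<star> ?X (?Z v)"
      using q2 v x zC unfolding w_def by (simp add: quad_iff act_mult com)
    have "\<rho> (x \<otimes> inv z) (\<rho> (x \<otimes> inv z) w) \<star> w = \<rho> (x \<otimes> inv z) w \<star> \<rho> (x \<otimes> inv z) w"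
      using q3 C x zC by (simp add: quad_iff)
    moreover have "\<rho> (x \<otimes> inv z) w = ?X (?Z v)" unfolding w_def using x zC v by (simp add: act_mult)
    moreover have "\<rho> (x \<otimes> inv z) (?X (?Z v)) = ?X (?X v)"
      using x zC v by (simp add: act_mult flip: com)
    ultimately have e3: "?X (?X v) \<star> w = ?X (?Z v) \<star> ?X (?Z v)" by simp
    have A: "?X v \<star> ?X v \<star> w = ?X (?Z v) \<star> ?X (?Z v) \<star> v"
      unfolding e1[symmetric] e3[symmetric] using C v by (simp add: V.m_ac)
    have B: "?X w \<star> ?X w \<star> v = ?X (?Z v) \<star> ?X (?Z v) \<star> w"
      unfolding e1'[symmetric] e2[symmetric] using C v by (simp add: V.m_ac)
    \<comment> \<open>Additively, \<open>A\<close> and \<open>B\<close> read 2xv + w = 2xzv + v and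
      2xw + v = 2xzv + w. Half of their sum is xv + xw = 2xzv, and x can be cancelled.\<close>
    have "?X v \<star> ?X w = ?X (?Z v) \<star> ?X (?Z v)"
      using V.mult_eq_square[OF C(1,2,3) v C(4) A B VP.sq_one_odd[OF p_odd]] .
    then have "?X (v \<star> w) = ?X (?Z v \<star> ?Z v)" using x zC v C by simp
    then have "v \<star> w = ?Z v \<star> ?Z v" using act_inj[OF x] v C zC by simp
    then show ?thesis unfolding w_def using v C zC by (simp add: V.m_comm)
  qed
  then show ?thesis using zC by (simp add: quad_iff)
qed

text \<open>On a quadratic element g^n = 1 + n(g - 1). For n = p this is the identity on
  \<open>V\<close>, so by faithfulness non-trivial quadratic elements have order p.\<close>

lemma quad_pow_act:
  assumes "quad g" "g \<in> carrier G" "v \<in> carrier V"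
  shows "\<rho> (g [^] (n::nat)) v = dl g v [^]\<^bsub>V\<^esub> n \<star> v"
proof (induction n)
  case (Suc n)
  have "\<rho> (g [^] Suc n) v = \<rho> (g [^] n) (\<rho> g v)" using assms by (simp add: act_mult)
  also have "\<dots> = \<rho> (g [^] n) (dl g v) \<star> \<rho> (g [^] n) v"
    unfolding act_eq_dl[OF assms(2,3)] using assms by simp
  also have "\<rho> (g [^] n) (dl g v) = dl g v"
  proof (induction n)
    case (Suc n)
    then show ?case using assms by (simp add: act_mult quad_def)
  qed (use assms in simp)
  finally show ?case using Suc assms by (simp add: V.m_ac)
qed (use assms in simp)

lemma quad_order: "quad g \<Longrightarrow> g \<in> carrier G \<Longrightarrow> g [^] p = \<one>"
  by (rule faithful) (simp_all add: quad_pow_act V_exp)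

lemma Fix_subgroup:
  assumes "E \<subseteq> carrier G" shows "subgroup (Fix E) V"
proof (rule V.subgroupI)
  show "Fix E \<noteq> {}" using assms unfolding Fix_def by (auto intro!: exI[of _ \<epsilon>])
qed (use assms in \<open>auto simp: Fix_def subset_iff\<close>)

lemma Fix_antimono: "E \<subseteq> F \<Longrightarrow> Fix F \<subseteq> Fix E"
  unfolding Fix_def by auto

lemma Fix_one: "Fix {\<one>} = carrier V"
  unfolding Fix_def by auto

lemma j_one: "j {\<one>} = card (carrier V)"
  unfolding j_def Fix_one by simp

lemma Fix_mult:
  assumes "subgroup E G" "subgroup F G"
  shows "Fix (E <#> F) = Fix E \<inter> Fix F"
proof
  have C: "\<And>x. x \<in> E \<Longrightarrow> x \<in> carrier G" "\<And>x. x \<in> F \<Longrightarrow> x \<in> carrier G"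
    using subgroup.mem_carrier[OF assms(1)] subgroup.mem_carrier[OF assms(2)] by auto
  have o: "\<one> \<in> E" "\<one> \<in> F" using subgroup.one_closed[OF assms(1)] subgroup.one_closed[OF assms(2)] by auto
  have "E \<subseteq> E <#> F" "F \<subseteq> E <#> F" unfolding set_mult_def using o C by force+
  then show "Fix (E <#> F) \<subseteq> Fix E \<inter> Fix F" using Fix_antimono by blast
  show "Fix E \<inter> Fix F \<subseteq> Fix (E <#> F)"
    unfolding Fix_def set_mult_def using C by (auto simp: act_mult)
qed

lemma Fix_conj:
  assumes "E \<subseteq> carrier G" "g \<in> carrier G"
  shows "Fix ((\<lambda>x. g \<otimes> x \<otimes> inv g) ` E) = \<rho> g ` Fix E"
proof
  show "Fix ((\<lambda>x. g \<otimes> x \<otimes> inv g) ` E) \<subseteq> \<rho> g ` Fix E"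
  proof
    fix v assume v: "v \<in> Fix ((\<lambda>x. g \<otimes> x \<otimes> inv g) ` E)"
    have vV: "v \<in> carrier V" using v unfolding Fix_def by auto
    have "\<rho> e (\<rho> (inv g) v) = \<rho> (inv g) v" if e: "e \<in> E" for e
    proof -
      have eC: "e \<in> carrier G" using e assms by auto
      have "\<rho> (g \<otimes> e \<otimes> inv g) v = v" using v e unfolding Fix_def by auto
      then have "\<rho> g (\<rho> e (\<rho> (inv g) v)) = v" using vV eC assms by (simp add: act_mult)
      then show ?thesis using vV eC assms by (metis act_closed act_inv_cancel(2) G.inv_closed)
    qed
    then have "\<rho> (inv g) v \<in> Fix E" unfolding Fix_def using vV assms by auto
    moreover have "v = \<rho> g (\<rho> (inv g) v)" using vV assms by simp
    ultimately show "v \<in> \<rho> g ` Fix E" by blast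
  qed
  show "\<rho> g ` Fix E \<subseteq> Fix ((\<lambda>x. g \<otimes> x \<otimes> inv g) ` E)"
    unfolding Fix_def using assms by (auto simp: act_mult subset_iff)
qed

lemma j_conj:
  assumes "E \<subseteq> carrier G" "g \<in> carrier G"
  shows "j ((\<lambda>x. g \<otimes> x \<otimes> inv g) ` E) = j E"
proof -
  have "inj_on (\<rho> g) (Fix E)" using act_inj[OF assms(2)] unfolding inj_on_def Fix_def by auto
  moreover have "inj_on (\<lambda>x. g \<otimes> x \<otimes> inv g) E"
    using assms unfolding inj_on_def by (auto simp: subset_iff)
  ultimately show ?thesis unfolding j_def Fix_conj[OF assms] by (simp add: card_image)
qed

end

section \<open>Offenders and replacement\<close>

lemma set_mult_memI: "h \<in> H \<Longrightarrow> k \<in> K \<Longrightarrow> h \<otimes>\<^bsub>G\<^esub> k \<in> H <#>\<^bsub>G\<^esub> K"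
  unfolding set_mult_def by blast

lemma (in group) centralizer_subgroup:
  assumes "K \<subseteq> carrier G" shows "subgroup (centralizer G K) G"
proof (rule subgroupI)
  fix a assume a: "a \<in> centralizer G K"
  then show "inv a \<in> centralizer G K" using assms commute_inv[of a] unfolding centralizer_def by auto
  fix b assume b: "b \<in> centralizer G K"
  have "a \<otimes> b \<otimes> k = k \<otimes> (a \<otimes> b)" if k: "k \<in> K" for k
  proof -
    have C: "a \<in> carrier G" "b \<in> carrier G" "k \<in> carrier G" using a b k assms unfolding centralizer_def by auto
    have "a \<otimes> b \<otimes> k = a \<otimes> (k \<otimes> b)" using b k C unfolding centralizer_def by (simp add: m_assoc)
    also have "\<dots> = k \<otimes> a \<otimes> b" using a k C unfolding centralizer_def by (simp flip: m_assoc)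
    finally show ?thesis using C by (simp add: m_assoc)
  qed
  then show "a \<otimes> b \<in> centralizer G K" using a b unfolding centralizer_def by auto
next
  have "\<one> \<in> centralizer G K" using assms unfolding centralizer_def by auto
  then show "centralizer G K \<noteq> {}" by blast
qed (auto simp: centralizer_def)

text \<open>Centralizers are taken twice: \<open>K\<close> centralizes itself, so the generated
  subgroup centralizes \<open>K\<close>, so \<open>K\<close> and then the generated subgroup
  centralize the generated subgroup.\<close>

lemma (in group) generate_commute:
  assumes K: "K \<subseteq> carrier G" and c: "\<And>a b. a \<in> K \<Longrightarrow> b \<in> K \<Longrightarrow> a \<otimes> b = b \<otimes> a"
    and "a \<in> generate G K" "b \<in> generate G K"
  shows "a \<otimes> b = b \<otimes> a"
proof -
  have "K \<subseteq> centralizer G K" using K c unfolding centralizer_def by auto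
  then have 1: "generate G K \<subseteq> centralizer G K" using generate_subgroup_incl centralizer_subgroup[OF K] by blast
  have gC: "generate G K \<subseteq> carrier G" using generate_incl[OF K] .
  have "K \<subseteq> centralizer G (generate G K)" using 1 K unfolding centralizer_def by fastforce
  then have "generate G K \<subseteq> centralizer G (generate G K)"
    using generate_subgroup_incl centralizer_subgroup[OF gC] by blast
  then show ?thesis using assms(3,4) unfolding centralizer_def by blast
qed

lemma (in group) set_mult_subgroup_commute:
  assumes H: "subgroup H G" and K: "subgroup K G" and c: "\<And>h k. h \<in> H \<Longrightarrow> k \<in> K \<Longrightarrow> h \<otimes> k = k \<otimes> h"
  shows "subgroup (H <#> K) G"
proof (rule subgroupI)
  have C: "\<And>x. x \<in> H \<Longrightarrow> x \<in> carrier G" "\<And>x. x \<in> K \<Longrightarrow> x \<in> carrier G"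
    using subgroup.mem_carrier[OF H] subgroup.mem_carrier[OF K] by auto
  show "H <#> K \<subseteq> carrier G" using C unfolding set_mult_def by auto
  show "H <#> K \<noteq> {}" using subgroup.one_closed[OF H] subgroup.one_closed[OF K] unfolding set_mult_def by blast
  fix a assume "a \<in> H <#> K"
  then obtain h k where a: "h \<in> H" "k \<in> K" "a = h \<otimes> k" unfolding set_mult_def by auto
  have "inv a = inv h \<otimes> inv k"
    using a C c[of h k] inv_mult_group[of k h] by simp
  then show "inv a \<in> H <#> K"
    using a subgroup.m_inv_closed[OF H] subgroup.m_inv_closed[OF K] set_mult_memI by metis
  fix b assume "b \<in> H <#> K"
  then obtain h' k' where b: "h' \<in> H" "k' \<in> K" "b = h' \<otimes> k'" unfolding set_mult_def by auto
  have "a \<otimes> b = h \<otimes> (k \<otimes> h') \<otimes> k'" using a b C by (simp add: m_assoc)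
  also have "\<dots> = (h \<otimes> h') \<otimes> (k \<otimes> k')" using a b C c[of h' k, symmetric] by (simp add: m_assoc)
  finally show "a \<otimes> b \<in> H <#> K"
    using a b subgroup.m_closed[OF H] subgroup.m_closed[OF K] set_mult_memI by metis
qed

context p_module
begin

text \<open>The subgroup [V, E] C_V(E). It is a ceiling for the fixed points of all replacements of
  \<open>E\<close>; as it is proper, no replacement can be trivial.\<close>

definition comm_fix :: "'a set \<Rightarrow> 'v set" where
  "comm_fix E = generate V ({dl e v | e v. e \<in> E \<and> v \<in> carrier V} \<union> Fix E)"

lemma comm_fix_subgroup: "E \<subseteq> carrier G \<Longrightarrow> subgroup (comm_fix E) V"
  unfolding comm_fix_def by (rule V.generate_is_subgroup) (auto simp: Fix_def)

text \<open>Let \<open>T\<close> be a maximal proper \<open>E\<close>-invariant subgroup above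
  C_V(E). The p-group \<open>E\<close> has non-trivial fixed points on V/T; their preimage is
  invariant, hence all of \<open>V\<close>, which means [V, E] <= T.\<close>

lemma comm_fix_proper:
  assumes E: "subgroup E G" and "Fix E \<noteq> carrier V"
  shows "comm_fix E \<noteq> carrier V"
proof -
  have EC: "\<And>e. e \<in> E \<Longrightarrow> e \<in> carrier G" using subgroup.mem_carrier[OF E] .
  define TT where "TT = {T. subgroup T V \<and> T \<noteq> carrier V \<and> Fix E \<subseteq> T \<and> (\<forall>e\<in>E. \<forall>v\<in>T. \<rho> e v \<in> T)}"
  have "Fix E \<in> TT" unfolding TT_def using Fix_subgroup[of E] assms EC by (auto simp: Fix_def)
  moreover have "finite TT"
    by (rule finite_subset[of _ "Pow (carrier V)"]) (use VP.fin subgroup.subset TT_def in auto)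
  ultimately obtain T where T: "T \<in> TT" and max: "\<forall>T'\<in>TT. T \<subseteq> T' \<longrightarrow> T = T'"
    using finite_has_maximal by blast
  have sT: "subgroup T V" "T \<noteq> carrier V" and FT: "Fix E \<subseteq> T" and inv: "\<And>e v. e \<in> E \<Longrightarrow> v \<in> T \<Longrightarrow> \<rho> e v \<in> T"
    using T unfolding TT_def by auto
  have TC: "\<And>v. v \<in> T \<Longrightarrow> v \<in> carrier V" using subgroup.mem_carrier[OF sT(1)] .
  obtain n where n: "card E = p ^ n" using G.card_subgroup_pow[OF E] .
  obtain m where m: "order V = p ^ m" using V_order by blast
  obtain v where v: "v \<in> carrier V" "v \<notin> T" "\<And>g. g \<in> E \<Longrightarrow> \<rho> g v \<star> vinv v \<in> T"
  proof (rule fixed_point_outside_subgroup[of "G\<lparr>carrier := E\<rparr>" p n V m T \<rho>], goal_cases)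
    case 1 show ?case by (rule G.subgroup_imp_group[OF E])
  next
    case (12 v)
    then show ?case using that by auto
  qed (use n m sT G.p V.is_group E EC hom inv act_mult in \<open>auto simp: order_def\<close>)
  define T' where "T' = {v \<in> carrier V. \<forall>e\<in>E. dl e v \<in> T}"
  have TT': "T \<subseteq> T'" unfolding T'_def dl_def
    using TC inv subgroup.m_closed[OF sT(1)] subgroup.m_inv_closed[OF sT(1)] by auto
  have sT': "subgroup T' V"
  proof (rule V.subgroupI)
    show "T' \<noteq> {}" using TT' subgroup.one_closed[OF sT(1)] by auto
  qed (auto simp: T'_def EC dl_vmult dl_vinv subgroup.m_closed[OF sT(1)] subgroup.m_inv_closed[OF sT(1)])
  have "\<rho> f w \<in> T'" if "f \<in> E" "w \<in> T'" for f w
  proof -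
    have w: "w \<in> carrier V" "\<And>e. e \<in> E \<Longrightarrow> dl e w \<in> T" using that unfolding T'_def by auto
    have "dl e (\<rho> f w) \<in> T" if e: "e \<in> E" for e
    proof -
      have "dl e (\<rho> f w) = dl e (dl f w) \<star> dl e w"
        using e w \<open>f \<in> E\<close> EC by (simp add: act_eq_dl[of f w] dl_vmult)
      moreover have "dl e (dl f w) \<in> T" using TT' w \<open>f \<in> E\<close> e unfolding T'_def by blast
      ultimately show ?thesis using w e subgroup.m_closed[OF sT(1)] by simp
    qed
    then show ?thesis unfolding T'_def using w that EC by simp
  qed
  moreover have "v \<in> T'" unfolding T'_def dl_def using v by simp
  ultimately have "T' = carrier V" using max TT' sT' FT v(2) unfolding TT_def by blast
  then have "{dl e v | e v. e \<in> E \<and> v \<in> carrier V} \<union> Fix E \<subseteq> T" using FT unfolding T'_def by blast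
  then have "comm_fix E \<subseteq> T" unfolding comm_fix_def using V.generate_subgroup_incl sT(1) by blast
  then show ?thesis using sT TC by blast
qed

lemma Fix_eq_carrier:
  assumes "subgroup E G" "Fix E = carrier V" shows "E = {\<one>}"
proof -
  have "e = \<one>" if "e \<in> E" for e
    using faithful[of e] that assms subgroup.mem_carrier[OF assms(1)] unfolding Fix_def by auto
  then have "E \<subseteq> {\<one>}" by blast
  then show ?thesis using subgroup.one_closed[OF assms(1)] by blast
qed

text \<open>Replacement in the style of Thompson and Timmesfeld: the subgroup of \<open>E\<close> fixing \<open>[v, E]\<close>
  is again extremal for \<open>j\<close>, because \<open>e \<mapsto> [v, e]\<close> is injective modulo it.\<close>

lemma replacement_one:
  assumes E: "subgroup E G" and ab: "\<And>e f. e \<in> E \<Longrightarrow> f \<in> E \<Longrightarrow> e \<otimes> f = f \<otimes> e"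
    and max: "\<And>F. subgroup F G \<Longrightarrow> F \<subseteq> E \<Longrightarrow> j F \<le> j E" and v: "v \<in> carrier V"
  defines "F \<equiv> {e \<in> E. \<forall>f\<in>E. \<rho> e (dl f v) = dl f v}"
  shows "subgroup F G" "j F = j E" "Fix F \<subseteq> comm_fix E"
proof -
  have EC: "\<And>e. e \<in> E \<Longrightarrow> e \<in> carrier G" using subgroup.mem_carrier[OF E] .
  have FixC: "\<And>u. u \<in> Fix E \<Longrightarrow> u \<in> carrier V" unfolding Fix_def by auto
  show F: "subgroup F G"
  proof (rule G.subgroupI)
    show "F \<noteq> {}" unfolding F_def using subgroup.one_closed[OF E] v EC by (auto intro!: exI[of _ \<one>])
    show "F \<subseteq> carrier G" using EC unfolding F_def by auto
  next
    fix a assume a: "a \<in> F"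
    have "\<rho> (inv a) (dl f v) = dl f v" if "f \<in> E" for f
      using a that v EC act_inv_cancel(2)[of a "dl f v"] unfolding F_def by simp
    then show "inv a \<in> F" using a subgroup.m_inv_closed[OF E] unfolding F_def by auto
    fix b assume "b \<in> F"
    then show "a \<otimes> b \<in> F" using a subgroup.m_closed[OF E] v EC unfolding F_def by (auto simp: act_mult)
  qed
  have FE: "F \<subseteq> E" unfolding F_def by auto
  define U where "U = comm_fix E"
  have U: "subgroup U V" unfolding U_def using comm_fix_subgroup EC by blast
  define f where "f = (\<lambda>(e, u). dl e v \<star> u)"
  have gen: "dl e v \<in> U" "u \<in> Fix E \<Longrightarrow> u \<in> U" if "e \<in> E" for e u
    using that v unfolding U_def comm_fix_def by (auto intro!: generate.incl)
  have "card (E \<times> Fix E) \<le> card (U \<inter> Fix F) * card F"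
  proof (rule card_le_fibers[where f = f])
    show "finite (E \<times> Fix E)" "finite (U \<inter> Fix F)"
      using G.fin_subgroup[OF E] VP.fin_subgroup[OF Fix_subgroup[of E]] VP.fin_subgroup[OF U] EC by auto
    show "f ` (E \<times> Fix E) \<subseteq> U \<inter> Fix F"
    proof (clarify, rule IntI)
      fix e u assume e: "e \<in> E" and u: "u \<in> Fix E"
      show "f (e, u) \<in> U" using gen[OF e] u subgroup.m_closed[OF U] unfolding f_def by simp
      have "\<rho> g (dl e v \<star> u) = dl e v \<star> u" if g: "g \<in> F" for g
      proof -
        have "\<rho> g (dl e v) = dl e v" "\<rho> g u = u" using g e u unfolding F_def Fix_def by auto
        then show ?thesis using g FE EC v FixC e u by (simp add: subset_iff)
      qed
      then show "f (e, u) \<in> Fix F" unfolding f_def Fix_def using FixC[OF u] EC[OF e] v by simp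
    qed
    fix y
    show "card {x \<in> E \<times> Fix E. f x = y} \<le> card F"
    proof (cases "{x \<in> E \<times> Fix E. f x = y} = {}")
      case True
      show ?thesis unfolding True by simp
    next
      case False
      then obtain e0 u0 where e0: "e0 \<in> E" "u0 \<in> Fix E" "dl e0 v \<star> u0 = y" unfolding f_def by auto
      show ?thesis
      proof (rule card_inj_on_le[of "\<lambda>x. inv e0 \<otimes> fst x"])
        show "inj_on (\<lambda>x. inv e0 \<otimes> fst x) {x \<in> E \<times> Fix E. f x = y}"
        proof (rule inj_onI)
          fix x x' assume x: "x \<in> {x \<in> E \<times> Fix E. f x = y}" "x' \<in> {x \<in> E \<times> Fix E. f x = y}"
            and eq: "inv e0 \<otimes> fst x = inv e0 \<otimes> fst x'"
          obtain e u e' u' where xx: "x = (e, u)" "x' = (e', u')" by fastforce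
          have m: "e \<in> E" "u \<in> Fix E" "e' \<in> E" "u' \<in> Fix E" "dl e v \<star> u = dl e' v \<star> u'"
            using x unfolding xx f_def by auto
          have "e = e'" using eq m e0 EC unfolding xx by simp
          moreover from this have "u = u'" using m EC FixC v by simp
          ultimately show "x = x'" unfolding xx by simp
        qed
        show "finite F" using G.fin_subgroup[OF F] .
        have "inv e0 \<otimes> e \<in> F" if e: "e \<in> E" "u \<in> Fix E" "dl e v \<star> u = y" for e u
        proof -
          \<comment> \<open>\<open>dl g\<close> kills \<open>u'\<close> and commutes with
            \<open>e'\<close>, so what \<open>e'\<close> does to \<open>dl g v\<close> depends on
            \<open>y\<close> alone. Two elements \<open>e\<close>, \<open>e0\<close> over the same
            \<open>y\<close> thus differ by an element of \<open>F\<close>.\<close>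
          have "\<rho> e' (dl g v) = dl g y \<star> dl g v" if "g \<in> E" "e' \<in> E" "u' \<in> Fix E" "dl e' v \<star> u' = y" for g e' u'
          proof -
            have "dl g u' = \<epsilon>" using that EC unfolding Fix_def by (auto simp: dl_eq_one_iff)
            then have "dl g y = dl g (dl e' v)" using that(4)[symmetric] that(1-3) EC FixC v by (simp add: dl_vmult)
            moreover have "\<rho> e' (dl g v) = dl g (\<rho> e' v)"
              using act_dl_comm[of e' g v] ab that EC v by auto
            moreover have "dl g (\<rho> e' v) = dl g (dl e' v) \<star> dl g v"
              using that EC v by (simp add: act_eq_dl[of e' v] dl_vmult)
            ultimately show ?thesis by simp
          qed
          then have "\<rho> e (dl g v) = \<rho> e0 (dl g v)" if "g \<in> E" for g using e e0 that by metis
          then have "\<rho> (inv e0 \<otimes> e) (dl g v) = dl g v" if "g \<in> E" for g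
            using that e e0 EC v by (simp add: act_mult)
          then show ?thesis unfolding F_def
            using e e0 subgroup.m_closed[OF E] subgroup.m_inv_closed[OF E] by auto
        qed
        then show "(\<lambda>x. inv e0 \<otimes> fst x) ` {x \<in> E \<times> Fix E. f x = y} \<subseteq> F" unfolding f_def by auto
      qed
    qed
  qed
  \<comment> \<open>In the chain j E <= |U \<inter> Fix F| |F| <= j F <= j E all terms coincide,
    which yields both remaining claims.\<close>
  then have le: "j E \<le> card (U \<inter> Fix F) * card F" unfolding j_def by (simp add: card_cartesian_product)
  have FixF: "subgroup (Fix F) V" using Fix_subgroup FE EC by blast
  have le2: "card (U \<inter> Fix F) \<le> card (Fix F)" using VP.fin_subgroup[OF FixF] by (simp add: card_mono)
  then have "card (U \<inter> Fix F) * card F \<le> j F" unfolding j_def by simp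
  then show jF: "j F = j E" using le max[OF F FE] by simp
  then have "card (Fix F) * card F \<le> card (U \<inter> Fix F) * card F" using le unfolding j_def by (simp add: mult.commute)
  then have "card (Fix F) \<le> card (U \<inter> Fix F)" using G.card_subgroup_pos[OF F] by simp
  then have "U \<inter> Fix F = Fix F" using VP.eq_if_card_le[OF FixF] by blast
  then show "Fix F \<subseteq> comm_fix E" unfolding U_def by blast
qed

text \<open>The product formula in \<open>G\<close> times the product formula in \<open>V\<close>.
  Together with the inclusion it says j F * j F' <= j(FF') * j(F \<inter> F'). The exact form is
  kept because equality must also give Fix(F \<inter> F') = Fix F Fix F'.\<close>

lemma j_lattice:
  assumes F: "subgroup F G" and F': "subgroup F' G"
  shows "j F * j F' = j (F <#> F') * (card (F \<inter> F') * card (Fix F <#>\<^bsub>V\<^esub> Fix F'))"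
    and "Fix F <#>\<^bsub>V\<^esub> Fix F' \<subseteq> Fix (F \<inter> F')"
proof -
  have C: "\<And>e. e \<in> F \<Longrightarrow> e \<in> carrier G" "\<And>e. e \<in> F' \<Longrightarrow> e \<in> carrier G"
    using subgroup.mem_carrier[OF F] subgroup.mem_carrier[OF F'] by auto
  have s: "subgroup (Fix F) V" "subgroup (Fix F') V" using Fix_subgroup C by blast+
  have a: "card (F <#> F') * card (F \<inter> F') = card F * card F'"
    using G.card_set_mult_Int[OF F F'] G.fin_subgroup F F' by blast
  have b: "card (Fix F <#>\<^bsub>V\<^esub> Fix F') * card (Fix F \<inter> Fix F') = card (Fix F) * card (Fix F')"
    using V.card_set_mult_Int[OF s] VP.fin_subgroup s by blast
  have "j F * j F' = (card F * card F') * (card (Fix F) * card (Fix F'))" by (simp add: j_def)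
  also have "\<dots> = j (F <#> F') * (card (F \<inter> F') * card (Fix F <#>\<^bsub>V\<^esub> Fix F'))"
    unfolding a[symmetric] b[symmetric] j_def Fix_mult[OF F F'] by simp
  finally show "j F * j F' = j (F <#> F') * (card (F \<inter> F') * card (Fix F <#>\<^bsub>V\<^esub> Fix F'))" .
  show "Fix F <#>\<^bsub>V\<^esub> Fix F' \<subseteq> Fix (F \<inter> F')"
    unfolding set_mult_def Fix_def using C by auto
qed

lemma j_pos: "subgroup E G \<Longrightarrow> j E > 0"
  unfolding j_def using G.card_subgroup_pos VP.card_subgroup_pos Fix_subgroup subgroup.subset
  by (metis nat_0_less_mult_iff)

text \<open>\<open>Q\<close> is the intersection, over all vectors v, of the subgroups from
  \<open>replacement_one\<close>. By \<open>j_lattice\<close> the extremal subgroups with fixed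
  points inside \<open>comm_fix E\<close> are closed under intersection. A trivial \<open>Q\<close>
  would fix all of \<open>V\<close>, contrary to \<open>comm_fix_proper\<close>.\<close>

lemma replacement:
  assumes E: "subgroup E G" and ab: "\<And>e f. e \<in> E \<Longrightarrow> f \<in> E \<Longrightarrow> e \<otimes> f = f \<otimes> e"
    and max: "\<And>F. subgroup F G \<Longrightarrow> F \<subseteq> E \<Longrightarrow> j F \<le> j E" and "E \<noteq> {\<one>}"
  defines "Q \<equiv> {e \<in> E. \<forall>f\<in>E. \<forall>v\<in>carrier V. \<rho> e (dl f v) = dl f v}"
  shows "subgroup Q G" "j Q = j E" "Q \<noteq> {\<one>}"
proof -
  have EC: "\<And>e. e \<in> E \<Longrightarrow> e \<in> carrier G" using subgroup.mem_carrier[OF E] .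
  define good where "good = (\<lambda>F. subgroup F G \<and> F \<subseteq> E \<and> j F = j E \<and> Fix F \<subseteq> comm_fix E)"
  define Fv where "Fv = (\<lambda>v. {e \<in> E. \<forall>f\<in>E. \<rho> e (dl f v) = dl f v})"
  have goodE: "good E" unfolding good_def comm_fix_def using E by (auto intro: generate.incl)
  have goodFv: "good (Fv v)" if "v \<in> carrier V" for v
    using replacement_one[OF E ab max that] unfolding good_def Fv_def by auto
  have good_Int: "good (F \<inter> F')" if "good F" "good F'" for F F'
  proof -
    have F: "subgroup F G" "F \<subseteq> E" "j F = j E" "Fix F \<subseteq> comm_fix E"
      and F': "subgroup F' G" "F' \<subseteq> E" "j F' = j E" "Fix F' \<subseteq> comm_fix E" using that unfolding good_def by auto
    have ab': "\<And>e f. e \<in> F \<Longrightarrow> f \<in> F' \<Longrightarrow> e \<otimes> f = f \<otimes> e" using ab F F' by blast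
    have FI: "subgroup (F \<inter> F') G" using G.subgroups_Inter_pair F F' by blast
    have FM: "subgroup (F <#> F') G" using G.set_mult_subgroup_commute[OF F(1) F'(1) ab'] .
    have FME: "F <#> F' \<subseteq> E" unfolding set_mult_def using F F' subgroup.m_closed[OF E] by blast
    define W where "W = Fix F <#>\<^bsub>V\<^esub> Fix F'"
    have l: "j E * j E = j (F <#> F') * (card (F \<inter> F') * card W)" and W: "W \<subseteq> Fix (F \<inter> F')"
      using j_lattice[OF F(1) F'(1)] F F' unfolding W_def by auto
    have "j E * j E \<le> j E * (card (F \<inter> F') * card W)" unfolding l using max[OF FM FME] by simp
    then have l1: "j E \<le> card (F \<inter> F') * card W" using j_pos[OF E] by simp
    have sFI: "subgroup (Fix (F \<inter> F')) V" using Fix_subgroup F EC by blast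
    have l2: "card W \<le> card (Fix (F \<inter> F'))" using W VP.fin_subgroup[OF sFI] by (simp add: card_mono)
    then have "card (F \<inter> F') * card W \<le> j (F \<inter> F')" unfolding j_def by simp
    moreover have l3: "j (F \<inter> F') \<le> j E" using max[OF FI] F by blast
    ultimately have jI: "j (F \<inter> F') = j E" using l1 by simp
    have "card (F \<inter> F') * card (Fix (F \<inter> F')) \<le> card (F \<inter> F') * card W" using l1 jI unfolding j_def by simp
    then have "card (Fix (F \<inter> F')) \<le> card W" using G.card_subgroup_pos[OF FI] by simp
    then have "W = Fix (F \<inter> F')" using VP.eq_if_card_le[OF sFI W] by blast
    moreover have "W \<subseteq> comm_fix E" unfolding W_def set_mult_def
      using F F' subgroup.m_closed[OF comm_fix_subgroup[of E]] EC by blast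
    ultimately show ?thesis unfolding good_def using FI F jI by auto
  qed
  have "good (E \<inter> \<Inter>(Fv ` T))" if "finite T" "T \<subseteq> carrier V" for T
    using that
  proof (induction T rule: finite_induct)
    case (insert x T)
    have "E \<inter> \<Inter>(Fv ` insert x T) = (E \<inter> \<Inter>(Fv ` T)) \<inter> Fv x" by auto
    then show ?case using good_Int insert goodFv by simp
  qed (use goodE in simp)
  then have "good (E \<inter> \<Inter>(Fv ` carrier V))" using VP.fin by blast
  moreover have "E \<inter> \<Inter>(Fv ` carrier V) = Q" unfolding Q_def Fv_def using V.one_closed by blast
  ultimately have Q: "good Q" by simp
  then show "subgroup Q G" "j Q = j E" unfolding good_def by auto
  show "Q \<noteq> {\<one>}"
  proof
    assume "Q = {\<one>}"
    then have "carrier V \<subseteq> comm_fix E" using Q Fix_one unfolding good_def by simp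
    then have "comm_fix E = carrier V" using subgroup.subset[OF comm_fix_subgroup[of E]] EC by blast
    then have "Fix E = carrier V" using comm_fix_proper[OF E] by blast
    then show False using Fix_eq_carrier[OF E] \<open>E \<noteq> {\<one>}\<close> by blast
  qed
qed

text \<open>A minimal non-trivial offender \<open>F\<close> satisfies the extremality required by
  \<open>replacement\<close>: its proper non-trivial subgroups are no offenders, and the trivial one
  has \<open>j\<close> equal to |V| <= j F.\<close>

lemma quadratic_offender:
  assumes E: "subgroup E G" and ab: "\<And>e f. e \<in> E \<Longrightarrow> f \<in> E \<Longrightarrow> e \<otimes> f = f \<otimes> e"
    and "E \<noteq> {\<one>}" and off: "card (carrier V) \<le> j E"
  obtains Q where "subgroup Q G" "Q \<subseteq> E" "Q \<noteq> {\<one>}" "card (carrier V) \<le> j Q" "\<And>e. e \<in> Q \<Longrightarrow> quad e"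
proof -
  define Off where "Off = {F. subgroup F G \<and> F \<subseteq> E \<and> F \<noteq> {\<one>} \<and> card (carrier V) \<le> j F}"
  have "finite Off" by (rule finite_subset[of _ "Pow E"]) (use G.fin_subgroup[OF E] Off_def in auto)
  moreover have "E \<in> Off" using assms unfolding Off_def by auto
  ultimately obtain F where F: "F \<in> Off" and min: "\<forall>F'\<in>Off. F' \<subseteq> F \<longrightarrow> F = F'"
    using finite_has_minimal[of Off] by blast
  have F': "subgroup F G" "F \<subseteq> E" "F \<noteq> {\<one>}" "card (carrier V) \<le> j F" using F unfolding Off_def by auto
  have max: "j K \<le> j F" if "subgroup K G" "K \<subseteq> F" for K
  proof (cases "K = F \<or> K = {\<one>}")
    case True
    then show ?thesis using F' j_one by auto
  next
    case False
    then have "K \<notin> Off" using min that by blast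
    then show ?thesis using that F' False unfolding Off_def by auto
  qed
  define Q where "Q = {e \<in> F. \<forall>f\<in>F. \<forall>v\<in>carrier V. \<rho> e (dl f v) = dl f v}"
  have Q: "subgroup Q G" "j Q = j F" "Q \<noteq> {\<one>}"
    using replacement[OF F'(1) _ max F'(3)] ab F'(2) unfolding Q_def by blast+
  have "quad e" if "e \<in> Q" for e using that unfolding Q_def quad_def by auto
  then show ?thesis using that[of Q] Q F' unfolding Q_def by auto
qed

end

text \<open>For z of order p the condition says that \<open>V\<close>, restricted to the group
  generated by z, has a free direct summand: a Jordan block of full size p.\<close>

locale ps_module = p_module +
  assumes ps: "\<lbrakk>z \<in> carrier G; \<And>g. g \<in> carrier G \<Longrightarrow> z \<otimes> g = g \<otimes> z; z \<noteq> \<one>\<rbrakk>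
    \<Longrightarrow> \<exists>v\<in>carrier V. (dl z ^^ (p - 1)) v \<noteq> \<epsilon>"
begin

lemma dl_funpow_ge:
  assumes "z \<in> carrier G" "v \<in> carrier V" "(dl z ^^ k) v = \<epsilon>" "k \<le> n"
  shows "(dl z ^^ n) v = \<epsilon>"
proof -
  have "(dl z ^^ n) v = (dl z ^^ (n - k)) ((dl z ^^ k) v)"
    using assms(4) funpow_add[of "n - k" k "dl z"] by simp
  then show ?thesis using assms by simp
qed

lemma central_quad:
  assumes z: "z \<in> carrier G" and c: "\<And>g. g \<in> carrier G \<Longrightarrow> z \<otimes> g = g \<otimes> z" and q: "quad z"
  shows "z = \<one>"
proof (rule ccontr)
  assume "z \<noteq> \<one>"
  then obtain v where v: "v \<in> carrier V" "(dl z ^^ (p - 1)) v \<noteq> \<epsilon>" using ps[OF z c] by blast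
  have "(dl z ^^ 2) v = \<epsilon>" using q z v unfolding quad_def by (simp add: numeral_2_eq_2 dl_eq_one_iff)
  then show False using dl_funpow_ge[OF z v(1), of 2 "p - 1"] p_ge_3 v(2) by simp
qed

text \<open>A central commutator satisfies the proviso of \<open>quad_comm_elt\<close>, so it is
  quadratic and central, hence trivial.\<close>

lemma quad_comm_central:
  assumes x: "x \<in> carrier G" "quad x" and y: "y \<in> carrier G"
    and c: "\<And>g. g \<in> carrier G \<Longrightarrow> comm_elt G x y \<otimes> g = g \<otimes> comm_elt G x y"
  shows "x \<otimes> y = y \<otimes> x"
proof -
  have z: "comm_elt G x y \<in> carrier G" using x y by simp
  have "quad (comm_elt G x y)"
    by (rule quad_comm_elt[OF x(1) y x(2) refl]) (use c x y in auto)
  then have "comm_elt G x y = \<one>" using central_quad[OF z c] by blast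
  then show ?thesis using G.comm_elt_eq_one_iff x y by blast
qed

lemma quad_normal_meets:
  assumes N: "N \<lhd> G" "N \<noteq> {\<one>}" obtains z where "z \<in> N" "z \<noteq> \<one>" "\<And>g. g \<in> carrier G \<Longrightarrow> z \<otimes> g = g \<otimes> z" "\<not> quad z"
proof -
  obtain z where z: "z \<in> N" "z \<noteq> \<one>" "\<And>g. g \<in> carrier G \<Longrightarrow> z \<otimes> g = g \<otimes> z"
    using G.normal_meets_center[OF N] by blast
  have "z \<in> carrier G" using z N normal_imp_subgroup subgroup.mem_carrier by metis
  then show ?thesis using that z central_quad by blast
qed

text \<open>The largest subgroup of \<open>A\<close> at which \<open>j\<close> is maximal is normal in \<open>G\<close>, and so is the quadratic
  subgroup obtained from it by replacement.\<close>

lemma no_offender_in_abelian_normal: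
  assumes A: "A \<lhd> G" and ab: "\<And>e f. e \<in> A \<Longrightarrow> f \<in> A \<Longrightarrow> e \<otimes> f = f \<otimes> e"
    and E: "subgroup E G" "E \<subseteq> A" "E \<noteq> {\<one>}" and off: "card (carrier V) \<le> j E"
  shows False
proof -
  have sA: "subgroup A G" using A normal_imp_subgroup by blast
  have AC: "\<And>e. e \<in> A \<Longrightarrow> e \<in> carrier G" using subgroup.mem_carrier[OF sA] .
  define SS where "SS = {F. subgroup F G \<and> F \<subseteq> A}"
  have finSS: "finite SS" by (rule finite_subset[of _ "Pow A"]) (use G.fin_subgroup[OF sA] SS_def in auto)
  have ESS: "E \<in> SS" using E SS_def by auto
  define m where "m = Max (j ` SS)"
  have m: "\<And>F. F \<in> SS \<Longrightarrow> j F \<le> m" unfolding m_def using finSS by simp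
  have mE: "card (carrier V) \<le> m" using m[OF ESS] off by simp
  define MM where "MM = {F \<in> SS. j F = m \<and> F \<noteq> {\<one>}}"
  have "\<exists>F\<in>SS. j F = m" 
  proof -
    have "m \<in> j ` SS" unfolding m_def using finSS ESS by (intro Max_in) auto
    then show ?thesis by auto
  qed
  \<comment> \<open>The maximum might be attained by the trivial subgroup, but then it equals |V|
    and the offender \<open>E\<close> attains it as well.\<close>
  then have "MM \<noteq> {}"
    using m[OF ESS] off j_one mE ESS E unfolding MM_def by (metis (mono_tags, lifting) empty_iff le_antisym mem_Collect_eq)
  moreover have "finite MM" using finSS unfolding MM_def by simp
  ultimately obtain F where F: "F \<in> MM" and maxl: "\<forall>F'\<in>MM. F \<subseteq> F' \<longrightarrow> F = F'"
    using finite_has_maximal[of MM] by blast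
  have F': "subgroup F G" "F \<subseteq> A" "j F = m" "F \<noteq> {\<one>}" using F unfolding MM_def SS_def by auto
  have FC: "F \<subseteq> carrier G" using F' AC by blast
  have conj: "g \<otimes> x \<otimes> inv g \<in> F" if g: "g \<in> carrier G" and x: "x \<in> F" for g x
  proof -
    define F2 where "F2 = (\<lambda>x. g \<otimes> x \<otimes> inv g) ` F"
    have s2: "subgroup F2 G"
    proof -
      have "(\<lambda>x. g \<otimes> x \<otimes> inv g) \<in> hom G G" using g by (auto intro!: homI simp: G.m_assoc)
      then have "group_hom G G (\<lambda>x. g \<otimes> x \<otimes> inv g)" by (simp add: group_hom_def group_hom_axioms_def)
      then show ?thesis unfolding F2_def using group_hom.subgroup_img_is_subgroup F'(1) by blast
    qed
    have F2A: "F2 \<subseteq> A" unfolding F2_def using G.normal_conj(2)[OF A] g F'(2) by blast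
    have j2: "j F2 = m" unfolding F2_def using j_conj[OF FC g] F' by simp
    have ab2: "\<And>e f. e \<in> F \<Longrightarrow> f \<in> F2 \<Longrightarrow> e \<otimes> f = f \<otimes> e" using ab F' F2A by blast
    have FM: "F <#> F2 \<in> SS" "F \<inter> F2 \<in> SS"
      using G.set_mult_subgroup_commute[OF F'(1) s2 ab2] G.subgroups_Inter_pair[OF F'(1) s2] F' F2A
        subgroup.m_closed[OF sA] unfolding SS_def set_mult_def by blast+
    \<comment> \<open>Neither j(F F2) nor j(F \<inter> F2) exceeds m while their product is at least
      m^2; so F F2 attains m, and maximality of \<open>F\<close> gives F2 <= F.\<close>
    have l: "m * m = j (F <#> F2) * (card (F \<inter> F2) * card (Fix F <#>\<^bsub>V\<^esub> Fix F2))"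
      and W: "Fix F <#>\<^bsub>V\<^esub> Fix F2 \<subseteq> Fix (F \<inter> F2)"
      using j_lattice[OF F'(1) s2] F' j2 by auto
    have sFI: "subgroup (Fix (F \<inter> F2)) V" using Fix_subgroup FC by blast
    have "card (Fix F <#>\<^bsub>V\<^esub> Fix F2) \<le> card (Fix (F \<inter> F2))" using W VP.fin_subgroup[OF sFI] by (simp add: card_mono)
    then have "card (F \<inter> F2) * card (Fix F <#>\<^bsub>V\<^esub> Fix F2) \<le> j (F \<inter> F2)" unfolding j_def by simp
    also have "\<dots> \<le> m" using m FM by blast
    finally have "m * m \<le> j (F <#> F2) * m" unfolding l by simp
    then have "m \<le> j (F <#> F2)" using j_pos[OF F'(1)] F' by simp
    then have jm: "j (F <#> F2) = m" using m FM by (simp add: le_antisym)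
    have "\<one> \<in> F" "\<one> \<in> F2" using subgroup.one_closed F'(1) s2 by auto
    then have sub: "F \<subseteq> F <#> F2" "F2 \<subseteq> F <#> F2"
      unfolding set_mult_def using FC F2A AC by force+
    then have "F <#> F2 \<noteq> {\<one>}" using F' \<open>\<one> \<in> F\<close> by blast
    then have "F <#> F2 \<in> MM" unfolding MM_def using FM jm by blast
    then have "F = F <#> F2" using maxl sub by blast
    then show ?thesis using sub x unfolding F2_def by blast
  qed
  have nF: "F \<lhd> G" using F'(1) conj unfolding G.normal_inv_iff by blast
  define Q where "Q = {e \<in> F. \<forall>f\<in>F. \<forall>v\<in>carrier V. \<rho> e (dl f v) = dl f v}"
  have Q: "subgroup Q G" "Q \<noteq> {\<one>}"
    using replacement[OF F'(1) _ _ F'(4)] ab F' m unfolding Q_def SS_def by blast+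
  have "Q \<lhd> G"
  proof (rule G.normalI'[OF Q(1)])
    fix x g assume x: "x \<in> Q" and g: "g \<in> carrier G"
    have xF: "x \<in> F" "x \<in> carrier G" using x FC unfolding Q_def by auto
    have "\<rho> (inv g \<otimes> x \<otimes> g) (dl f v) = dl f v" if f: "f \<in> F" and v: "v \<in> carrier V" for f v
    proof -
      have fC: "f \<in> carrier G" using f FC by blast
      have "\<rho> g (dl f v) = dl (g \<otimes> f \<otimes> inv g) (\<rho> g v)"
        using fC v g by (simp add: dl_def act_mult)
      moreover have "g \<otimes> f \<otimes> inv g \<in> F" using G.normal_conj(2)[OF nF f g] .
      ultimately have "\<rho> x (\<rho> g (dl f v)) = \<rho> g (dl f v)" using x v g unfolding Q_def by simp
      then show ?thesis using xF g fC v by (simp add: act_mult)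
    qed
    then show "inv g \<otimes> x \<otimes> g \<in> Q" unfolding Q_def using G.normal_conj(1)[OF nF xF(1) g] by blast
  qed
  then obtain z where "z \<in> Q" "\<not> quad z" using quad_normal_meets Q(2) by blast
  then show False unfolding Q_def quad_def by blast
qed

text \<open>The normal closure of \<open>E\<close> would be abelian. Comparing \<open>E\<close> with
  its own conjugates suffices, because any two conjugates become \<open>E\<close> and a conjugate of
  \<open>E\<close> after a common conjugation.\<close>

lemma offender_conjugates_not_commuting:
  assumes E: "subgroup E G" "E \<noteq> {\<one>}" and off: "card (carrier V) \<le> j E"
    and c: "\<And>e f g. \<lbrakk>e \<in> E; f \<in> E; g \<in> carrier G\<rbrakk> \<Longrightarrow> e \<otimes> (inv g \<otimes> f \<otimes> g) = (inv g \<otimes> f \<otimes> g) \<otimes> e"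
  shows False
proof -
  have EC: "\<And>e. e \<in> E \<Longrightarrow> e \<in> carrier G" using subgroup.mem_carrier[OF E(1)] .
  define K where "K = {inv g \<otimes> e \<otimes> g | e g. e \<in> E \<and> g \<in> carrier G}"
  have KC: "K \<subseteq> carrier G" unfolding K_def using EC by auto
  have comm: "a \<otimes> b = b \<otimes> a" if ab: "a \<in> K" "b \<in> K" for a b
  proof -
    obtain e g f h where e: "e \<in> E" "g \<in> carrier G" "a = inv g \<otimes> e \<otimes> g"
      and f: "f \<in> E" "h \<in> carrier G" "b = inv h \<otimes> f \<otimes> h" using ab unfolding K_def by auto
    let ?k = "h \<otimes> inv g"
    have b: "b = inv g \<otimes> (inv ?k \<otimes> f \<otimes> ?k) \<otimes> g" using e f EC by (simp add: G.m_assoc G.inv_mult_group)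
    have "a \<otimes> b = inv g \<otimes> (e \<otimes> (inv ?k \<otimes> f \<otimes> ?k)) \<otimes> g"
      unfolding b e(3) using e f EC by (simp add: G.m_assoc)
    also have "\<dots> = inv g \<otimes> ((inv ?k \<otimes> f \<otimes> ?k) \<otimes> e) \<otimes> g" using c[OF e(1) f(1), of ?k] e f by simp
    also have "\<dots> = b \<otimes> a" unfolding b e(3) using e f EC by (simp add: G.m_assoc)
    finally show ?thesis .
  qed
  define A where "A = generate G K"
  have "A \<lhd> G" unfolding A_def
  proof (rule G.normal_generate_conj[OF KC])
    fix h g assume "h \<in> K" and g: "g \<in> carrier G"
    then obtain e k where e: "e \<in> E" "k \<in> carrier G" "h = inv k \<otimes> e \<otimes> k" unfolding K_def by auto
    then have "inv g \<otimes> h \<otimes> g = inv (k \<otimes> g) \<otimes> e \<otimes> (k \<otimes> g)" using g EC by (simp add: G.m_assoc G.inv_mult_group)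
    then show "inv g \<otimes> h \<otimes> g \<in> K" unfolding K_def using e g by blast
  qed
  moreover have "a \<otimes> b = b \<otimes> a" if "a \<in> A" "b \<in> A" for a b
    using G.generate_commute[OF KC comm] that unfolding A_def by blast
  moreover have "E \<subseteq> A"
  proof
    fix e assume e: "e \<in> E"
    then have "e = inv \<one> \<otimes> e \<otimes> \<one>" using EC by simp
    then have "e \<in> K" unfolding K_def using e by blast
    then show "e \<in> A" unfolding A_def by (rule generate.incl)
  qed
  ultimately show False using no_offender_in_abelian_normal[OF _ _ E(1) _ E(2) off] by blast
qed

end

section \<open>Class at most four, metabelian groups and small rank\<close>

lemma (in p_group) card_proper_subgroup:
  assumes "subgroup H G" "subgroup K G" "H \<subset> K"
  shows "card H * p \<le> card K"
proof -
  obtain a b where ab: "card H = p ^ a" "card K = p ^ b"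
    using card_subgroup_pow assms by metis
  have "card H < card K" using assms fin_subgroup psubset_card_mono by blast
  then have "a < b" using ab p_gt_1 by simp
  then have "p ^ Suc a \<le> p ^ b" using p_gt_1 by (intro power_increasing) auto
  then show ?thesis using ab by (simp add: mult.commute)
qed

lemma (in p_group) card_nontrivial_subgroup:
  assumes "subgroup H G" "H \<noteq> {\<one>}" shows "p \<le> card H"
proof -
  have "\<one> \<in> H" using subgroup.one_closed assms by blast
  then have "card {\<one>} * p \<le> card H"
    by (intro card_proper_subgroup) (use assms triv_subgroup in auto)
  then show ?thesis by simp
qed

context group
begin

lemma elementary_abelian_iff:
  "elementary_abelian q G E \<longleftrightarrow> subgroup E G \<and> (\<forall>a\<in>E. \<forall>b\<in>E. a \<otimes> b = b \<otimes> a) \<and> (\<forall>x\<in>E. x [^] q = \<one>)"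
proof -
  have "comm_group (G\<lparr>carrier := E\<rparr>) \<longleftrightarrow> (\<forall>a\<in>E. \<forall>b\<in>E. a \<otimes> b = b \<otimes> a)" if E: "subgroup E G"
  proof
    assume "comm_group (G\<lparr>carrier := E\<rparr>)"
    then interpret C: comm_group "G\<lparr>carrier := E\<rparr>" .
    show "\<forall>a\<in>E. \<forall>b\<in>E. a \<otimes> b = b \<otimes> a" using C.m_comm by simp
  next
    assume "\<forall>a\<in>E. \<forall>b\<in>E. a \<otimes> b = b \<otimes> a"
    then show "comm_group (G\<lparr>carrier := E\<rparr>)"
      using group.group_comm_groupI[OF subgroup_imp_group[OF E]] by simp
  qed
  then show ?thesis unfolding elementary_abelian_def by blast
qed

lemma set_mult_elementary_abelian:
  assumes E: "elementary_abelian q G E" and F: "elementary_abelian q G F"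
    and c: "\<And>e f. e \<in> E \<Longrightarrow> f \<in> F \<Longrightarrow> e \<otimes> f = f \<otimes> e"
  shows "elementary_abelian q G (E <#> F)"
proof -
  have sE: "subgroup E G" "\<And>a b. a \<in> E \<Longrightarrow> b \<in> E \<Longrightarrow> a \<otimes> b = b \<otimes> a" "\<And>x. x \<in> E \<Longrightarrow> x [^] q = \<one>"
    and sF: "subgroup F G" "\<And>a b. a \<in> F \<Longrightarrow> b \<in> F \<Longrightarrow> a \<otimes> b = b \<otimes> a" "\<And>x. x \<in> F \<Longrightarrow> x [^] q = \<one>"
    using E F unfolding elementary_abelian_iff by auto
  have C: "\<And>x. x \<in> E \<Longrightarrow> x \<in> carrier G" "\<And>x. x \<in> F \<Longrightarrow> x \<in> carrier G"
    using subgroup.mem_carrier[OF sE(1)] subgroup.mem_carrier[OF sF(1)] by auto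
  have gen: "E <#> F \<subseteq> generate G (E \<union> F)"
    unfolding set_mult_def by (blast intro: generate.eng generate.incl)
  have "a \<otimes> b = b \<otimes> a" if "a \<in> E <#> F" "b \<in> E <#> F" for a b
  proof (rule generate_commute[of "E \<union> F"])
    show "a \<in> generate G (E \<union> F)" "b \<in> generate G (E \<union> F)" using gen that by auto
    show "E \<union> F \<subseteq> carrier G" using C by auto
    show "a \<otimes> b = b \<otimes> a" if "a \<in> E \<union> F" "b \<in> E \<union> F" for a b
      using that c[of a b] c[of b a] sE(2) sF(2) by auto
  qed
  moreover have "x [^] q = \<one>" if xEF: "x \<in> E <#> F" for x
  proof -
    obtain e f where x: "e \<in> E" "f \<in> F" "x = e \<otimes> f" using xEF unfolding set_mult_def by auto
    then show ?thesis using pow_mult_distrib[of e f q] c[of e f] C sE(3) sF(3) by simp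
  qed
  ultimately show ?thesis
    unfolding elementary_abelian_iff using set_mult_subgroup_commute[OF sE(1) sF(1) c] by auto
qed

lemma conj_pow:
  assumes "a \<in> carrier G" "g \<in> carrier G"
  shows "inv g \<otimes> a [^] (n::nat) \<otimes> g = (inv g \<otimes> a \<otimes> g) [^] n"
proof (induction n)
  case (Suc n)
  have "inv g \<otimes> a [^] Suc n \<otimes> g = (inv g \<otimes> a [^] n \<otimes> g) \<otimes> (inv g \<otimes> a \<otimes> g)"
    using assms by (simp add: m_assoc)
  then show ?case using Suc assms by simp
qed (use assms in simp)

lemma centralizer_normal:
  assumes N: "N \<lhd> G" shows "centralizer G N \<lhd> G"
proof (rule normalI')
  have NC: "N \<subseteq> carrier G" using N normal_imp_subgroup subgroup.subset by blast
  show "subgroup (centralizer G N) G" using centralizer_subgroup[OF NC] .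
  fix x g assume x: "x \<in> centralizer G N" and g: "g \<in> carrier G"
  have xC: "x \<in> carrier G" using x unfolding centralizer_def by auto
  have "inv g \<otimes> x \<otimes> g \<otimes> a = a \<otimes> (inv g \<otimes> x \<otimes> g)" if a: "a \<in> N" for a
  proof -
    have aC: "a \<in> carrier G" using a NC by auto
    have "g \<otimes> a \<otimes> inv g \<in> N" using normal_conj(2)[OF N a g] .
    then have e: "x \<otimes> (g \<otimes> a \<otimes> inv g) = (g \<otimes> a \<otimes> inv g) \<otimes> x" using x unfolding centralizer_def by auto
    have "inv g \<otimes> x \<otimes> g \<otimes> a = inv g \<otimes> (x \<otimes> (g \<otimes> a \<otimes> inv g)) \<otimes> g" using xC aC g by (simp add: m_assoc)
    also have "\<dots> = a \<otimes> (inv g \<otimes> x \<otimes> g)" unfolding e using xC aC g by (simp add: m_assoc)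
    finally show ?thesis .
  qed
  then show "inv g \<otimes> x \<otimes> g \<in> centralizer G N" unfolding centralizer_def using xC g by auto
qed

lemma comm_elt_mult_central:
  assumes "a \<in> carrier G" "w \<in> carrier G" "g \<in> carrier G" and c: "\<And>h. h \<in> carrier G \<Longrightarrow> w \<otimes> h = h \<otimes> w"
  shows "comm_elt G (a \<otimes> w) g = comm_elt G a g"
proof -
  have w: "comm_elt G w g = \<one>" using comm_elt_eq_one_iff assms by blast
  have "inv w \<otimes> comm_elt G a g \<otimes> w = comm_elt G a g"
    using assms c[of "comm_elt G a g"] by (simp add: m_assoc flip: c)
  then show ?thesis using assms w by (simp add: comm_elt_mult_left)
qed

end

section \<open>The codimension bound and the cases of small class and metabelian groups\<close>

context ps_module
begin

text \<open>The images (z - 1)^k V are \<open>G\<close>-invariant because z is central. A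
  non-trivial one contains a non-trivial vector fixed by the p-group \<open>G\<close>, in particular
  by z, so z - 1 is not injective on it and the next image is smaller.\<close>

lemma central_dl_nilpotent:
  assumes z: "z \<in> carrier G" and c: "\<And>g. g \<in> carrier G \<Longrightarrow> z \<otimes> g = g \<otimes> z"
  obtains N where "\<And>v. v \<in> carrier V \<Longrightarrow> (dl z ^^ N) v = \<epsilon>"
proof -
  define I where "I = (\<lambda>k. (dl z ^^ k) ` carrier V)"
  have hom: "(dl z ^^ k) \<in> hom V V" for k
    by (rule homI) (use z in \<open>auto simp: dl_funpow_vmult\<close>)
  have sI: "subgroup (I k) V" for k
    unfolding I_def using group_hom.img_is_subgroup[of V V "dl z ^^ k"] hom
    by (simp add: group_hom_def group_hom_axioms_def)
  have dec: "card (I (Suc k)) < card (I k)" if ne: "I k \<noteq> {\<epsilon>}" for k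
  proof -
    obtain n where n: "order G = p ^ n" using G.order_pow by blast
    obtain m where m: "card (I k) = p ^ m" using VP.card_subgroup_pow[OF sI] .
    have IC: "\<And>v. v \<in> I k \<Longrightarrow> v \<in> carrier V" using subgroup.mem_carrier[OF sI] .
    have inv: "\<rho> g v \<in> I k" if "g \<in> carrier G" "v \<in> I k" for g v
      using that act_dl_funpow[OF z _ c] unfolding I_def by auto
    obtain v where v: "v \<in> I k" "v \<noteq> \<epsilon>" "\<And>g. g \<in> carrier G \<Longrightarrow> \<rho> g v \<star> inv\<^bsub>V\<lparr>carrier := I k\<rparr>\<^esub> v \<in> {\<epsilon>}"
    proof (rule fixed_point_outside_subgroup[of G p n "V\<lparr>carrier := I k\<rparr>" m "{\<epsilon>}" \<rho>], goal_cases)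
      case 4 show ?case by (rule V.subgroup_imp_group[OF sI])
    next
      case 6
      then show ?case using V.subgroup_incl[OF V.triv_subgroup sI] subgroup.one_closed[OF sI] by auto
    next
      case (8 g)
      then show ?case using inv IC by (auto intro!: homI)
    next
      case (12 v)
      then show ?case using that by auto
    qed (use n m G.p ne IC inv act_mult in \<open>auto simp: order_def\<close>)
    have "dl z v = \<epsilon>"
      using v(3)[OF z] V.m_inv_consistent[OF sI v(1)] unfolding dl_def by simp
    then have nin: "\<not> inj_on (dl z) (I k)"
      using v z subgroup.one_closed[OF sI, of k] unfolding inj_on_def by (metis dl_vone)
    have finI: "finite (I k)" using VP.fin_subgroup[OF sI] .
    have "I (Suc k) = dl z ` I k" unfolding I_def by (auto simp: image_image)
    then show ?thesis using nin finI by (metis card_image_le eq_card_imp_inj_on le_neq_implies_less)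
  qed
  define N where "N = (ARG_MIN (\<lambda>k. card (I k)) k. True)"
  have "card (I N) \<le> card (I k)" for k
    unfolding N_def by (rule arg_min_nat_le) simp
  then have "I N = {\<epsilon>}" using dec[of N] by (meson leD)
  then have "(dl z ^^ N) v = \<epsilon>" if "v \<in> carrier V" for v using that unfolding I_def by blast
  then show ?thesis using that by blast
qed

text \<open>A subgroup with few non-fixed vectors forces a central element \<open>z\<close> of the kernel on
  \<open>\<Inter>\<^sub>g C\<^sub>V(E\<^sup>g)\<close> to satisfy \<open>(z - 1)\<^sup>p\<^sup>-\<^sup>1 = 0\<close>: the images of \<open>(z - 1)\<^sup>k\<close> modulo \<open>C\<^sub>V(E)\<close> decrease strictly.\<close>

lemma codim_bound:
  assumes E: "subgroup E G" "E \<noteq> {\<one>}"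
  shows "p ^ (p - 1) * card (Fix E) \<le> card (carrier V)"
proof (rule ccontr)
  assume neg: "\<not> ?thesis"
  have EC: "\<And>e. e \<in> E \<Longrightarrow> e \<in> carrier G" using subgroup.mem_carrier[OF E(1)] .
  have sF: "subgroup (Fix E) V" using Fix_subgroup EC by blast
  have FC: "\<And>u. u \<in> Fix E \<Longrightarrow> u \<in> carrier V" unfolding Fix_def by auto
  define C where "C = {v \<in> carrier V. \<forall>g\<in>carrier G. \<rho> g v \<in> Fix E}"
  define K where "K = {g \<in> carrier G. \<forall>v\<in>C. \<rho> g v = v}"
  have CC: "\<And>v. v \<in> C \<Longrightarrow> v \<in> carrier V" unfolding C_def by auto
  have C_inv: "\<rho> h v \<in> C" if "h \<in> carrier G" "v \<in> C" for h v
    using that unfolding C_def by (auto simp flip: act_mult)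
  have sK: "subgroup K G"
  proof (rule G.subgroupI)
    show "K \<noteq> {}" unfolding K_def using CC by (auto intro!: exI[of _ \<one>])
  next
    fix a assume a: "a \<in> K"
    have "\<rho> (inv a) v = v" if "v \<in> C" for v
      using a that CC act_inv_cancel(2)[of a v] unfolding K_def by simp
    then show "inv a \<in> K" using a unfolding K_def by simp
    fix b assume "b \<in> K"
    then show "a \<otimes> b \<in> K" using a CC unfolding K_def by (auto simp: act_mult)
  qed (auto simp: K_def)
  have "K \<lhd> G"
  proof (rule G.normalI'[OF sK])
    fix x g assume x: "x \<in> K" and g: "g \<in> carrier G"
    have "\<rho> (inv g \<otimes> x \<otimes> g) v = v" if "v \<in> C" for v
      using x g that C_inv[OF g that] CC unfolding K_def by (auto simp: act_mult)
    then show "inv g \<otimes> x \<otimes> g \<in> K" using x g unfolding K_def by auto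
  qed
  moreover have "E \<subseteq> K"
  proof
    fix e assume e: "e \<in> E"
    have "\<rho> e v = v" if "v \<in> C" for v
    proof -
      have "\<rho> \<one> v \<in> Fix E" using that unfolding C_def by blast
      then show ?thesis using that CC e unfolding Fix_def by simp
    qed
    then show "e \<in> K" unfolding K_def using e EC by simp
  qed
  then have "K \<noteq> {\<one>}" using E subgroup.one_closed[OF E(1)] by blast
  ultimately obtain z where zK: "z \<in> K" and z1: "z \<noteq> \<one>" and c: "\<And>g. g \<in> carrier G \<Longrightarrow> z \<otimes> g = g \<otimes> z"
    using G.normal_meets_center by blast
  have z: "z \<in> carrier G" using zK unfolding K_def by auto
  obtain N where N: "\<And>v. v \<in> carrier V \<Longrightarrow> (dl z ^^ N) v = \<epsilon>" using central_dl_nilpotent[OF z c] by blast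
  have dlF: "dl z u \<in> Fix E" if "u \<in> Fix E" for u
    using that z EC act_dl_comm[OF _ z c[symmetric]] unfolding Fix_def by auto
  \<comment> \<open>\<open>T k\<close> becomes (z - 1)^k V times C_V(E). With C_V(E) adjoined at
    every step, the strict steps of the chain can be counted against the index of C_V(E).\<close>
  define \<Phi> where "\<Phi> = (\<lambda>T. (dl z ` T) <#>\<^bsub>V\<^esub> Fix E)"
  define T where "T = (\<lambda>k. (\<Phi> ^^ k) (carrier V))"
  have T0: "T 0 = carrier V" and TS: "\<And>k. T (Suc k) = \<Phi> (T k)" unfolding T_def by auto
  have gh: "group_hom V V (dl z)" using dl_hom[OF z] by (simp add: group_hom_def group_hom_axioms_def)
  have sT: "subgroup (T k) V \<and> Fix E \<subseteq> T k" for k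
  proof (induction k)
    case 0
    then show ?case using V.subgroup_self FC unfolding T0 by blast
  next
    case (Suc k)
    have s: "subgroup (dl z ` T k) V" using group_hom.subgroup_img_is_subgroup[OF gh] Suc by blast
    have "subgroup (T (Suc k)) V" unfolding TS \<Phi>_def
      by (rule V.set_mult_subgroup_commute[OF s sF]) (use subgroup.mem_carrier[OF s] FC V.m_comm in blast)
    moreover have "Fix E \<subseteq> T (Suc k)"
    proof
      fix u assume u: "u \<in> Fix E"
      have "\<epsilon> \<star> u \<in> T (Suc k)" unfolding TS \<Phi>_def
        by (rule set_mult_memI) (use subgroup.one_closed[OF s] u in auto)
      then show "u \<in> T (Suc k)" using u FC by simp
    qed
    ultimately show ?case by blast
  qed
  have TC: "\<And>k t. t \<in> T k \<Longrightarrow> t \<in> carrier V" using sT subgroup.mem_carrier by metis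
  have \<Phi>_mono: "\<Phi> A \<subseteq> \<Phi> B" if "A \<subseteq> B" for A B using that unfolding \<Phi>_def set_mult_def by auto
  have Tdec: "T (Suc k) \<subseteq> T k" for k
  proof (induction k)
    case 0
    show ?case unfolding T0 using TC by blast
  next
    case (Suc k)
    then show ?case using \<Phi>_mono TS by simp
  qed
  have Tform: "\<exists>v\<in>carrier V. \<exists>u\<in>Fix E. t = (dl z ^^ k) v \<star> u" if "t \<in> T k" for k t
    using that
  proof (induction k arbitrary: t)
    case 0
    then show ?case unfolding T0 using subgroup.one_closed[OF sF] by (intro bexI[of _ t] bexI[of _ \<epsilon>]) auto
  next
    case (Suc k)
    then obtain t' u' where t': "t' \<in> T k" "u' \<in> Fix E" "t = dl z t' \<star> u'" unfolding TS \<Phi>_def set_mult_def by auto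
    obtain v u where vu: "v \<in> carrier V" "u \<in> Fix E" "t' = (dl z ^^ k) v \<star> u" using Suc.IH[OF t'(1)] by blast
    have "t = (dl z ^^ Suc k) v \<star> (dl z u \<star> u')"
      using t' vu z FC by (simp add: dl_vmult V.m_assoc)
    moreover have "dl z u \<star> u' \<in> Fix E" using dlF vu t' subgroup.m_closed[OF sF] by blast
    ultimately show ?case using vu by blast
  qed
  have Thas: "(dl z ^^ k) v \<in> T k" if "v \<in> carrier V" for k v
  proof (induction k)
    case 0
    then show ?case using that T0 by simp
  next
    case (Suc k)
    have "dl z ((dl z ^^ k) v) \<star> \<epsilon> \<in> T (Suc k)" unfolding TS \<Phi>_def
      by (rule set_mult_memI) (use Suc subgroup.one_closed[OF sF] in auto)
    then show ?case using that z by simp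
  qed
  \<comment> \<open>Once two consecutive terms agree the chain is constant, and nilpotency of z - 1
    then forces it to be C_V(E). Until that happens every step costs a factor of at least p.\<close>
  have step: "T k = Fix E \<or> card (T k) * p ^ k \<le> card (carrier V)" for k
  proof (induction k)
    case 0
    then show ?case unfolding T0 by simp
  next
    case (Suc k)
    consider "T k = Fix E" | "T (Suc k) = T k" | "T k \<noteq> Fix E" "T (Suc k) \<subset> T k" using Tdec by blast
    then show ?case
    proof cases
      case 1
      then show ?thesis using Tdec[of k] sT[of "Suc k"] by blast
    next
      case 2
      have stab: "T (k + i) = T k" for i by (induction i) (use 2 TS in auto)
      have "T k \<subseteq> Fix E"
      proof
        fix t assume "t \<in> T k"
        then have "t \<in> T (k + N)" using stab by simp
        then obtain v u where "v \<in> carrier V" "u \<in> Fix E" "t = (dl z ^^ (k + N)) v \<star> u" using Tform by blast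
        moreover have "(dl z ^^ (k + N)) v = \<epsilon>" using dl_funpow_ge[OF z \<open>v \<in> carrier V\<close> N] \<open>v \<in> carrier V\<close> by simp
        ultimately show "t \<in> Fix E" using FC by simp
      qed
      then show ?thesis using 2 sT by blast
    next
      case 3
      have "card (T (Suc k)) * p \<le> card (T k)" using VP.card_proper_subgroup 3(2) sT by blast
      then have "card (T (Suc k)) * p * p ^ k \<le> card (T k) * p ^ k" by simp
      also have "\<dots> \<le> card (carrier V)" using Suc 3(1) by blast
      finally show ?thesis by (simp only: power_Suc mult.assoc) blast
    qed
  qed
  \<comment> \<open>Not having arrived after p - 2 steps means a factor p^(p-2) above
    \<open>T (p - 2)\<close> and another p below it, so C_V(E) would have index at least
    p^(p-1).\<close>
  have Tp: "T (p - 2) = Fix E"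
  proof (rule ccontr)
    assume ne: "T (p - 2) \<noteq> Fix E"
    then have "card (Fix E) * p \<le> card (T (p - 2))" using VP.card_proper_subgroup[OF sF] sT by blast
    then have "card (Fix E) * p * p ^ (p - 2) \<le> card (T (p - 2)) * p ^ (p - 2)" by simp
    also have "\<dots> \<le> card (carrier V)" using step ne by blast
    also have "card (Fix E) * p * p ^ (p - 2) = p ^ (p - 1) * card (Fix E)"
    proof -
      have "p * p ^ (p - 2) = p ^ (p - 1)" using p_ge_3 by (simp flip: power_Suc)
      then show ?thesis by (simp add: mult.assoc mult.commute)
    qed
    finally show False using neg by simp
  qed
  \<comment> \<open>The last factor z - 1 is free: (z - 1)^(p-2) V is \<open>G\<close>-invariant and
    inside C_V(E), hence inside \<open>C\<close>, where z acts trivially.\<close>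
  have "(dl z ^^ (p - 1)) v = \<epsilon>" if v: "v \<in> carrier V" for v
  proof -
    have "(dl z ^^ (p - 2)) v \<in> C"
      unfolding C_def using Thas[of _ "p - 2"] Tp v z by (auto simp: act_dl_funpow[OF z _ c])
    then have "\<rho> z ((dl z ^^ (p - 2)) v) = (dl z ^^ (p - 2)) v" using zK unfolding K_def by blast
    then have "dl z ((dl z ^^ (p - 2)) v) = \<epsilon>" using z v by (simp add: dl_eq_one_iff)
    moreover have "p - 1 = Suc (p - 2)" using p_ge_3 by simp
    ultimately show ?thesis by simp
  qed
  then show False using ps[OF z c z1] by blast
qed

lemma offender_card:
  assumes E: "subgroup E G" "E \<noteq> {\<one>}" and off: "card (carrier V) \<le> j E"
  shows "p ^ (p - 1) \<le> card E"
proof -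
  have "subgroup (Fix E) V" using Fix_subgroup subgroup.subset E by blast
  then have "card (Fix E) > 0" using VP.card_subgroup_pos by blast
  moreover have "p ^ (p - 1) * card (Fix E) \<le> card E * card (Fix E)"
    using codim_bound[OF E] off unfolding j_def by linarith
  ultimately show ?thesis by simp
qed

text \<open>The conjugate of f by g is f [f, g], and e commutes with both factors; so
  \<open>E\<close> commutes with all its conjugates.\<close>

lemma no_offender_if_quads_centralize_commutators:
  assumes c: "\<And>x g h. \<lbrakk>x \<in> carrier G; quad x; g \<in> carrier G; h \<in> carrier G\<rbrakk> \<Longrightarrow> x \<otimes> comm_elt G g h = comm_elt G g h \<otimes> x"
    and E: "subgroup E G" "E \<noteq> {\<one>}" and ab: "\<And>e f. e \<in> E \<Longrightarrow> f \<in> E \<Longrightarrow> e \<otimes> f = f \<otimes> e"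
    and q: "\<And>e. e \<in> E \<Longrightarrow> quad e" and off: "card (carrier V) \<le> j E"
  shows False
proof (rule offender_conjugates_not_commuting[OF E off])
  fix e f g assume h: "e \<in> E" "f \<in> E" "g \<in> carrier G"
  have C: "e \<in> carrier G" "f \<in> carrier G" using h subgroup.mem_carrier[OF E(1)] by auto
  have "e \<otimes> (f \<otimes> comm_elt G f g) = f \<otimes> (e \<otimes> comm_elt G f g)"
    using ab[OF h(1,2)] C h by (simp flip: G.m_assoc)
  also have "\<dots> = (f \<otimes> comm_elt G f g) \<otimes> e"
    using c[OF C(1) q[OF h(1)] C(2) h(3)] C h by (simp add: G.m_assoc)
  finally show "e \<otimes> (inv g \<otimes> f \<otimes> g) = (inv g \<otimes> f \<otimes> g) \<otimes> e" using C h by (simp add: G.conj_eq_comm_elt)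
qed

text \<open>Put a = [g, h] and c = [a, x], so that every [c, y] is central. Then x commutes with c.
  Moreover y \<mapsto> [c, y] maps products to products in the centre, so it kills the commutator a.
  Thus c commutes with a and x and is quadratic; its commutators being central, it is itself
  central, hence trivial.\<close>

lemma quad_centralizes_commutators_class4:
  assumes cl: "iter_comm G (carrier G) (carrier G) 4 = {\<one>}"
    and x: "x \<in> carrier G" "quad x" and gh: "g \<in> carrier G" "h \<in> carrier G"
  shows "x \<otimes> comm_elt G g h = comm_elt G g h \<otimes> x"
proof -
  \<comment> \<open>Indices are shifted by one: \<open>\<gamma> i\<close> is the term number i + 1
    of the lower central series.\<close>
  define \<gamma> where "\<gamma> = iter_comm G (carrier G) (carrier G)"
  have \<gamma>S: "\<gamma> (Suc i) = generate G {comm_elt G a b | a b. a \<in> \<gamma> i \<and> b \<in> carrier G}" for i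
    unfolding \<gamma>_def by (simp add: comm_subgroup_def)
  have \<gamma>C: "\<gamma> i \<subseteq> carrier G" for i
  proof (induction i)
    case (Suc i)
    show ?case unfolding \<gamma>S by (rule G.generate_incl) (use Suc in auto)
  qed (simp add: \<gamma>_def)
  have in\<gamma>: "comm_elt G a b \<in> \<gamma> (Suc i)" if "a \<in> \<gamma> i" "b \<in> carrier G" for a b i
    unfolding \<gamma>S using that by (auto intro: generate.incl)
  have cen: "w \<otimes> y = y \<otimes> w" if "w \<in> \<gamma> 3" "y \<in> carrier G" for w y
  proof -
    have "comm_elt G w y \<in> \<gamma> 4" using in\<gamma>[OF that] by (simp add: eval_nat_numeral)
    then have "comm_elt G w y = \<one>" using cl unfolding \<gamma>_def by simp
    then show ?thesis using G.comm_elt_eq_one_iff that \<gamma>C by blast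
  qed
  define a where "a = comm_elt G g h"
  define c where "c = comm_elt G a x"
  have C: "a \<in> carrier G" "c \<in> carrier G" unfolding a_def c_def using gh x by auto
  have "a \<in> \<gamma> 1" unfolding a_def using in\<gamma>[of g 0 h] gh by (simp add: \<gamma>_def)
  then have c2: "c \<in> \<gamma> 2" unfolding c_def using in\<gamma>[of a 1 x] x by (simp add: eval_nat_numeral)
  have c3: "comm_elt G c y \<in> \<gamma> 3" if "y \<in> carrier G" for y
    using in\<gamma>[OF c2 that] by (simp add: eval_nat_numeral)
  have cenc: "comm_elt G c y \<otimes> w = w \<otimes> comm_elt G c y" if "y \<in> carrier G" "w \<in> carrier G" for y w
    using cen[OF c3] that by blast
  have xc: "x \<otimes> c = c \<otimes> x"
  proof (rule quad_comm_central[OF x C(2)])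
    fix w assume w: "w \<in> carrier G"
    have "comm_elt G x c = inv (comm_elt G c x)" using x C by (simp add: G.inv_comm_elt)
    then show "comm_elt G x c \<otimes> w = w \<otimes> comm_elt G x c"
      using G.commute_inv[of "comm_elt G c x" w] cenc x C w by simp
  qed
  have cmul: "comm_elt G c (y \<otimes> w) = comm_elt G c w \<otimes> comm_elt G c y" if "y \<in> carrier G" "w \<in> carrier G" for y w
  proof -
    have "inv w \<otimes> comm_elt G c y \<otimes> w = comm_elt G c y"
      using cenc[OF that] that C by (simp add: G.m_assoc)
    then show ?thesis using that C by (simp add: G.comm_elt_mult_right)
  qed
  have "comm_elt G c (h \<otimes> g \<otimes> a) = comm_elt G c (g \<otimes> h)"
    unfolding a_def using gh by (simp add: G.word_simps)
  also have "\<dots> = comm_elt G c (h \<otimes> g)"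
    unfolding cmul[OF gh] cmul[OF gh(2,1)] by (rule cenc) (use gh C in auto)
  finally have "comm_elt G c a \<otimes> comm_elt G c (h \<otimes> g) = comm_elt G c (h \<otimes> g)" using cmul[of "h \<otimes> g" a] gh C by simp
  then have "comm_elt G c a = \<one>" using C gh by simp
  then have ca: "c \<otimes> a = a \<otimes> c" using G.comm_elt_eq_one_iff C by blast
  have ic: "inv c = comm_elt G x a" unfolding c_def using x C by (simp add: G.inv_comm_elt)
  have "quad (inv c)"
    by (rule quad_comm_elt[OF x(1) C(1) x(2) ic])
      (use G.commute_inv[of c x] G.commute_inv[of c a] xc ca x C in auto)
  then have qc: "quad c" using quad_inv[of "inv c"] C by simp
  have "c \<otimes> y = y \<otimes> c" if "y \<in> carrier G" for y
    by (rule quad_comm_central[OF C(2) qc that]) (use cenc that in blast)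
  then have "c = \<one>" using central_quad[OF C(2) _ qc] by blast
  then have "a \<otimes> x = x \<otimes> a" unfolding c_def using G.comm_elt_eq_one_iff x C by blast
  then show ?thesis unfolding a_def by simp
qed

text \<open>As \<open>D\<close> is abelian, a \<mapsto> [a, x] is a homomorphism on
  \<open>D\<close>. Its image \<open>K\<close> is normal, because conjugation multiplies x by an
  element of \<open>D\<close>, which does not affect these commutators. A non-trivial
  \<open>K\<close> would contain a central element of the form [a, x], which is quadratic.\<close>

lemma quad_centralizes_commutators_metabelian:
  assumes met: "metabelian G"
    and x: "x \<in> carrier G" "quad x" and gh: "g \<in> carrier G" "h \<in> carrier G"
  shows "x \<otimes> comm_elt G g h = comm_elt G g h \<otimes> x"
proof -
  define D where "D = derived G (carrier G)"
  have nD: "D \<lhd> G" unfolding D_def using G.derived_self_is_normal .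
  have sD: "subgroup D G" using nD normal_imp_subgroup by blast
  have DC: "\<And>a. a \<in> D \<Longrightarrow> a \<in> carrier G" using subgroup.mem_carrier[OF sD] .
  have ab: "a \<otimes> b = b \<otimes> a" if "a \<in> D" "b \<in> D" for a b
  proof -
    interpret Dc: comm_group "G\<lparr>carrier := D\<rparr>" using met unfolding metabelian_def D_def .
    show ?thesis using Dc.m_comm that by simp
  qed
  have inD: "comm_elt G a b \<in> D" if "a \<in> carrier G" "b \<in> carrier G" for a b
  proof -
    have "comm_elt G a b = inv a \<otimes> inv b \<otimes> inv (inv a) \<otimes> inv (inv b)" using that by (simp add: comm_elt_def)
    moreover have "inv a \<otimes> inv b \<otimes> inv (inv a) \<otimes> inv (inv b) \<in> derived_set G (carrier G)"
      using that G.inv_closed by blast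
    ultimately show ?thesis unfolding D_def derived_def by (simp add: generate.incl)
  qed
  define K where "K = (\<lambda>a. comm_elt G a x) ` D"
  have mul: "comm_elt G (a \<otimes> b) x = comm_elt G a x \<otimes> comm_elt G b x" if "a \<in> D" "b \<in> D" for a b
  proof -
    have "inv b \<otimes> comm_elt G a x \<otimes> b = comm_elt G a x"
      using ab[OF inD[of a x] that(2)] that DC x by (simp add: G.m_assoc)
    then show ?thesis using that DC x by (simp add: G.comm_elt_mult_left)
  qed
  have "K \<lhd> G"
  proof (rule G.normalI')
    have "(\<lambda>a. comm_elt G a x) \<in> hom (G\<lparr>carrier := D\<rparr>) G" by (rule homI) (use mul DC x in auto)
    then have "group_hom (G\<lparr>carrier := D\<rparr>) G (\<lambda>a. comm_elt G a x)"
      using G.subgroup_imp_group[OF sD] by (simp add: group_hom_def group_hom_axioms_def)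
    then show "subgroup K G" unfolding K_def using group_hom.img_is_subgroup by fastforce
    fix k g assume k: "k \<in> K" and g: "g \<in> carrier G"
    then obtain a where a: "a \<in> D" "k = comm_elt G a x" unfolding K_def by auto
    let ?b = "inv g \<otimes> a \<otimes> g" and ?d = "comm_elt G x g"
    have b: "?b \<in> D" using G.normal_conj(1)[OF nD a(1) g] .
    have d: "?d \<in> D" using inD x g by blast
    have "inv g \<otimes> k \<otimes> g = comm_elt G ?b (x \<otimes> ?d)"
      using a DC x g by (simp add: G.conj_comm_elt flip: G.conj_eq_comm_elt)
    also have "\<dots> = comm_elt G ?b ?d \<otimes> (inv ?d \<otimes> comm_elt G ?b x \<otimes> ?d)"
      using b d DC x by (simp add: G.comm_elt_mult_right)
    also have "comm_elt G ?b ?d = \<one>" using G.comm_elt_eq_one_iff[OF DC[OF b] DC[OF d]] ab[OF b d] by blast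
    also have "inv ?d \<otimes> comm_elt G ?b x \<otimes> ?d = comm_elt G ?b x"
      using ab[OF inD[OF DC[OF b] x(1)] d] DC[OF b] DC[OF d] x by (simp add: G.m_assoc)
    finally have "inv g \<otimes> k \<otimes> g = comm_elt G ?b x" using DC[OF b] x by simp
    then show "inv g \<otimes> k \<otimes> g \<in> K" unfolding K_def using b by blast
  qed
  have "K = {\<one>}"
  proof (rule ccontr)
    assume "K \<noteq> {\<one>}"
    obtain z where z: "z \<in> K" "z \<noteq> \<one>" "\<And>g. g \<in> carrier G \<Longrightarrow> z \<otimes> g = g \<otimes> z" "\<not> quad z"
      by (rule quad_normal_meets[OF \<open>K \<lhd> G\<close> \<open>K \<noteq> {\<one>}\<close>]) (rule that)
    obtain a where a: "a \<in> D" "z = comm_elt G a x" using z unfolding K_def by auto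
    have zC: "z \<in> carrier G" using a DC x by simp
    have iz: "inv z = comm_elt G x a" using a DC x by (simp add: G.inv_comm_elt)
    have "quad (inv z)"
      by (rule quad_comm_elt[OF x(1) DC[OF a(1)] x(2) iz])
        (use G.commute_inv[OF zC _ z(3)] x DC a in auto)
    then show False using quad_inv[of "inv z"] zC z by simp
  qed
  then have "comm_elt G (comm_elt G g h) x = \<one>" unfolding K_def using inD[OF gh] by blast
  then show ?thesis using G.comm_elt_eq_one_iff[of "comm_elt G g h" x] gh x by simp
qed

section \<open>Cyclic normal subgroups and groups of small rank\<close>

lemma cyclic_normal:
  assumes m: "m \<in> carrier G" and c: "\<And>g. g \<in> carrier G \<Longrightarrow> \<exists>s::nat. inv g \<otimes> m \<otimes> g = m [^] s"
  shows "generate G {m} \<lhd> G"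
proof (rule G.normalI')
  show "subgroup (generate G {m}) G" using G.generate_is_subgroup m by blast
  fix x g assume x: "x \<in> generate G {m}" and g: "g \<in> carrier G"
  obtain k :: nat where k: "x = m [^] k" using x G.generate_pow_on_finite_carrier[OF G.fin m] by auto
  obtain s :: nat where s: "inv g \<otimes> m \<otimes> g = m [^] s" using c[OF g] by blast
  have "inv g \<otimes> x \<otimes> g = m [^] (s * k)" unfolding k G.conj_pow[OF m g] s using m by (simp add: G.nat_pow_pow)
  then show "inv g \<otimes> x \<otimes> g \<in> generate G {m}" using G.generate_pow_on_finite_carrier[OF G.fin m] by auto
qed

text \<open>The metabelian argument with a cyclic group in place of \<open>D\<close>: c = [m, x] is
  a power of m, so [m^k, x] = c^k, and these commutators form the normal subgroup generated by c. A
  non-trivial central element in it would be quadratic.\<close>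

lemma quad_centralizes_cyclic_normal:
  assumes m: "m \<in> carrier G" and N: "generate G {m} \<lhd> G" and x: "x \<in> carrier G" "quad x"
  shows "x \<otimes> m = m \<otimes> x"
proof -
  have gen: "generate G {m} = {m [^] k | k. k \<in> (UNIV::nat set)}" using G.generate_pow_on_finite_carrier[OF G.fin m] .
  have mM: "m \<in> generate G {m}" by (simp add: generate.incl)
  define c where "c = comm_elt G m x"
  have cC: "c \<in> carrier G" unfolding c_def using m x by simp
  have "c \<in> generate G {m}" unfolding c_def using G.normal_comm_elt[OF N m x(1)] mM by blast
  then obtain t :: nat where t: "c = m [^] t" unfolding gen by auto
  have cm: "m [^] k \<otimes> c = c \<otimes> m [^] k" for k :: nat
    unfolding t using m by (simp add: G.nat_pow_mult add.commute)
  have ck: "comm_elt G (m [^] k) x = c [^] k" for k :: nat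
  proof (induction k)
    case (Suc k)
    have "inv m \<otimes> c \<otimes> m = c" using cm[of 1, symmetric] cC m by (simp add: G.m_assoc)
    then have "inv m \<otimes> c [^] k \<otimes> m = c [^] k" unfolding G.conj_pow[OF cC m] by simp
    then show ?case using Suc m x cC unfolding c_def[symmetric] by (simp add: G.comm_elt_mult_left c_def)
  qed (use x in simp)
  have "generate G {c} \<lhd> G"
  proof (rule cyclic_normal[OF cC])
    fix g assume g: "g \<in> carrier G"
    have "inv g \<otimes> m \<otimes> g \<in> generate G {m}" using G.normal_conj(1)[OF N mM g] .
    then obtain s :: nat where s: "inv g \<otimes> m \<otimes> g = m [^] s" unfolding gen by auto
    have "inv g \<otimes> c \<otimes> g = (m [^] s) [^] t" unfolding t G.conj_pow[OF m g] s ..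
    also have "\<dots> = c [^] s" unfolding t using m by (simp add: G.nat_pow_pow mult.commute)
    finally show "\<exists>s::nat. inv g \<otimes> c \<otimes> g = c [^] s" by blast
  qed
  have "generate G {c} = {\<one>}"
  proof (rule ccontr)
    assume "generate G {c} \<noteq> {\<one>}"
    then obtain z where z: "z \<in> generate G {c}" "\<And>g. g \<in> carrier G \<Longrightarrow> z \<otimes> g = g \<otimes> z" "\<not> quad z"
      using quad_normal_meets[OF \<open>generate G {c} \<lhd> G\<close>] by blast
    obtain k :: nat where k: "z = c [^] k" using z(1) G.generate_pow_on_finite_carrier[OF G.fin cC] by auto
    have zC: "z \<in> carrier G" using k cC by simp
    have iz: "inv z = comm_elt G x (m [^] k)" unfolding k ck[symmetric] using m x by (simp add: G.inv_comm_elt)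
    have "quad (inv z)"
      by (rule quad_comm_elt[OF x(1) _ x(2) iz])
        (use G.commute_inv[OF zC _ z(2)] x m in auto)
    then show False using quad_inv[of "inv z"] zC z by simp
  qed
  moreover have "c \<in> generate G {c}" by (simp add: generate.incl)
  ultimately have "c = \<one>" by simp
  then show ?thesis using G.comm_elt_eq_one_iff[OF m x(1)] unfolding c_def by simp
qed

end

lemma fermat_pow_cong:
  assumes "Factorial_Ring.prime (q::nat)" shows "[s ^ (q ^ N) = s] (mod q)"
proof (induction N)
  case (Suc N)
  have fermat: "[a ^ q = a] (mod q)" for a :: nat
  proof (cases "q dvd a")
    case True
    moreover from this have "q dvd a ^ q" using prime_gt_0_nat[OF assms] by (meson dvd_power dvd_trans)
    ultimately show ?thesis by (simp add: cong_def mod_eq_0_iff_dvd)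
  next
    case False
    then have "[a ^ (q - 1) * a = 1 * a] (mod q)" using fermat_theorem[OF assms] by (intro cong_mult) auto
    then show ?thesis using prime_gt_0_nat[OF assms] by (simp add: power_eq_if mult.commute)
  qed
  have "s ^ (q ^ Suc N) = (s ^ (q ^ N)) ^ q" by (simp add: power_mult[symmetric] mult.commute)
  then show ?case using fermat[of "s ^ (q ^ N)"] Suc cong_trans by metis
qed simp

lemma (in group) pow_eq_of_cong:
  assumes "u \<in> carrier G" "u [^] (q::nat) = \<one>" "[a = b] (mod q)"
  shows "u [^] a = u [^] (b::nat)"
proof -
  have "u [^] a = u [^] (a mod q)" for a
  proof -
    have "u [^] a = u [^] (q * (a div q)) \<otimes> u [^] (a mod q)" using assms(1) by (simp add: nat_pow_mult)
    also have "u [^] (q * (a div q)) = \<one>" using assms by (simp flip: nat_pow_pow)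
    finally show ?thesis using assms by simp
  qed
  then show ?thesis using assms(3) unfolding cong_def by metis
qed

text \<open>A power automorphism of \<open>p\<close>-power order fixes every element of order \<open>p\<close>.\<close>

lemma (in p_group) order_p_in_cyclic_normal_central:
  assumes m: "m \<in> carrier G" and N: "generate G {m} \<lhd> G"
    and u: "u \<in> generate G {m}" "u [^] p = \<one>" and h: "h \<in> carrier G"
  shows "u \<otimes> h = h \<otimes> u"
proof -
  have gen: "generate G {m} = {m [^] k | k. k \<in> (UNIV::nat set)}" using generate_pow_on_finite_carrier[OF fin m] .
  have mM: "m \<in> generate G {m}" by (simp add: generate.incl)
  obtain i :: nat where i: "u = m [^] i" using u(1) unfolding gen by auto
  have uC: "u \<in> carrier G" using i m by simp
  obtain s :: nat where s: "inv h \<otimes> m \<otimes> h = m [^] s" using normal_conj(1)[OF N mM h] unfolding gen by auto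
  have hu: "inv h \<otimes> u \<otimes> h = u [^] s"
    unfolding i conj_pow[OF m h] s using m by (simp add: nat_pow_pow mult.commute)
  have pw: "inv (h [^] r) \<otimes> u \<otimes> h [^] r = u [^] (s ^ r)" for r :: nat
  proof (induction r)
    case (Suc r)
    have "inv (h [^] Suc r) \<otimes> u \<otimes> h [^] Suc r = inv h \<otimes> (inv (h [^] r) \<otimes> u \<otimes> h [^] r) \<otimes> h"
      using h uC by (simp add: inv_mult_group m_assoc)
    also have "\<dots> = (inv h \<otimes> u \<otimes> h) [^] (s ^ r)" unfolding Suc conj_pow[OF uC h] ..
    also have "\<dots> = u [^] (s ^ Suc r)" unfolding hu using uC by (simp add: nat_pow_pow)
    finally show ?case .
  qed (use uC in simp)
  obtain n where n: "order G = p ^ n" using order_pow by blast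
  have "u = u [^] (s ^ (p ^ n))"
    using pw[of "p ^ n"] pow_order_eq_1[OF h] n uC by simp
  also have "\<dots> = u [^] s" by (rule pow_eq_of_cong[OF uC u(2) fermat_pow_cong[OF p]])
  finally have "inv h \<otimes> u \<otimes> h = u" using hu by simp
  then have "h \<otimes> (inv h \<otimes> u \<otimes> h) = h \<otimes> u" by simp
  then show ?thesis using h uC by (simp add: m_assoc)
qed

context ps_module
begin

text \<open>Take a maximal cyclic normal subgroup \<open>M\<close> and a central \<open>Z\<close> of
  order p in it. The group B = EZ already has the largest possible order p^p, so it absorbs every
  element of order p that commutes with it. \<open>E\<close> centralizes \<open>M\<close> but is not
  inside it, so C_G(M) exceeds \<open>M\<close>; an element of C_G(M) just above \<open>M\<close>
  either enlarges \<open>M\<close> or yields an element of order p that cannot be absorbed.\<close>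

lemma no_offender_if_rank_le_p:
  assumes rank: "\<And>B. elementary_abelian p G B \<Longrightarrow> card B \<le> p ^ p"
    and E: "subgroup E G" "E \<noteq> {\<one>}" and ab: "\<And>e f. e \<in> E \<Longrightarrow> f \<in> E \<Longrightarrow> e \<otimes> f = f \<otimes> e"
    and q: "\<And>e. e \<in> E \<Longrightarrow> quad e" and off: "card (carrier V) \<le> j E"
  shows False
proof -
  have EC: "\<And>e. e \<in> E \<Longrightarrow> e \<in> carrier G" using subgroup.mem_carrier[OF E(1)] .
  define Cyc where "Cyc = {M. M \<lhd> G \<and> (\<exists>m\<in>carrier G. M = generate G {m})}"
  have "finite Cyc"
    by (rule finite_subset[of _ "Pow (carrier G)"])
      (use G.fin Cyc_def normal_imp_subgroup subgroup.subset in blast)+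
  moreover have "generate G {\<one>} \<in> Cyc"
    unfolding Cyc_def using G.generate_one G.one_is_normal by auto
  ultimately obtain M where M: "M \<in> Cyc" and max: "\<forall>M'\<in>Cyc. M \<subseteq> M' \<longrightarrow> M = M'"
    using finite_has_maximal[of Cyc] by blast
  obtain m where m: "m \<in> carrier G" "M = generate G {m}" and N: "M \<lhd> G" using M unfolding Cyc_def by auto
  have gen: "generate G {a} = {a [^] k | k. k \<in> (UNIV::nat set)}" if "a \<in> carrier G" for a
    using G.generate_pow_on_finite_carrier[OF G.fin that] .
  have sM: "subgroup M G" using N normal_imp_subgroup by blast
  have MC: "\<And>a. a \<in> M \<Longrightarrow> a \<in> carrier G" using subgroup.mem_carrier[OF sM] .
  have abM: "a \<otimes> b = b \<otimes> a" if "a \<in> M" "b \<in> M" for a b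
    using that m by (auto simp: gen[OF m(1)] G.nat_pow_mult add.commute)
  have single: "n \<in> M" if n: "n \<in> carrier G" "generate G {n} \<lhd> G" "M \<subseteq> generate G {n}" for n
  proof -
    have "M = generate G {n}" using max n unfolding Cyc_def by blast
    then show ?thesis by (simp add: generate.incl)
  qed
  have M1: "M \<noteq> {\<one>}"
  proof
    assume M1: "M = {\<one>}"
    have "carrier G \<noteq> {\<one>}" using E subgroup.subset[OF E(1)] subgroup.one_closed[OF E(1)] by blast
    then obtain z where z: "z \<in> carrier G" "z \<noteq> \<one>" "\<And>g. g \<in> carrier G \<Longrightarrow> z \<otimes> g = g \<otimes> z"
      using G.normal_meets_center[OF G.normal_self] by metis
    have "generate G {z} \<lhd> G"
      by (rule cyclic_normal[OF z(1)]) (use z in \<open>auto simp: G.m_assoc intro!: exI[of _ 1]\<close>)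
    moreover have "M \<subseteq> generate G {z}" using M1 generate.one by blast
    ultimately show False using single z M1 by blast
  qed
  have "\<not> M \<subseteq> {\<one>}" using M1 subgroup.one_closed[OF sM] by blast
  then obtain z where z: "z \<in> M" "z \<notin> {\<one>}" "\<And>g. g \<in> carrier G \<Longrightarrow> comm_elt G z g \<in> {\<one>}" "z [^] p \<in> {\<one>}"
    using G.central_step_pow[OF G.one_is_normal N] by metis
  have zC: "z \<in> carrier G" using z MC by blast
  have zc: "z \<otimes> g = g \<otimes> z" if "g \<in> carrier G" for g
    using z(3)[OF that] G.comm_elt_eq_one_iff[OF zC that] by simp
  define Z where "Z = generate G {z}"
  have sZ: "subgroup Z G" unfolding Z_def using G.generate_is_subgroup zC by blast
  have ZM: "Z \<subseteq> M" unfolding Z_def using G.generate_subgroup_incl[OF _ sM] z by blast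
  have Zc: "w \<otimes> g = g \<otimes> w" if w: "w \<in> Z" and g: "g \<in> carrier G" for w g
  proof -
    have "{z} \<subseteq> centralizer G (carrier G)" using zc zC unfolding centralizer_def by auto
    then have "Z \<subseteq> centralizer G (carrier G)"
      unfolding Z_def using G.generate_subgroup_incl G.centralizer_subgroup by blast
    then show ?thesis using w g unfolding centralizer_def by blast
  qed
  have Zp: "w [^] p = \<one>" if w: "w \<in> Z" for w
  proof -
    obtain k :: nat where "w = z [^] k" using w unfolding Z_def gen[OF zC] by auto
    then have "w [^] p = (z [^] p) [^] k" using zC by (simp add: G.nat_pow_pow mult.commute)
    then show ?thesis using z zC by simp
  qed
  have eE: "elementary_abelian p G E"
    unfolding G.elementary_abelian_iff using E ab q quad_order EC by blast
  have eZ: "elementary_abelian p G Z"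
    unfolding G.elementary_abelian_iff using sZ Zc Zp subgroup.mem_carrier[OF sZ] by blast
  have EZ: "E \<inter> Z = {\<one>}"
    using central_quad q Zc EC subgroup.one_closed[OF E(1)] subgroup.one_closed[OF sZ] by blast
  define B where "B = E <#> Z"
  have eB: "elementary_abelian p G B"
    unfolding B_def by (rule G.set_mult_elementary_abelian[OF eE eZ]) (use Zc EC in auto)
  have sB: "subgroup B G" using eB unfolding G.elementary_abelian_iff by blast
  have "Z \<noteq> {\<one>}" unfolding Z_def using z(2) by (metis generate.incl singletonD singletonI)
  then have "p \<le> card Z" using G.card_nontrivial_subgroup[OF sZ] by blast
  moreover have "p ^ (p - 1) \<le> card E" using offender_card[OF E off] .
  ultimately have "p ^ (p - 1) * p \<le> card E * card Z" by (rule mult_le_mono[rotated])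
  also have "\<dots> = card B"
    using G.card_set_mult_Int[OF E(1) sZ] G.fin_subgroup E(1) sZ EZ unfolding B_def by simp
  finally have cB: "p ^ p \<le> card B" using p_ge_3 by (simp add: power_eq_if mult.commute)
  \<comment> \<open>By \<open>quad_comm_central\<close> y commutes with \<open>E\<close>, so y lies
    in \<open>B\<close> by the choice of order. In y = e w the factor e has the same, central,
    commutators as y; being quadratic it is central, hence trivial, and y = w is in
    \<open>Z\<close>.\<close>
  have key: "y \<in> M" if y: "y \<in> carrier G" "y [^] p = \<one>"
    and yc: "\<And>g h. g \<in> carrier G \<Longrightarrow> h \<in> carrier G \<Longrightarrow> comm_elt G y g \<otimes> h = h \<otimes> comm_elt G y g" for y
  proof -
    have yE: "e \<otimes> y = y \<otimes> e" if e: "e \<in> E" for e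
    proof (rule quad_comm_central[OF EC[OF e] q[OF e] y(1)])
      fix h assume h: "h \<in> carrier G"
      have "comm_elt G e y = inv (comm_elt G y e)" using y EC[OF e] by (simp add: G.inv_comm_elt)
      then show "comm_elt G e y \<otimes> h = h \<otimes> comm_elt G e y"
        using G.commute_inv[OF _ h yc[OF EC[OF e] h]] y EC[OF e] by simp
    qed
    define Y where "Y = generate G {y}"
    have sY: "subgroup Y G" unfolding Y_def using G.generate_is_subgroup y by blast
    have yY: "y \<in> Y" unfolding Y_def by (simp add: generate.incl)
    have YC: "\<And>w. w \<in> Y \<Longrightarrow> w \<in> carrier G" using subgroup.mem_carrier[OF sY] .
    have "\<exists>k::nat. w = y [^] k" if "w \<in> Y" for w using that unfolding Y_def gen[OF y(1)] by auto
    then have eY: "elementary_abelian p G Y"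
      unfolding G.elementary_abelian_iff using sY y
      by (metis G.nat_pow_comm G.nat_pow_one G.nat_pow_pow mult.commute)
    have bY: "b \<otimes> w = w \<otimes> b" if b: "b \<in> B" and w: "w \<in> Y" for b w
    proof -
      have "y \<in> centralizer G B"
      proof -
        have "y \<otimes> (e \<otimes> u) = (e \<otimes> u) \<otimes> y" if "e \<in> E" "u \<in> Z" for e u
        proof -
          have uC: "u \<in> carrier G" using that ZM MC by blast
          have "y \<otimes> (e \<otimes> u) = e \<otimes> (y \<otimes> u)" using yE[OF that(1)] y uC EC that by (simp flip: G.m_assoc)
          then show ?thesis using Zc[OF that(2) y(1)] y uC EC that by (simp add: G.m_assoc)
        qed
        then show ?thesis unfolding centralizer_def B_def set_mult_def using y by auto
      qed
      then have "Y \<subseteq> centralizer G B" unfolding Y_def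
        using G.generate_subgroup_incl G.centralizer_subgroup[OF subgroup.subset[OF sB]] by blast
      then show ?thesis using b w unfolding centralizer_def by fastforce
    qed
    have eBY: "elementary_abelian p G (B <#> Y)"
      by (rule G.set_mult_elementary_abelian[OF eB eY]) (rule bY)
    then have sBY: "subgroup (B <#> Y) G" unfolding G.elementary_abelian_iff by blast
    have BBY: "B \<subseteq> B <#> Y" "Y \<subseteq> B <#> Y"
      using set_mult_memI[of _ B \<one> Y G] set_mult_memI[of \<one> B _ Y G]
        subgroup.one_closed[OF sY] subgroup.one_closed[OF sB] subgroup.mem_carrier[OF sB] YC by auto
    have "card (B <#> Y) \<le> card B" using rank[OF eBY] cB by linarith
    then have "B = B <#> Y" using G.eq_if_card_le[OF sBY BBY(1)] by blast
    then have "y \<in> B" using BBY yY by blast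
    then obtain e w where ew: "e \<in> E" "w \<in> Z" "y = e \<otimes> w" unfolding B_def set_mult_def by auto
    have wC: "w \<in> carrier G" using ew ZM MC by blast
    have "comm_elt G e g = comm_elt G y g" if "g \<in> carrier G" for g
      unfolding ew(3) using G.comm_elt_mult_central[OF EC[OF ew(1)] wC that Zc[OF ew(2)]] by simp
    then have "e \<otimes> g = g \<otimes> e" if "g \<in> carrier G" for g
      using quad_comm_central[OF EC[OF ew(1)] q[OF ew(1)] that] yc[OF that] that by simp
    then have "e = \<one>" using central_quad[OF EC[OF ew(1)] _ q[OF ew(1)]] by blast
    then show ?thesis using ew ZM wC by auto
  qed
  have EM: "E \<subseteq> centralizer G M"
  proof
    fix e assume e: "e \<in> E"
    have "e \<otimes> m = m \<otimes> e"
      using quad_centralizes_cyclic_normal[OF m(1) _ EC[OF e] q[OF e]] N unfolding m(2) by blast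
    then have "m \<in> centralizer G {e}" using m unfolding centralizer_def by auto
    then have "M \<subseteq> centralizer G {e}" unfolding m(2)
      using G.generate_subgroup_incl[OF _ G.centralizer_subgroup[of "{e}"]] EC[OF e] by simp
    then show "e \<in> centralizer G M" using EC[OF e] unfolding centralizer_def by auto
  qed
  have "\<not> centralizer G M \<subseteq> M"
  proof
    assume "centralizer G M \<subseteq> M"
    then have "E \<subseteq> M" using EM by blast
    then show False using no_offender_in_abelian_normal[OF N abM E(1) _ E(2) off] by blast
  qed
  then obtain n where n: "n \<in> centralizer G M" "n \<notin> M" "\<And>g. g \<in> carrier G \<Longrightarrow> comm_elt G n g \<in> M" "n [^] p \<in> M"
    using G.central_step_pow[OF N G.centralizer_normal[OF N]] by blast
  have nC: "n \<in> carrier G" using n unfolding centralizer_def by auto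
  obtain k :: nat where k: "n [^] p = m [^] k" using n(4) unfolding m(2) gen[OF m(1)] by auto
  show False
  proof (cases "p dvd k")
    \<comment> \<open>Here n^p generates \<open>M\<close>, so m is a power of n and n generates a
      larger cyclic normal subgroup.\<close>
    case False
    obtain a where a: "order G = p ^ a" using G.order_pow by blast
    have cop: "coprime k (p ^ a)" using False G.p by (metis coprime_commute coprime_power_right_iff prime_imp_coprime)
    obtain k' where "[k * k' = Suc 0] (mod p ^ a)" using cong_solve_coprime_nat[OF cop] by blast
    then have "m [^] (k * k') = m [^] Suc 0"
      using G.pow_eq_of_cong[OF m(1)] G.pow_order_eq_1[OF m(1)] a by simp
    then have "m = (n [^] p) [^] k'" using k m by (simp add: G.nat_pow_pow)
    then have "m = n [^] (p * k')" using nC by (simp add: G.nat_pow_pow)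
    then have "m \<in> generate G {n}" unfolding gen[OF nC] by auto
    then have Mn: "M \<subseteq> generate G {n}" unfolding m(2)
      using G.generate_subgroup_incl[OF _ G.generate_is_subgroup] nC by blast
    have "generate G {n} \<lhd> G"
    proof (rule cyclic_normal[OF nC])
      fix g assume g: "g \<in> carrier G"
      obtain s :: nat where "comm_elt G n g = n [^] s" using n(3)[OF g] Mn unfolding gen[OF nC] by auto
      then have "inv g \<otimes> n \<otimes> g = n [^] Suc s"
        using nC g G.nat_pow_Suc2[OF nC, of s] by (simp add: G.conj_eq_comm_elt)
      then show "\<exists>s::nat. inv g \<otimes> n \<otimes> g = n [^] s" by blast
    qed
    then show False using single[OF nC _ Mn] n(2) by blast
  next
    \<comment> \<open>Here n^p is the p-th power of some b in \<open>M\<close>, and dividing by b,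
      which commutes with n, leaves an element of order p outside \<open>M\<close>.\<close>
    case True
    then obtain k' where k': "k = k' * p" by (metis dvdE mult.commute)
    define b where "b = m [^] k'"
    define y where "y = n \<otimes> inv b"
    have bM: "b \<in> M" unfolding b_def m(2) gen[OF m(1)] by auto
    have bC: "b \<in> carrier G" "y \<in> carrier G" using bM MC nC unfolding y_def by auto
    have nb: "n \<otimes> inv b = inv b \<otimes> n" using n(1) subgroup.m_inv_closed[OF sM bM] unfolding centralizer_def by auto
    have bp: "b [^] p = n [^] p" unfolding b_def k k' using m by (simp add: G.nat_pow_pow)
    have "y [^] p = n [^] p \<otimes> inv b [^] p" unfolding y_def using G.pow_mult_distrib[OF nb] nC bC by simp
    also have "inv b [^] p = inv (n [^] p)" using bp bC by (simp add: G.nat_pow_inv)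
    finally have yp: "y [^] p = \<one>" using nC by simp
    have yM: "y \<notin> M"
    proof
      assume "y \<in> M"
      then have "y \<otimes> b \<in> M" using bM subgroup.m_closed[OF sM] by blast
      then show False using n(2) nC bC unfolding y_def by (simp add: G.m_assoc)
    qed
    have "comm_elt G y g \<otimes> h = h \<otimes> comm_elt G y g" if gh: "g \<in> carrier G" "h \<in> carrier G" for g h
    proof -
      let ?u = "comm_elt G y g"
      have "comm_elt G (inv b) g \<in> M"
        using G.normal_comm_elt[OF N _ gh(1), of "inv b"] subgroup.m_inv_closed[OF sM bM] bC by blast
      then have uM: "?u \<in> M" unfolding y_def
        using G.normal_comm_elt_subst(4)[OF N gh(1) nC _] n(3)[OF gh(1)] bC by simp
      have uC: "?u \<in> carrier G" using bC gh by simp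
      have cm: "y \<otimes> ?u = ?u \<otimes> y"
      proof -
        have "n \<in> centralizer G M" "inv b \<in> centralizer G M"
          using n(1) abM subgroup.m_inv_closed[OF sM bM] MC unfolding centralizer_def by auto
        then have "y \<in> centralizer G M" unfolding y_def
          using subgroup.m_closed[OF G.centralizer_subgroup[OF subgroup.subset[OF sM]]] by blast
        then show ?thesis using uM unfolding centralizer_def by blast
      qed
      \<comment> \<open>y and its commutator u commute, and y u is a conjugate of y. So u has p-th
        power one as well, and inside the cyclic normal \<open>M\<close> such elements are
        central.\<close>
      have "(y \<otimes> ?u) [^] p = inv g \<otimes> y [^] p \<otimes> g"
        unfolding G.conj_pow[OF bC(2) gh(1)] using bC gh by (simp add: G.conj_eq_comm_elt)
      then have "y [^] p \<otimes> ?u [^] p = \<one>" using G.pow_mult_distrib[OF cm bC(2) uC] yp gh by simp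
      then have "?u [^] p = \<one>" using yp uC by simp
      then show ?thesis
        using G.order_p_in_cyclic_normal_central[OF m(1) _ _ _ gh(2)] N uM unfolding m(2) by blast
    qed
    then show False using key[OF bC(2) yp] yM by blast
  qed
qed

end

section \<open>The upper central series and groups of maximal class\<close>

context group
begin

primrec ucs :: "nat \<Rightarrow> 'a set" where
  "ucs 0 = {\<one>}"
| "ucs (Suc i) = {g \<in> carrier G. \<forall>h\<in>carrier G. comm_elt G g h \<in> ucs i}"

text \<open>The preimages in \<open>G\<close> of the upper central series of G/N, kept inside
  \<open>G\<close> to avoid quotient groups.\<close>

primrec rel_ucs :: "'a set \<Rightarrow> nat \<Rightarrow> 'a set" where
  "rel_ucs N 0 = N"
| "rel_ucs N (Suc i) = {g \<in> carrier G. \<forall>h\<in>carrier G. comm_elt G g h \<in> rel_ucs N i}"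

lemma central_over_normal:
  assumes N: "N \<lhd> G"
  shows "{g \<in> carrier G. \<forall>h\<in>carrier G. comm_elt G g h \<in> N} \<lhd> G" (is "?T \<lhd> G")
proof (rule normalI')
  have o: "\<one> \<in> N" using N normal_imp_subgroup subgroup.one_closed by blast
  show "subgroup ?T G"
  proof (rule subgroupI)
    show "?T \<noteq> {}" using o by (auto intro!: exI[of _ \<one>])
  qed (auto intro: normal_comm_elt_subst(4,5)[OF N])
  fix x g assume x: "x \<in> ?T" and g: "g \<in> carrier G"
  have "comm_elt G (inv g \<otimes> x \<otimes> g) h \<in> N" if h: "h \<in> carrier G" for h
  proof -
    have "comm_elt G x (g \<otimes> h \<otimes> inv g) \<in> N" using x g h by blast
    then have "inv g \<otimes> comm_elt G x (g \<otimes> h \<otimes> inv g) \<otimes> g \<in> N" using normal_conj(1)[OF N _ g] by blast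
    then show ?thesis using x g h by (simp add: word_simps)
  qed
  then show "inv g \<otimes> x \<otimes> g \<in> ?T" using x g by auto
qed

lemma ucs_normal: "ucs i \<lhd> G"
  by (induction i) (use one_is_normal central_over_normal in auto)

lemma rel_ucs_normal: "N \<lhd> G \<Longrightarrow> rel_ucs N i \<lhd> G"
  by (induction i) (use central_over_normal in auto)

lemma ucs_subgroup: "subgroup (ucs i) G"
  using ucs_normal normal_imp_subgroup by blast

lemma ucs_carrier: "x \<in> ucs i \<Longrightarrow> x \<in> carrier G"
  using ucs_subgroup subgroup.mem_carrier by metis

lemma ucs_Suc_subset: "ucs i \<subseteq> ucs (Suc i)"
  using normal_comm_elt[OF ucs_normal] ucs_carrier by auto

lemma ucs_mono: "i \<le> k \<Longrightarrow> ucs i \<subseteq> ucs k"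
  using ucs_Suc_subset by (rule lift_Suc_mono_le)

text \<open>Truncated subtraction is right also for i = 0, so later index computations need no case
  distinction.\<close>

lemma ucs_comm:
  assumes "a \<in> ucs i" "g \<in> carrier G" shows "comm_elt G a g \<in> ucs (i - 1)"
proof (cases i)
  case 0
  then show ?thesis using assms by simp
next
  case (Suc k)
  then show ?thesis using assms by simp
qed

lemma ucs_sub_rel_ucs: "N \<lhd> G \<Longrightarrow> ucs i \<subseteq> rel_ucs N i"
proof (induction i)
  case 0
  then show ?case using normal_imp_subgroup subgroup.one_closed by auto
qed auto

lemma iter_comm_carrier: "iter_comm G (carrier G) (carrier G) i \<subseteq> carrier G"
proof (induction i)
  case (Suc i)
  show ?case unfolding iter_comm.simps comm_subgroup_def by (rule generate_incl) (use Suc in auto)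
qed simp

lemma iter_comm_mem: "x \<in> iter_comm G (carrier G) (carrier G) i \<Longrightarrow> x \<in> carrier G"
  using iter_comm_carrier by blast

lemma iter_comm_normal: "iter_comm G (carrier G) (carrier G) i \<lhd> G"
proof (induction i)
  case 0
  then show ?case using normal_self by simp
next
  case (Suc i)
  let ?I = "iter_comm G (carrier G) (carrier G)"
  let ?K = "{comm_elt G h k |h k. h \<in> ?I i \<and> k \<in> carrier G}"
  have KC: "?K \<subseteq> carrier G" by (auto dest: iter_comm_mem)
  have sub: "subgroup (?I (Suc i)) G" unfolding iter_comm.simps comm_subgroup_def by (rule generate_is_subgroup[OF KC])
  have "?I (Suc i) \<subseteq> ?I i"
    unfolding iter_comm.simps(2) comm_subgroup_def
    by (rule generate_subgroup_incl) (use normal_comm_elt[OF Suc] iter_comm_mem normal_imp_subgroup[OF Suc] in auto)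
  then have "comm_elt G x g \<in> ?I (Suc i)" if "x \<in> ?I (Suc i)" "g \<in> carrier G" for x g
    using that unfolding iter_comm.simps comm_subgroup_def by (auto intro!: generate.incl)
  then show ?case
  proof (intro normalI'[OF sub])
    fix x g assume h: "\<And>x g. x \<in> ?I (Suc i) \<Longrightarrow> g \<in> carrier G \<Longrightarrow> comm_elt G x g \<in> ?I (Suc i)"
      and x: "x \<in> ?I (Suc i)" and g: "g \<in> carrier G"
    have "x \<otimes> comm_elt G x g \<in> ?I (Suc i)" using subgroup.m_closed[OF sub x h[OF x g]] .
    moreover have "x \<in> carrier G" using x subgroup.mem_carrier[OF sub] by blast
    ultimately show "inv g \<otimes> x \<otimes> g \<in> ?I (Suc i)" using g by (simp add: conj_eq_comm_elt)
  qed
qed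

lemma iter_comm_one_imp_ucs:
  assumes "iter_comm G (carrier G) (carrier G) c = {\<one>}" shows "ucs c = carrier G"
proof -
  have "i \<le> c \<Longrightarrow> iter_comm G (carrier G) (carrier G) (c - i) \<subseteq> ucs i" for i
  proof (induction i)
    case 0
    then show ?case using assms by simp
  next
    case (Suc i)
    let ?I = "iter_comm G (carrier G) (carrier G)"
    have e: "c - i = Suc (c - Suc i)" using Suc by simp
    have "comm_elt G a h \<in> ucs i" if "a \<in> ?I (c - Suc i)" "h \<in> carrier G" for a h
    proof -
      have "comm_elt G a h \<in> ?I (c - i)"
        unfolding e iter_comm.simps comm_subgroup_def using that by (auto intro: generate.incl)
      then show ?thesis using Suc by auto
    qed
    then show ?case using iter_comm_carrier by auto
  qed
  from this[of c] show ?thesis using ucs_carrier by auto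
qed

lemma ucs_imp_iter_comm_one:
  assumes "ucs c = carrier G" shows "iter_comm G (carrier G) (carrier G) c = {\<one>}"
proof -
  have "i \<le> c \<Longrightarrow> iter_comm G (carrier G) (carrier G) i \<subseteq> ucs (c - i)" for i
  proof (induction i)
    case 0
    then show ?case using assms by simp
  next
    case (Suc i)
    have "c - i - 1 = c - Suc i" by simp
    moreover have "iter_comm G (carrier G) (carrier G) i \<subseteq> ucs (c - i)" using Suc by simp
    ultimately have "{comm_elt G h k |h k. h \<in> iter_comm G (carrier G) (carrier G) i \<and> k \<in> carrier G} \<subseteq> ucs (c - Suc i)"
      using ucs_comm[of _ "c - i"] by auto
    then show ?case
      unfolding iter_comm.simps comm_subgroup_def by (rule generate_subgroup_incl[OF _ ucs_subgroup])
  qed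
  from this[of c] have "iter_comm G (carrier G) (carrier G) c \<subseteq> {\<one>}" by simp
  then show ?thesis using subgroup.one_closed[OF normal_imp_subgroup[OF iter_comm_normal]] by blast
qed

text \<open>Collection in a group of class two, required only of the pair x, y: moving x past y^k
  costs z^k, and these exponents add up to m(m - 1)/2.\<close>

lemma class_two_power:
  assumes C: "x \<in> carrier G" "y \<in> carrier G" and z: "z = comm_elt G y x"
    and zx: "z \<otimes> x = x \<otimes> z" and zy: "z \<otimes> y = y \<otimes> z"
  shows "(x \<otimes> y) [^] (m::nat) = x [^] m \<otimes> y [^] m \<otimes> z [^] (m * (m - 1) div 2)"
proof (induction m)
  case (Suc m)
  have zC: "z \<in> carrier G" using z C by simp
  have yx: "y \<otimes> x = x \<otimes> y \<otimes> z" using z C by (simp add: word_simps)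
  have zp: "z [^] k \<otimes> w = w \<otimes> z [^] k" if "z \<otimes> w = w \<otimes> z" "w \<in> carrier G" for w and k :: nat
  proof (induction k)
    case (Suc k)
    have "z [^] Suc k \<otimes> w = z [^] k \<otimes> w \<otimes> z" using that zC by (simp add: m_assoc)
    then show ?case using Suc that zC by (simp add: m_assoc)
  qed (use that in simp)
  have yk: "y [^] k \<otimes> x = x \<otimes> y [^] k \<otimes> z [^] k" for k :: nat
  proof (induction k)
    case (Suc k)
    have "y [^] Suc k \<otimes> x = y [^] k \<otimes> x \<otimes> y \<otimes> z" using C zC yx by (simp add: m_assoc)
    also have "\<dots> = x \<otimes> y [^] k \<otimes> (z [^] k \<otimes> y) \<otimes> z" unfolding Suc using C zC by (simp add: m_assoc)
    also have "\<dots> = x \<otimes> y [^] Suc k \<otimes> z [^] Suc k" unfolding zp[OF zy C(2)] using C zC by (simp add: m_assoc)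
    finally show ?case .
  qed (use C in simp)
  let ?t = "m * (m - 1) div 2"
  have t: "Suc m * (Suc m - 1) div 2 = m + ?t" by (cases m) auto
  have "(x \<otimes> y) [^] Suc m = x [^] m \<otimes> y [^] m \<otimes> (z [^] ?t \<otimes> x) \<otimes> y" using Suc C zC by (simp add: m_assoc)
  also have "\<dots> = x [^] m \<otimes> (y [^] m \<otimes> x) \<otimes> (z [^] ?t \<otimes> y)" unfolding zp[OF zx C(1)] using C zC by (simp add: m_assoc)
  also have "\<dots> = x [^] m \<otimes> (x \<otimes> y [^] m \<otimes> z [^] m) \<otimes> (y \<otimes> z [^] ?t)" unfolding yk zp[OF zy C(2)] ..
  also have "\<dots> = x [^] Suc m \<otimes> y [^] m \<otimes> (z [^] m \<otimes> y) \<otimes> z [^] ?t" using C zC by (simp add: m_assoc)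
  also have "\<dots> = x [^] Suc m \<otimes> y [^] Suc m \<otimes> (z [^] m \<otimes> z [^] ?t)"
    unfolding zp[OF zy C(2)] using C zC by (simp add: m_assoc)
  also have "z [^] m \<otimes> z [^] ?t = z [^] (Suc m * (Suc m - 1) div 2)" unfolding t using zC by (simp add: nat_pow_mult)
  finally show ?case .
qed (use C z in simp)

end

section \<open>Nilpotency of p-groups and maximal elementary abelian normal subgroups\<close>

context p_group
begin

lemma ucs_proper: "ucs i \<noteq> carrier G \<Longrightarrow> ucs i \<subset> ucs (Suc i)"
proof -
  assume "ucs i \<noteq> carrier G"
  then have "\<not> carrier G \<subseteq> ucs i" using ucs_carrier by blast
  then obtain x where x: "x \<in> carrier G" "x \<notin> ucs i" "\<And>g. g \<in> carrier G \<Longrightarrow> comm_elt G x g \<in> ucs i"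
    using central_step[OF ucs_normal normal_self] by metis
  then have "x \<in> ucs (Suc i)" by simp
  then show ?thesis using x ucs_Suc_subset by blast
qed

lemma ucs_top: obtains c where "ucs c = carrier G"
proof -
  have "ucs i = carrier G \<or> i < card (ucs i)" for i
  proof (induction i)
    case 0
    then show ?case by simp
  next
    case (Suc i)
    show ?case
    proof (cases "ucs i = carrier G")
      case True
      then show ?thesis using ucs_Suc_subset[of i] ucs_carrier[of _ "Suc i"] by blast
    next
      case False
      have "card (ucs i) < card (ucs (Suc i))"
        using ucs_proper[OF False] fin_subgroup[OF ucs_subgroup] psubset_card_mono by blast
      then show ?thesis using Suc False by linarith
    qed
  qed
  moreover have "card (ucs i) \<le> order G" for i
    unfolding order_def using fin ucs_carrier by (intro card_mono) auto
  ultimately have "ucs (order G) = carrier G" by (meson leD)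
  then show ?thesis using that by blast
qed

text \<open>\<open>LEAST\<close> is meaningful because the upper central series of a finite p-group
  reaches the whole group.\<close>

lemma nilpotency_class_correct:
  shows "iter_comm G (carrier G) (carrier G) (nilpotency_class G) = {\<one>}"
    and "c < nilpotency_class G \<Longrightarrow> iter_comm G (carrier G) (carrier G) c \<noteq> {\<one>}"
proof -
  obtain c0 where "ucs c0 = carrier G" using ucs_top .
  then have "iter_comm G (carrier G) (carrier G) c0 = {\<one>}" using ucs_imp_iter_comm_one by blast
  then show "iter_comm G (carrier G) (carrier G) (nilpotency_class G) = {\<one>}"
    unfolding nilpotency_class_def by (rule LeastI)
  show "c < nilpotency_class G \<Longrightarrow> iter_comm G (carrier G) (carrier G) c \<noteq> {\<one>}"
    unfolding nilpotency_class_def by (rule not_less_Least)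
qed

text \<open>Alperin's argument: if \<open>x \<in> C\<^sub>G(N)\<close> has order \<open>p\<close> and lies as low as possible in the central
  series over \<open>N\<close>, then \<open>[x, G] \<le> N\<close>; otherwise a commutator \<open>y = [x, t] \<notin> N\<close> as low as possible
  would have order \<open>p\<close> too, because \<open>\<langle>x, y\<rangle>\<close> has class two and \<open>x y = x\<^sup>t\<close>.\<close>

lemma maximal_elementary_abelian_normal:
  assumes podd: "odd p" and N: "N \<lhd> G" and eN: "elementary_abelian p G N"
    and max: "\<And>B. B \<lhd> G \<Longrightarrow> elementary_abelian p G B \<Longrightarrow> N \<subseteq> B \<Longrightarrow> B = N"
    and x: "x \<in> centralizer G N" "x [^] p = \<one>"
  shows "x \<in> N"
proof (rule ccontr)
  assume "x \<notin> N"
  have sN: "subgroup N G" using N normal_imp_subgroup by blast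
  have nC: "centralizer G N \<lhd> G" by (rule centralizer_normal[OF N])
  obtain c where c: "ucs c = carrier G" using ucs_top .
  have R: "rel_ucs N c = carrier G"
    using c ucs_sub_rel_ucs[OF N, of c] subgroup.subset[OF normal_imp_subgroup[OF rel_ucs_normal[OF N]]] by blast
  define P where "P = (\<lambda>i. \<exists>x\<in>centralizer G N. x [^] p = \<one> \<and> x \<notin> N \<and> x \<in> rel_ucs N i)"
  have "P c" unfolding P_def using R x \<open>x \<notin> N\<close> by (auto simp: centralizer_def)
  define i where "i = (LEAST i. P i)"
  have Pi: "P i" unfolding i_def by (rule LeastI) fact
  have less: "\<not> P k" if "k < i" for k using that not_less_Least unfolding i_def by blast
  obtain x where x: "x \<in> centralizer G N" "x [^] p = \<one>" "x \<notin> N" "x \<in> rel_ucs N i" using Pi unfolding P_def by blast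
  have xC: "x \<in> carrier G" using x unfolding centralizer_def by auto
  obtain k where k: "i = Suc k" using x by (cases i) auto
  have xk: "comm_elt G x g \<in> rel_ucs N k" if "g \<in> carrier G" for g using x(4) that unfolding k by simp
  have inN: "comm_elt G x g \<in> N" if g: "g \<in> carrier G" for g
  proof (rule ccontr)
    assume nin: "comm_elt G x g \<notin> N"
    define T where "T = (\<lambda>l. \<exists>t\<in>carrier G. comm_elt G x t \<notin> N \<and> comm_elt G x t \<in> rel_ucs N l)"
    have "T k" unfolding T_def using nin g xk by blast
    define l where "l = (LEAST l. T l)"
    have Tl: "T l" unfolding l_def by (rule LeastI) fact
    have lessT: "\<not> T l'" if "l' < l" for l' using that not_less_Least unfolding l_def by blast
    obtain t where t: "t \<in> carrier G" "comm_elt G x t \<notin> N" "comm_elt G x t \<in> rel_ucs N l" using Tl unfolding T_def by blast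
    obtain l' where l': "l = Suc l'" using t by (cases l) auto
    define y where "y = comm_elt G x t"
    have yC: "y \<in> carrier G" unfolding y_def using xC t by simp
    have yCN: "y \<in> centralizer G N" unfolding y_def using normal_comm_elt[OF nC xC t(1)] x by blast
    \<comment> \<open>[x, y] is a commutator of x one level below y, so it lies in \<open>N\<close>
      by the choice of \<open>l\<close>. Since x and y centralize \<open>N\<close>, it commutes with
      both.\<close>
    have "comm_elt G y x \<in> rel_ucs N l'" using t(3) xC unfolding l' y_def by simp
    then have "comm_elt G x y \<in> rel_ucs N l'"
      using normal_comm_elt_subst(3)[OF rel_ucs_normal[OF N] yC xC xC] by blast
    then have "comm_elt G x y \<in> N" using lessT[of l'] yC unfolding T_def l' by blast
    then have z: "comm_elt G y x \<in> N" using normal_comm_elt_subst(3)[OF N xC yC yC] by blast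
    define z where "z = comm_elt G y x"
    have zC: "z \<in> carrier G" unfolding z_def using xC yC by simp
    have zc: "z \<otimes> x = x \<otimes> z" "z \<otimes> y = y \<otimes> z" using z x(1) yCN unfolding z_def[symmetric] centralizer_def by auto
    have zp: "z [^] p = \<one>" using z eN unfolding elementary_abelian_iff z_def by blast
    have "p dvd p * (p - 1) div 2"
    proof -
      obtain q where "p = 2 * q + 1" using podd oddE by blast
      then have "p * (p - 1) div 2 = p * q" by simp
      then show ?thesis by simp
    qed
    then have zt: "z [^] (p * (p - 1) div 2) = \<one>"
      using zp zC by (metis dvdE nat_pow_one nat_pow_pow)
    have "x \<otimes> y = inv t \<otimes> x \<otimes> t" unfolding y_def using xC t by (simp add: conj_eq_comm_elt)
    then have "(x \<otimes> y) [^] p = \<one>" using conj_pow[OF xC t(1), of p] x t by simp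
    then have "y [^] p = \<one>"
      using class_two_power[OF xC yC z_def zc, of p] x(2) zt yC by simp
    then have "P k" unfolding P_def using yCN t(2) xk[OF t(1)] unfolding y_def by blast
    then show False using less k by simp
  qed
  define Y where "Y = generate G {x}"
  have gen: "Y = {x [^] k | k. k \<in> (UNIV::nat set)}" unfolding Y_def using generate_pow_on_finite_carrier[OF fin xC] .
  have sY: "subgroup Y G" unfolding Y_def using generate_is_subgroup xC by blast
  have eY: "elementary_abelian p G Y"
    unfolding elementary_abelian_iff using sY x(2) xC unfolding gen
    by (auto simp: nat_pow_pow nat_pow_mult add.commute mult.commute[of _ p]) (simp flip: nat_pow_pow)
  have NY: "a \<otimes> w = w \<otimes> a" if "a \<in> N" "w \<in> Y" for a w
  proof -
    have "Y \<subseteq> centralizer G N"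
      unfolding Y_def using generate_subgroup_incl[OF _ normal_imp_subgroup[OF nC]] x by blast
    then show ?thesis using that unfolding centralizer_def by fastforce
  qed
  \<comment> \<open>[x, G] <= N makes the product of \<open>N\<close> with the group generated by x
    normal; it is elementary abelian and strictly larger than \<open>N\<close>.\<close>
  define B where "B = N <#> Y"
  have eB: "elementary_abelian p G B" unfolding B_def by (rule set_mult_elementary_abelian[OF eN eY NY])
  then have sB: "subgroup B G" unfolding elementary_abelian_iff by blast
  have NB: "N \<subseteq> B" "Y \<subseteq> B"
    unfolding B_def using set_mult_memI[of _ N \<one> Y G] set_mult_memI[of \<one> N _ Y G]
      subgroup.one_closed[OF sY] subgroup.one_closed[OF sN] subgroup.mem_carrier[OF sN] subgroup.mem_carrier[OF sY] by auto
  have xY: "x \<in> Y" unfolding Y_def by (simp add: generate.incl)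
  have powB: "b [^] (m::nat) \<in> B" if "b \<in> B" for b m
    using that subgroup.m_closed[OF sB] subgroup.one_closed[OF sB] by (induction m) auto
  have "B \<lhd> G"
  proof (rule normalI'[OF sB])
    fix b g assume b: "b \<in> B" and g: "g \<in> carrier G"
    obtain a k where b': "a \<in> N" "b = a \<otimes> x [^] (k::nat)" using b unfolding B_def set_mult_def gen by auto
    have aC: "a \<in> carrier G" using b' subgroup.mem_carrier[OF sN] by blast
    have "inv g \<otimes> b \<otimes> g = (inv g \<otimes> a \<otimes> g) \<otimes> (inv g \<otimes> x [^] k \<otimes> g)" unfolding b' using aC xC g by (simp add: m_assoc)
    also have "\<dots> = (inv g \<otimes> a \<otimes> g) \<otimes> (x \<otimes> comm_elt G x g) [^] k"
      unfolding conj_pow[OF xC g] conj_eq_comm_elt[OF xC g] ..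
    finally show "inv g \<otimes> b \<otimes> g \<in> B"
      using powB subgroup.m_closed[OF sB] NB xY inN[OF g] normal_conj(1)[OF N b'(1) g]
      by (metis subsetD)
  qed
  then have "B = N" using max eB NB by blast
  then show False using NB xY x(3) by blast
qed

end

text \<open>The bound 6 reflects class n - 1 > 4, smaller class being a case of its own. It gives
  room for the terms with indices n - 4 to n - 2 and for \<open>Z 4\<close>.\<close>

locale max_class_group = p_group +
  fixes n :: nat
  assumes ord: "order G = p ^ n" and n6: "n \<ge> 6" and cls: "nilpotency_class G = n - 1" and p_odd: "odd p"
begin

abbreviation Z where "Z \<equiv> ucs"

lemma p3: "p \<ge> 3" using p_odd p_gt_1 by presburger

lemma Z_top: "Z (n - 1) = carrier G"
  using nilpotency_class_correct(1) iter_comm_one_imp_ucs unfolding cls by blast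

lemma Z_not_top: "i \<le> n - 2 \<Longrightarrow> Z i \<noteq> carrier G"
proof
  assume "i \<le> n - 2" "Z i = carrier G"
  moreover from this have "i < n - 1" using n6 by linarith
  ultimately show False using nilpotency_class_correct(2)[of i] ucs_imp_iter_comm_one[of i] unfolding cls by blast
qed

lemma card_Z_step: "i \<le> n - 2 \<Longrightarrow> card (Z i) * p \<le> card (Z (Suc i))"
  using card_proper_subgroup[OF ucs_subgroup ucs_subgroup ucs_proper[OF Z_not_top]] .

lemma card_Z_ge: "i \<le> n - 1 \<Longrightarrow> p ^ i \<le> card (Z i)"
proof (induction i)
  case (Suc i)
  then have "p ^ i * p \<le> card (Z i) * p" by simp
  also have "\<dots> \<le> card (Z (Suc i))" using card_Z_step Suc by simp
  finally show ?case by (simp add: mult.commute)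
qed simp

text \<open>The elements commuting with s modulo \<open>Z i\<close> form a subgroup containing s and
  \<open>Z (Suc i)\<close>. If these generated \<open>G\<close>, then s would be central modulo
  \<open>Z i\<close>. The hypothesis \<open>gen\<close> expresses that \<open>T\<close> lies in the
  subgroup they generate.\<close>

lemma not_cyclic_over_Z:
  assumes s: "s \<in> carrier G" "s \<notin> Z (Suc i)"
    and T: "subgroup T G" and gen: "\<And>T'. subgroup T' G \<Longrightarrow> s \<in> T' \<Longrightarrow> Z (Suc i) \<subseteq> T' \<Longrightarrow> T \<subseteq> T'"
  shows "T \<noteq> carrier G"
proof
  assume TG: "T = carrier G"
  define T' where "T' = {g \<in> carrier G. comm_elt G s g \<in> Z i}"
  have "subgroup T' G"
  proof (rule subgroupI)
    show "T' \<noteq> {}" unfolding T'_def using s subgroup.one_closed[OF ucs_subgroup] by (auto intro!: exI[of _ \<one>])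
  qed (use s in \<open>auto simp: T'_def intro: normal_comm_elt_subst(1,2)[OF ucs_normal]\<close>)
  moreover have "s \<in> T'"
  proof -
    have "comm_elt G s s = \<one>" using comm_elt_eq_one_iff s by blast
    then show ?thesis unfolding T'_def using s subgroup.one_closed[OF ucs_subgroup] by simp
  qed
  moreover have "Z (Suc i) \<subseteq> T'"
  proof
    fix u assume u: "u \<in> Z (Suc i)"
    have uC: "u \<in> carrier G" using u ucs_carrier by blast
    have "comm_elt G u s \<in> Z i" using u s by simp
    then show "u \<in> T'" unfolding T'_def using normal_comm_elt_subst(3)[OF ucs_normal uC s(1) s(1)] uC by blast
  qed
  ultimately have "carrier G \<subseteq> T'" using gen TG by blast
  then have "s \<in> Z (Suc i)" unfolding T'_def using s by auto
  then show False using s by blast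
qed

text \<open>The quotient by \<open>Z (n - 2)\<close> is not cyclic, so it has order at least p^2.
  The n - 2 strict steps below share the remaining p^(n-2) and must all have index p.\<close>

lemma card_Z: "i \<le> n - 2 \<Longrightarrow> card (Z i) = p ^ i"
proof -
  have top: "card (Z (n - 2)) \<le> p ^ (n - 2)"
  proof -
    obtain b where b: "card (Z (n - 2)) = p ^ b" using card_subgroup_pow[OF ucs_subgroup] .
    have "\<not> carrier G \<subseteq> Z (n - 2)" using Z_not_top[of "n - 2"] ucs_carrier by blast
    then obtain s where s: "s \<in> carrier G" "s \<notin> Z (n - 2)" by blast
    define T where "T = generate G (insert s (Z (n - 2)))"
    have C: "insert s (Z (n - 2)) \<subseteq> carrier G" using s ucs_carrier by blast
    have sT: "subgroup T G" unfolding T_def by (rule generate_is_subgroup[OF C])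
    have n3: "n - 2 = Suc (n - 3)" using n6 by simp
    have "T \<noteq> carrier G"
    proof (rule not_cyclic_over_Z[of s "n - 3", OF s(1) _ sT])
      show "s \<notin> Z (Suc (n - 3))" using s n3 by simp
      show "T \<subseteq> T'" if "subgroup T' G" "s \<in> T'" "Z (Suc (n - 3)) \<subseteq> T'" for T'
        unfolding T_def by (rule generate_subgroup_incl) (use that n3 in auto)
    qed
    then have "T \<subset> carrier G" using subgroup.subset[OF sT] by blast
    then have "card T * p \<le> card (carrier G)" using card_proper_subgroup[OF sT subgroup_self] by blast
    moreover have "Z (n - 2) \<subset> T" unfolding T_def using s by (auto intro: generate.incl)
    then have "card (Z (n - 2)) * p \<le> card T" using card_proper_subgroup[OF ucs_subgroup sT] by blast
    then have "p ^ b * p * p \<le> card T * p" unfolding b by simp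
    ultimately have "p ^ b * p * p \<le> p ^ n" using ord unfolding order_def by linarith
    then have "p ^ (b + 2) \<le> p ^ n" by (simp only: power_add power2_eq_square mult.assoc)
    then have "b + 2 \<le> n" using p_gt_1 power_le_imp_le_exp by blast
    then show ?thesis unfolding b using p_gt_1 by (intro power_increasing) auto
  qed
  have down: "card (Z (n - 2 - d)) * p ^ d \<le> p ^ (n - 2)" if "d \<le> n - 2" for d
    using that
  proof (induction d)
    case (Suc d)
    have "Suc (n - 2 - Suc d) = n - 2 - d" using Suc by simp
    then have "card (Z (n - 2 - Suc d)) * p \<le> card (Z (n - 2 - d))" using card_Z_step[of "n - 2 - Suc d"] by simp
    then have "card (Z (n - 2 - Suc d)) * p * p ^ d \<le> card (Z (n - 2 - d)) * p ^ d" by simp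
    also have "\<dots> \<le> p ^ (n - 2)" using Suc by simp
    finally show ?case unfolding power_Suc mult.assoc .
  qed (use top in simp)
  assume i: "i \<le> n - 2"
  have "card (Z i) * p ^ (n - 2 - i) \<le> p ^ i * p ^ (n - 2 - i)"
    using down[of "n - 2 - i"] i by (simp only: diff_diff_cancel diff_le_self le_add_diff_inverse flip: power_add)
  then have "card (Z i) \<le> p ^ i" using p_gt_1 by simp
  then show ?thesis using card_Z_ge[of i] i by simp
qed

text \<open>If \<open>N\<close> has more elements than \<open>Z i\<close>, then by
  \<open>central_step\<close> it meets \<open>Z (Suc i)\<close> outside \<open>Z i\<close>, and that
  section has order p. Consequently the normal subgroups of index at least p^2 are exactly the terms
  \<open>Z i\<close>.\<close>

lemma Z_sub_normal:
  assumes N: "N \<lhd> G" and "p ^ i \<le> card N" "i \<le> n - 2"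
  shows "Z i \<subseteq> N"
  using assms(2,3)
proof (induction i)
  case 0
  then show ?case using subgroup.one_closed[OF normal_imp_subgroup[OF N]] by simp
next
  case (Suc i)
  have "p ^ i \<le> p ^ Suc i" using p_gt_1 by simp
  then have "p ^ i \<le> card N" using Suc.prems(1) by linarith
  then have IH: "Z i \<subseteq> N" using Suc.IH Suc.prems(2) by linarith
  have sN: "subgroup N G" using N normal_imp_subgroup by blast
  have "\<not> N \<subseteq> Z i"
  proof
    assume "N \<subseteq> Z i"
    then have "card N \<le> p ^ i" using card_Z[of i] Suc(3) fin_subgroup[OF ucs_subgroup[of i]] card_mono by fastforce
    then show False using Suc(2) p_gt_1 by (meson lessI linorder_not_le order_trans power_strict_increasing)
  qed
  then obtain x where x: "x \<in> N" "x \<notin> Z i" "\<And>g. g \<in> carrier G \<Longrightarrow> comm_elt G x g \<in> Z i"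
    using central_step[OF ucs_normal N] by metis
  have sI: "subgroup (N \<inter> Z (Suc i)) G" using subgroups_Inter_pair[OF sN ucs_subgroup] .
  have "x \<in> N \<inter> Z (Suc i)" using x subgroup.mem_carrier[OF sN] by simp
  then have "Z i \<subset> N \<inter> Z (Suc i)" using x IH ucs_Suc_subset by blast
  then have "card (Z i) * p \<le> card (N \<inter> Z (Suc i))" using card_proper_subgroup[OF ucs_subgroup sI] by blast
  then have "card (Z (Suc i)) \<le> card (N \<inter> Z (Suc i))" using card_Z[of i] card_Z[OF Suc(3)] Suc(3) by (simp add: mult.commute del: ucs.simps)
  then have "N \<inter> Z (Suc i) = Z (Suc i)" using eq_if_card_le[OF ucs_subgroup] by blast
  then show ?case by blast
qed

lemma normal_eq_Z:
  assumes "N \<lhd> G" "card N = p ^ i" "i \<le> n - 2" shows "N = Z i"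
proof -
  have "Z i \<subseteq> N" using Z_sub_normal assms by simp
  then have "Z i = N"
    by (rule eq_if_card_le[OF normal_imp_subgroup[OF assms(1)]]) (use card_Z assms in simp)
  then show ?thesis ..
qed

lemma card_gamma:
  assumes i: "i \<le> n - 1" shows "p ^ (n - 1 - i) \<le> card (iter_comm G (carrier G) (carrier G) i)"
proof -
  let ?I = "iter_comm G (carrier G) (carrier G)"
  have sI: "subgroup (?I k) G" for k using normal_imp_subgroup[OF iter_comm_normal] .
  have dec: "?I (Suc k) \<subseteq> ?I k" for k
    unfolding iter_comm.simps(2) comm_subgroup_def
    by (rule generate_subgroup_incl) (use normal_comm_elt[OF iter_comm_normal] iter_comm_mem sI in auto)
  have proper: "?I (Suc k) \<subset> ?I k" if "k < n - 1" for k
  proof -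
    have "?I (Suc k) \<noteq> ?I k"
    proof
      assume eq: "?I (Suc k) = ?I k"
      have "?I (k + d) = ?I k" for d by (induction d) (use eq in simp_all)
      then have "?I k = {\<one>}" using nilpotency_class_correct(1) that unfolding cls by (metis le_add_diff_inverse less_imp_le)
      then show False using nilpotency_class_correct(2)[of k] that cls by simp
    qed
    then show ?thesis using dec by blast
  qed
  have "p ^ d \<le> card (?I (n - 1 - d))" if "d \<le> n - 1" for d
    using that
  proof (induction d)
    case 0
    then show ?case using nilpotency_class_correct(1) unfolding cls by simp
  next
    case (Suc d)
    have e: "Suc (n - 1 - Suc d) = n - 1 - d" using Suc by simp
    have "n - 1 - Suc d < n - 1" using Suc by simp
    then have "card (?I (n - 1 - d)) * p \<le> card (?I (n - 1 - Suc d))"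
      using card_proper_subgroup[OF sI sI proper, of "n - 1 - Suc d"] unfolding e by blast
    moreover have "p ^ d * p \<le> card (?I (n - 1 - d)) * p" using Suc by simp
    ultimately show ?case unfolding power_Suc2 by linarith
  qed
  from this[of "n - 1 - i"] show ?thesis using i by (simp only: diff_diff_cancel diff_le_self)
qed

text \<open>The classical estimate for a commutator of the upper with the lower central series, by
  induction on the lower index with the three subgroups lemma; \<open>iter_comm\<close> number i is
  the lower term number i + 1.\<close>

lemma Z_comm_gamma:
  "a \<in> Z k \<Longrightarrow> w \<in> iter_comm G (carrier G) (carrier G) i \<Longrightarrow> comm_elt G a w \<in> Z (k - Suc i)"
proof (induction i arbitrary: a w k)
  case 0
  then show ?case using ucs_comm by simp
next
  case (Suc i)
  let ?I = "iter_comm G (carrier G) (carrier G)"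
  have sI: "subgroup (?I i) G" using normal_imp_subgroup[OF iter_comm_normal] .
  define T where "T = {w \<in> carrier G. comm_elt G a w \<in> Z (k - Suc (Suc i))}"
  have aC: "a \<in> carrier G" using Suc ucs_carrier by blast
  have sT: "subgroup T G"
  proof (rule subgroupI)
    show "T \<noteq> {}" unfolding T_def using aC subgroup.one_closed[OF ucs_subgroup] by (auto intro!: exI[of _ \<one>])
  qed (use aC in \<open>auto simp: T_def intro: normal_comm_elt_subst(1,2)[OF ucs_normal]\<close>)
  have "comm_elt G b c \<in> T" if b: "b \<in> ?I i" and c: "c \<in> carrier G" for b c
  proof -
    have bC: "b \<in> carrier G" using b subgroup.mem_carrier[OF sI] by blast
    have "comm_elt G (comm_elt G b c) a \<in> Z (k - Suc (Suc i))"
    proof (rule three_subgroups[OF ucs_normal subgroup_self ucs_subgroup[of k] sI _ _ c Suc(2) b])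
      fix c' a' b' assume m: "c' \<in> carrier G" "a' \<in> Z k" "b' \<in> ?I i"
      have C: "a' \<in> carrier G" "b' \<in> carrier G" using m ucs_carrier subgroup.mem_carrier[OF sI] by auto
      have "comm_elt G c' a' \<in> Z (k - 1)"
        using normal_comm_elt_subst(3)[OF ucs_normal C(1) m(1) m(1)] ucs_comm[OF m(2,1)] by blast
      then have "comm_elt G (comm_elt G c' a') b' \<in> Z (k - 1 - Suc i)" using Suc.IH m(3) by blast
      then show "comm_elt G (comm_elt G c' a') b' \<in> Z (k - Suc (Suc i))" by simp
      have "comm_elt G a' b' \<in> Z (k - Suc i)" using Suc.IH m by blast
      then have "comm_elt G (comm_elt G a' b') c' \<in> Z (k - Suc i - 1)" using ucs_comm m by blast
      then show "comm_elt G (comm_elt G a' b') c' \<in> Z (k - Suc (Suc i))" by simp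
    qed
    then show ?thesis unfolding T_def
      using normal_comm_elt_subst(3)[OF ucs_normal _ aC aC, of "comm_elt G b c"] bC c by auto
  qed
  then have "?I (Suc i) \<subseteq> T"
    unfolding iter_comm.simps comm_subgroup_def by (intro generate_subgroup_incl[OF _ sT]) auto
  then show ?case using Suc(3) unfolding T_def by blast
qed

text \<open>Comparing orders, \<open>Z (n - Suc i)\<close> lies in the lower central term number i +
  1, so \<open>Z_comm_gamma\<close> applies with upper central terms on both sides.\<close>

lemma Z_comm_Z:
  assumes a: "a \<in> Z k" and w: "w \<in> Z (n - Suc i)" and i: "1 \<le> i" "i \<le> n - 1"
  shows "comm_elt G a w \<in> Z (k - Suc i)" "comm_elt G w a \<in> Z (k - Suc i)"
proof -
  have "Z (n - Suc i) \<subseteq> iter_comm G (carrier G) (carrier G) i"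
    by (rule Z_sub_normal[OF iter_comm_normal]) (use card_gamma[of i] i in auto)
  then show "comm_elt G a w \<in> Z (k - Suc i)" using Z_comm_gamma a w by blast
  then show "comm_elt G w a \<in> Z (k - Suc i)"
    using normal_comm_elt_subst(3)[OF ucs_normal ucs_carrier[OF a] ucs_carrier[OF w] ucs_carrier[OF w]] by blast
qed

end

lemma (in group) conj_action_mult:
  assumes "a \<in> carrier G" "b \<in> carrier G" "g \<in> carrier G"
  shows "inv g \<otimes> (a \<otimes> b) \<otimes> g = (inv g \<otimes> a \<otimes> g) \<otimes> (inv g \<otimes> b \<otimes> g)"
  using assms by (simp add: m_assoc)

section \<open>Two-step centralizers in groups of maximal class\<close>

context max_class_group
begin

declare ucs.simps(2) [simp del]

text \<open>\<open>Cz j\<close> is the two-step centralizer \<open>C\<^sub>G(Z\<^sub>j\<^sub>+\<^sub>1/Z\<^sub>j\<^sub>-\<^sub>1)\<close>, meaningful for \<open>j \<ge> 1\<close>.\<close>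

definition Cz :: "nat \<Rightarrow> 'a set" where
  "Cz j = {g \<in> carrier G. \<forall>a\<in>Z (Suc j). comm_elt G a g \<in> Z (j - 1)}"

text \<open>The centralizer of Z_(n-2)/Z_(n-4), classically the centralizer of the second modulo the
  fourth lower central term.\<close>

abbreviation D where "D \<equiv> Cz (n - 3)"

text \<open>One element a tests membership: the section \<open>Z (Suc j)\<close> over
  \<open>Z j\<close> has order p, and commutators of \<open>Z j\<close> lie in
  \<open>Z (j - 1)\<close> anyway.\<close>

lemma Cz_iff:
  assumes j: "j \<le> n - 3" and a: "a \<in> Z (Suc j)" "a \<notin> Z j" and g: "g \<in> carrier G"
  shows "g \<in> Cz j \<longleftrightarrow> comm_elt G a g \<in> Z (j - 1)"
proof
  assume c: "comm_elt G a g \<in> Z (j - 1)"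
  define T where "T = {b \<in> Z (Suc j). comm_elt G b g \<in> Z (j - 1)}"
  have sT: "subgroup T G"
  proof (rule subgroupI)
    show "T \<subseteq> carrier G" unfolding T_def using ucs_carrier by blast
    show "T \<noteq> {}" using a c unfolding T_def by blast
  qed (use g ucs_carrier in \<open>auto simp: T_def intro: normal_comm_elt_subst(4,5)[OF ucs_normal] subgroup.m_closed[OF ucs_subgroup] subgroup.m_inv_closed[OF ucs_subgroup]\<close>)
  have "Z j \<subseteq> T" unfolding T_def using ucs_comm[OF _ g] ucs_Suc_subset by blast
  then have "Z j \<subset> T" using a c unfolding T_def by blast
  then have "card (Z j) * p \<le> card T" using card_proper_subgroup[OF ucs_subgroup sT] by blast
  then have "card (Z (Suc j)) \<le> card T" using card_Z[of j] card_Z[of "Suc j"] j n6 by (simp add: mult.commute)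
  then have "T = Z (Suc j)" using eq_if_card_le[OF ucs_subgroup, of T "Suc j"] unfolding T_def by blast
  then show "g \<in> Cz j" unfolding Cz_def T_def using g by blast
qed (use a in \<open>auto simp: Cz_def\<close>)

lemma Z_gap: assumes "i < n - 1" obtains a where "a \<in> Z (Suc i)" "a \<notin> Z i"
proof -
  have "i \<le> n - 2" using assms by linarith
  then show ?thesis using that ucs_proper[OF Z_not_top] by blast
qed

lemma Cz_subgroup: "subgroup (Cz j) G"
proof (rule subgroupI)
  have "\<one> \<in> Cz j" unfolding Cz_def using ucs_carrier subgroup.one_closed[OF ucs_subgroup] by auto
  then show "Cz j \<noteq> {}" by blast
qed (use ucs_carrier in \<open>auto simp: Cz_def intro: normal_comm_elt_subst(1,2)[OF ucs_normal]\<close>)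

lemma Z_sub_Cz: "Z (n - 2) \<subseteq> Cz j"
proof
  fix w assume w: "w \<in> Z (n - 2)"
  have "comm_elt G a w \<in> Z (j - 1)" if "a \<in> Z (Suc j)" for a
    using Z_comm_Z(1)[OF that, of w 1] w n6 by (simp add: numeral_2_eq_2)
  then show "w \<in> Cz j" unfolding Cz_def using w ucs_carrier by blast
qed

text \<open>For a in \<open>Z (Suc j)\<close> outside \<open>Z j\<close>, the class of [a, g] in the
  section of order p below \<open>Z j\<close> determines g up to \<open>Cz j\<close>, so the index
  is at most p. It is not 1, as a would then lie in \<open>Z j\<close>.\<close>

lemma card_Cz:
  assumes j: "1 \<le> j" "j \<le> n - 3" shows "card (Cz j) = p ^ (n - 1)"
proof -
  obtain a where a: "a \<in> Z (Suc j)" "a \<notin> Z j" by (rule Z_gap[of j]) (use j n6 in linarith)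
  have aC: "a \<in> carrier G" using a ucs_carrier by blast
  have sC: "subgroup (Cz j) G" by (rule Cz_subgroup)
  have "Cz j \<noteq> carrier G"
  proof
    assume "Cz j = carrier G"
    then have "comm_elt G a g \<in> Z (j - 1)" if "g \<in> carrier G" for g using that a unfolding Cz_def by blast
    then have "a \<in> Z (Suc (j - 1))" using aC by (simp add: ucs.simps)
    then show False using a j by simp
  qed
  then have "Cz j \<subset> carrier G" using subgroup.subset[OF sC] by blast
  then have le: "card (Cz j) * p \<le> card (carrier G)" using card_proper_subgroup[OF sC subgroup_self] by blast
  define H where "H = G\<lparr>carrier := Z j\<rparr>"
  have gH: "group H" unfolding H_def using subgroup_imp_group[OF ucs_subgroup] .
  have Zsub: "Z (j - 1) \<subseteq> Z j" using ucs_mono by simp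
  define f where "f = (\<lambda>g. Z (j - 1) #> comm_elt G a g)"
  have "card (carrier G) \<le> card (rcosets\<^bsub>H\<^esub> Z (j - 1)) * card (Cz j)"
  proof (rule card_le_fibers[where f = f])
    show "finite (carrier G)" by (rule fin)
    show "finite (rcosets\<^bsub>H\<^esub> Z (j - 1))" unfolding RCOSETS_def H_def using fin_subgroup[OF ucs_subgroup] by simp
    show "f ` carrier G \<subseteq> rcosets\<^bsub>H\<^esub> Z (j - 1)"
      unfolding RCOSETS_def H_def f_def using ucs_comm[OF a(1)] by auto
    fix y
    show "card {g \<in> carrier G. f g = y} \<le> card (Cz j)"
    proof (cases "{g \<in> carrier G. f g = y} = {}")
      case True
      show ?thesis unfolding True by simp
    next
      case False
      then obtain h where h: "h \<in> carrier G" "f h = y" by blast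
      show ?thesis
      proof (rule card_inj_on_le[of "\<lambda>g. g \<otimes> inv h"])
        show "inj_on (\<lambda>g. g \<otimes> inv h) {g \<in> carrier G. f g = y}" using h by (auto simp: inj_on_def)
        show "finite (Cz j)" using fin_subgroup[OF sC] .
        have "g \<otimes> inv h \<in> Cz j" if g: "g \<in> carrier G" "f g = y" for g
        proof -
          let ?k = "comm_elt G a (g \<otimes> inv h)" and ?c = "comm_elt G a h"
          have "comm_elt G a g \<in> Z (j - 1) #> ?c"
            using rcos_self[OF _ ucs_subgroup[of "j - 1"], of "comm_elt G a g"] g h aC unfolding f_def by simp
          then have "comm_elt G a g \<otimes> inv ?c \<in> Z (j - 1)"
            using subgroup.rcos_module_imp[OF ucs_subgroup[of "j - 1"] is_group, of ?c] aC h by simp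
          moreover have "comm_elt G a g = ?c \<otimes> (inv h \<otimes> ?k \<otimes> h)"
            using comm_elt_mult_right[of a "g \<otimes> inv h" h] aC g h by (simp add: m_assoc)
          ultimately have "?c \<otimes> (inv h \<otimes> ?k \<otimes> h) \<otimes> inv ?c \<in> Z (j - 1)" by simp
          then have "inv ?c \<otimes> (?c \<otimes> (inv h \<otimes> ?k \<otimes> h) \<otimes> inv ?c) \<otimes> ?c \<in> Z (j - 1)"
            using normal_conj(1)[OF ucs_normal] aC h by simp
          then have "inv h \<otimes> ?k \<otimes> h \<in> Z (j - 1)" using aC g h by (simp add: m_assoc)
          then have "?k \<in> Z (j - 1)" using normal_conj_iff[OF ucs_normal] aC g h by simp
          then show ?thesis using Cz_iff[OF j(2) a] g h by simp
        qed
        then show "(\<lambda>g. g \<otimes> inv h) ` {g \<in> carrier G. f g = y} \<subseteq> Cz j" by auto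
      qed
    qed
  qed
  moreover have "card (rcosets\<^bsub>H\<^esub> Z (j - 1)) = p"
  proof -
    have "subgroup (Z (j - 1)) H" unfolding H_def using subgroup_incl[OF ucs_subgroup ucs_subgroup Zsub] .
    then have "card (rcosets\<^bsub>H\<^esub> Z (j - 1)) * card (Z (j - 1)) = order H" using group.lagrange[OF gH] by blast
    also have "order H = p ^ j" unfolding H_def order_def using card_Z j by simp
    also have "card (Z (j - 1)) = p ^ (j - 1)" using card_Z j by simp
    also have "p ^ j = p * p ^ (j - 1)" using j by (simp flip: power_Suc)
    finally show ?thesis using p_gt_1 by simp
  qed
  ultimately have "card (Cz j) * p = p ^ n" using le ord unfolding order_def by (simp add: mult.commute)
  also have "p ^ n = p ^ (n - 1) * p" using n6 by (simp flip: power_Suc2)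
  finally show ?thesis using p_gt_1 by simp
qed

lemma Cz_eq: "\<lbrakk>1 \<le> i; i \<le> n - 3; D \<subseteq> Cz i\<rbrakk> \<Longrightarrow> Cz i = D"
  using eq_if_card_le[OF Cz_subgroup, of D i] card_Cz[of i] card_Cz[of "n - 3"] n6 by simp

lemma Z_comm_2:
  assumes "a \<in> Z k" "w \<in> Z (n - 2)" shows "comm_elt G a w \<in> Z (k - 2)" "comm_elt G w a \<in> Z (k - 2)"
  using Z_comm_Z[OF assms(1), of w 1] assms(2) n6 by (simp_all add: numeral_2_eq_2)

lemma Z_comm_4:
  assumes "a \<in> Z k" "w \<in> Z (n - 4)" shows "comm_elt G a w \<in> Z (k - 4)" "comm_elt G w a \<in> Z (k - 4)"
  using Z_comm_Z[OF assms(1), of w 3] assms(2) n6 by (simp_all add: eval_nat_numeral)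

lemma comm_in_Z: "g \<in> carrier G \<Longrightarrow> h \<in> carrier G \<Longrightarrow> comm_elt G g h \<in> Z (n - 2)"
  using ucs_comm[of g "n - 1" h] Z_top by (simp add: numeral_2_eq_2)

lemma D_comm:
  assumes "u \<in> Z (n - 2)" "d \<in> D" shows "comm_elt G u d \<in> Z (n - 4)"
proof -
  have "Suc (n - 3) = n - 2" "n - 3 - 1 = n - 4" using n6 by auto
  then show ?thesis using assms unfolding Cz_def by auto
qed

lemma comm_flip: "comm_elt G a b \<in> Z i \<Longrightarrow> a \<in> carrier G \<Longrightarrow> b \<in> carrier G \<Longrightarrow> comm_elt G b a \<in> Z i"
  using normal_comm_elt_subst(3)[OF ucs_normal] by blast

text \<open>By the three subgroups lemma \<open>D\<close> centralizes \<open>[Z\<^sub>i\<^sub>+\<^sub>1, Z\<^sub>n\<^sub>-\<^sub>2]\<close> modulo \<open>Z\<^sub>i\<^sub>-\<^sub>3\<close>; if this commutator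
  subgroup is too small for that to be useful, then \<open>D\<close> centralizes \<open>[Z\<^sub>i\<^sub>+\<^sub>1, G] = Z\<^sub>i\<close> modulo \<open>Z\<^sub>i\<^sub>-\<^sub>2\<close>.\<close>

lemma D_spread:
  assumes i: "3 \<le> i" "i \<le> n - 3" and D: "D \<subseteq> Cz i"
  shows "D \<subseteq> Cz (i - 1) \<or> D \<subseteq> Cz (i - 2)"
proof -
  have DC: "\<And>d. d \<in> D \<Longrightarrow> d \<in> carrier G" using subgroup.mem_carrier[OF Cz_subgroup] .
  have DZ: "comm_elt G d a \<in> Z (i - 1)" if "a \<in> Z (Suc i)" "d \<in> D" for a d
    using that D DC ucs_carrier comm_flip unfolding Cz_def[of i] by blast
  show ?thesis
  proof (cases "\<exists>a\<in>Z (Suc i). \<exists>u\<in>Z (n - 2). comm_elt G a u \<notin> Z (i - 2)")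
    case True
    then obtain a u where au: "a \<in> Z (Suc i)" "u \<in> Z (n - 2)" "comm_elt G a u \<notin> Z (i - 2)" by blast
    let ?k = "comm_elt G a u"
    have e: "Suc (i - 2) = i - 1" "i - 2 - 1 = i - 3" "Suc i - 4 = i - 3" "i - 1 - 2 = i - 3" "Suc i - 2 = i - 1" using i by auto
    have k: "?k \<in> Z (Suc (i - 2))" using Z_comm_2(1)[OF au(1,2)] unfolding e .
    have kd: "comm_elt G ?k d \<in> Z (i - 3)" if d: "d \<in> D" for d
    proof (rule three_subgroups[OF ucs_normal ucs_subgroup[of "n - 2"] Cz_subgroup[of "n - 3"] ucs_subgroup[of "Suc i"] _ _ au(2) d au(1)])
      fix u' d' a' assume m: "u' \<in> Z (n - 2)" "d' \<in> D" "a' \<in> Z (Suc i)"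
      show "comm_elt G (comm_elt G u' d') a' \<in> Z (i - 3)"
        using Z_comm_4(2)[OF m(3) D_comm[OF m(1,2)]] unfolding e .
      show "comm_elt G (comm_elt G d' a') u' \<in> Z (i - 3)"
        using Z_comm_2(1)[OF DZ[OF m(3,2)] m(1)] unfolding e .
    qed
    have "D \<subseteq> Cz (i - 2)"
    proof
      fix d assume d: "d \<in> D"
      show "d \<in> Cz (i - 2)" using Cz_iff[OF _ k au(3) DC[OF d]] kd[OF d] i unfolding e by simp
    qed
    then show ?thesis by blast
  next
    case False
    obtain a where a: "a \<in> Z (Suc i)" "a \<notin> Z i" by (rule Z_gap[of i]) (use i n6 in linarith)
    have aC: "a \<in> carrier G" using a ucs_carrier by blast
    have "\<not> (\<forall>g\<in>carrier G. comm_elt G a g \<in> Z (i - 1))"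
    proof
      assume "\<forall>g\<in>carrier G. comm_elt G a g \<in> Z (i - 1)"
      then have "a \<in> Z (Suc (i - 1))" using aC by (simp add: ucs.simps)
      then show False using a i by simp
    qed
    then obtain g where g: "g \<in> carrier G" "comm_elt G a g \<notin> Z (i - 1)" by blast
    let ?k = "comm_elt G a g"
    have e: "Suc (i - 1) = i" "i - 1 - 1 = i - 2" using i by auto
    have k: "?k \<in> Z (Suc (i - 1))" using ucs_comm[OF a(1) g(1)] unfolding e by simp
    have kd: "comm_elt G ?k d \<in> Z (i - 2)" if d: "d \<in> D" for d
    proof (rule three_subgroups[OF ucs_normal subgroup_self Cz_subgroup[of "n - 3"] ucs_subgroup[of "Suc i"] _ _ g(1) d a(1)])
      fix g' d' a' assume m: "g' \<in> carrier G" "d' \<in> D" "a' \<in> Z (Suc i)"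
      have c: "comm_elt G g' d' \<in> Z (n - 2)" using comm_in_Z m DC by blast
      then show "comm_elt G (comm_elt G g' d') a' \<in> Z (i - 2)"
        using False m comm_flip ucs_carrier by blast
      show "comm_elt G (comm_elt G d' a') g' \<in> Z (i - 2)"
        using ucs_comm[OF DZ[OF m(3,2)] m(1)] unfolding e .
    qed
    have "D \<subseteq> Cz (i - 1)"
    proof
      fix d assume d: "d \<in> D"
      show "d \<in> Cz (i - 1)" using Cz_iff[OF _ k g(2) DC[OF d]] kd[OF d] i unfolding e by simp
    qed
    then show ?thesis by blast
  qed
qed

text \<open>If only the middle one of three consecutive sections were centralized by \<open>d \<in> D\<close>, then comparing
  the actions of \<open>d\<close> and \<open>d\<^sup>g\<close>, which commute on \<open>Z\<^sub>4\<close>, would give \<open>2 \<zeta> = 0\<close> for some \<open>0 \<noteq> \<zeta> \<in> Z\<^sub>1\<close>.\<close>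

lemma D_neighbour:
  assumes ab: "\<And>a b. a \<in> Z 4 \<Longrightarrow> b \<in> Z 4 \<Longrightarrow> a \<otimes> b = b \<otimes> a" and D: "D \<subseteq> Cz 2"
  shows "D \<subseteq> Cz 1 \<or> D \<subseteq> Cz 3"
proof (rule ccontr)
  assume neg: "\<not> ?thesis"
  have DC: "\<And>d. d \<in> D \<Longrightarrow> d \<in> carrier G" using subgroup.mem_carrier[OF Cz_subgroup] .
  have sC: "subgroup (Cz i) G" for i by (rule Cz_subgroup)
  \<comment> \<open>A group is not the union of two proper subgroups, so a single d in
    \<open>D\<close> avoids \<open>Cz 1\<close> and \<open>Cz 3\<close>.\<close>
  obtain d where d: "d \<in> D" "d \<notin> Cz 1" "d \<notin> Cz 3"
  proof -
    obtain x y where xy: "x \<in> D" "x \<notin> Cz 1" "y \<in> D" "y \<notin> Cz 3" using neg by blast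
    have C: "x \<in> carrier G" "y \<in> carrier G" using xy DC by auto
    show thesis
    proof (cases "x \<in> Cz 3 \<and> y \<in> Cz 1")
      case True
      have "x \<otimes> y \<notin> Cz 1"
      proof
        assume "x \<otimes> y \<in> Cz 1"
        then have "x \<otimes> y \<otimes> inv y \<in> Cz 1" using True subgroup.m_closed[OF sC] subgroup.m_inv_closed[OF sC] by blast
        then show False using xy C by (simp add: m_assoc)
      qed
      moreover have "x \<otimes> y \<notin> Cz 3"
      proof
        assume "x \<otimes> y \<in> Cz 3"
        then have "inv x \<otimes> (x \<otimes> y) \<in> Cz 3" using True subgroup.m_closed[OF sC] subgroup.m_inv_closed[OF sC] by blast
        then show False using xy C by simp
      qed
      moreover have "x \<otimes> y \<in> D" using xy subgroup.m_closed[OF sC] by blast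
      ultimately show ?thesis using that by blast
    qed (use that xy in blast)
  qed
  have dC: "d \<in> carrier G" using d DC by blast
  have "Cz 2 = D" using Cz_eq D n6 by simp
  moreover have "D \<noteq> carrier G"
  proof
    assume "D = carrier G"
    moreover have "1 \<le> n - 3" using n6 by linarith
    ultimately have "p ^ n = p ^ (n - 1)" using card_Cz[of "n - 3"] ord unfolding order_def by simp
    then show False using n6 p_gt_1 by simp
  qed
  ultimately obtain g where g: "g \<in> carrier G" "g \<notin> Cz 2" using subgroup.subset[OF sC] by blast
  define ac where "ac = (\<lambda>x a. inv x \<otimes> a \<otimes> x)"
  define e where "e = inv g \<otimes> d \<otimes> g"
  have eC: "e \<in> carrier G" unfolding e_def using g dC by simp
  have ZC: "a \<in> carrier G" if "a \<in> Z i" for a i using that ucs_carrier by blast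
  have ac4: "ac x a \<in> Z 4" if "x \<in> carrier G" "a \<in> Z 4" for x a
    unfolding ac_def using normal_conj(1)[OF ucs_normal that(2,1)] .
  have ac_mult: "ac x (a \<otimes> b) = ac x a \<otimes> ac x b" if "x \<in> carrier G" "a \<in> Z 4" "b \<in> Z 4" for x a b
    unfolding ac_def using conj_action_mult that ZC by blast
  have ac_inv: "ac x (inv a) = inv (ac x a)" if "x \<in> carrier G" "a \<in> Z 4" for x a
    unfolding ac_def using that ZC by (simp add: inv_mult_group m_assoc)
  have ac_comm: "ac x a = a \<otimes> comm_elt G a x" if "x \<in> carrier G" "a \<in> Z i" for x a i
    unfolding ac_def using conj_eq_comm_elt that ZC by blast
  have sub4: "Z i \<subseteq> Z 4" if "i \<le> 4" for i using ucs_mono that by blast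
  have ac1: "ac x a = a" if "x \<in> carrier G" "a \<in> Z 1" for x a
    using ac_comm[OF that] ucs_comm[OF that(2,1)] ZC[OF that(2)] by simp
  \<comment> \<open>[[g, d], d] lies in Z_(n-4) and so centralizes Z_4. As [g, d] is the product of
    the inverse of e with d, this says that e and d commute on Z_4.\<close>
  have commute: "ac e (ac d a) = ac d (ac e a)" if a: "a \<in> Z 4" for a
  proof -
    let ?c = "comm_elt G g d"
    let ?w = "comm_elt G ?c d"
    have w: "?w \<in> Z (n - 4)" using D_comm[OF comm_in_Z[OF g(1) dC] d(1)] .
    have wC: "?w \<in> carrier G" using g dC by simp
    have fixw: "ac ?w b = b" if b: "b \<in> Z 4" for b
      using ac_comm[OF wC b] Z_comm_4(1)[OF b w] ZC[OF b] by simp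
    have c: "?c = inv e \<otimes> d" unfolding e_def using g dC by (simp add: word_simps)
    have "?c \<otimes> d = d \<otimes> ?c \<otimes> ?w" using g dC by (simp add: word_simps)
    then have "(inv e \<otimes> d) \<otimes> d = d \<otimes> (inv e \<otimes> d) \<otimes> ?w" unfolding c .
    define b where "b = ac e a"
    have b4: "b \<in> Z 4" unfolding b_def using ac4 eC a by blast
    have l: "ac ((inv e \<otimes> d) \<otimes> d) b = ac d (ac d a)"
      unfolding b_def ac_def using ZC[OF a] eC dC by (simp add: inv_mult_group m_assoc)
    have "ac (d \<otimes> (inv e \<otimes> d) \<otimes> ?w) b = ac ?w (ac d (ac (inv e) (ac d b)))"
      unfolding ac_def using ZC[OF b4] eC dC wC by (simp add: inv_mult_group m_assoc)
    also have "\<dots> = ac d (ac (inv e) (ac d b))" by (rule fixw) (use ac4 b4 dC eC in auto)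
    finally have "ac d (ac d a) = ac d (ac (inv e) (ac d b))"
      using l \<open>(inv e \<otimes> d) \<otimes> d = d \<otimes> (inv e \<otimes> d) \<otimes> ?w\<close> by simp
    then have "ac e (ac (inv d) (ac d (ac d a))) = ac e (ac (inv d) (ac d (ac (inv e) (ac d b))))" by simp
    then show ?thesis unfolding b_def
      unfolding ac_def using ZC[OF a] eC dC by (simp add: inv_mult_group m_assoc)
  qed
  have eg: "ac e (ac g a) = ac g (ac d a)" if "a \<in> Z 4" for a
    unfolding ac_def e_def using ZC[OF that] g dC by (simp add: inv_mult_group m_assoc)
  obtain a where "a \<in> Z (Suc 3)" "a \<notin> Z 3" by (rule Z_gap[of 3]) (use n6 in linarith)
  then have a: "a \<in> Z 4" "a \<notin> Z 3" by (simp_all add: eval_nat_numeral)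
  \<comment> \<open>The values of d - 1 and g - 1 along a. Each step a, b, q, \<open>\<zeta>\<close>
    drops exactly one level, as d, g, d lie outside \<open>Cz 3\<close>, \<open>Cz 2\<close>,
    \<open>Cz 1\<close> respectively; \<open>\<beta>\<close> and \<open>\<rho>\<close> drop two
    levels because d is in \<open>Cz 2\<close>.\<close>
  define b r where "b = comm_elt G a d" and "r = comm_elt G a g"
  define q \<beta> \<rho> where "q = comm_elt G b g" and "\<beta> = comm_elt G b d" and "\<rho> = comm_elt G r d"
  define \<zeta> \<kappa> where "\<zeta> = comm_elt G q d" and "\<kappa> = comm_elt G q g"
  have n3: "(3::nat) \<le> n - 3" "(2::nat) \<le> n - 3" "(1::nat) \<le> n - 3" using n6 by auto
  have s4: "Suc 3 = (4::nat)" "Suc 2 = (3::nat)" "Suc 1 = (2::nat)" by auto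
  have b3: "b \<in> Z 3" "b \<notin> Z 2"
    using ucs_comm[OF a(1) dC] Cz_iff[OF n3(1) _ a(2) dC] a(1) d(3) unfolding b_def s4 by auto
  have r3: "r \<in> Z 3" using ucs_comm[OF a(1) g(1)] unfolding r_def by simp
  have q2: "q \<in> Z 2" "q \<notin> Z 1"
    using ucs_comm[OF b3(1) g(1)] Cz_iff[OF n3(2) _ b3(2) g(1)] b3(1) g(2) unfolding q_def s4 by auto
  have z1: "\<zeta> \<in> Z 1" "\<zeta> \<notin> Z 0"
    using ucs_comm[OF q2(1) dC] Cz_iff[OF n3(3) _ q2(2) dC] q2(1) d(2) unfolding \<zeta>_def s4 by auto
  have k1: "\<kappa> \<in> Z 1" using ucs_comm[OF q2(1) g(1)] unfolding \<kappa>_def by simp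
  have dd: "comm_elt G x d \<in> Z 1" if "x \<in> Z 3" for x
    using d(1) D that unfolding Cz_def[of 2] s4 by auto
  have br1: "\<beta> \<in> Z 1" "\<rho> \<in> Z 1" unfolding \<beta>_def \<rho>_def using dd b3 r3 by auto
  have m4: "a \<in> Z 4" "b \<in> Z 4" "r \<in> Z 4" "q \<in> Z 4" "\<beta> \<in> Z 4" "\<rho> \<in> Z 4" "\<zeta> \<in> Z 4" "\<kappa> \<in> Z 4"
    using a b3 r3 q2 z1 k1 br1 sub4[of 3] sub4[of 2] sub4[of 1] by auto
  interpret A: comm_group "G\<lparr>carrier := Z 4\<rparr>"
    by (rule group.group_comm_groupI[OF subgroup_imp_group[OF ucs_subgroup]]) (use ab in simp)
  note Am = A.m_ac[simplified]
  have A_closed: "x \<otimes> y \<in> Z 4" "inv x \<in> Z 4" if "x \<in> Z 4" "y \<in> Z 4" for x y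
    using that subgroup.m_closed[OF ucs_subgroup] subgroup.m_inv_closed[OF ucs_subgroup] by auto
  have acs: "ac d a = a \<otimes> b" "ac g a = a \<otimes> r" "ac g b = b \<otimes> q" "ac d b = b \<otimes> \<beta>" "ac d r = r \<otimes> \<rho>"
      "ac d q = q \<otimes> \<zeta>" "ac g q = q \<otimes> \<kappa>"
    unfolding b_def r_def q_def \<beta>_def \<rho>_def \<zeta>_def \<kappa>_def
    using ac_comm[OF dC] ac_comm[OF g(1)] m4 unfolding b_def r_def q_def by blast+
  have ac1s: "ac d x = x" "ac g x = x" if "x \<in> {\<beta>, \<rho>, \<zeta>, \<kappa>}" for x
    using that ac1 dC g br1 z1 k1 by auto
  \<comment> \<open>Chosen such that g sends t to the image of a under first g, then d. As e is the
    conjugate of d by g, e after g equals g after d, so both sides of \<open>commute\<close> become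
    words in the known actions of d and g.\<close>
  define t where "t = a \<otimes> b \<otimes> inv q \<otimes> \<kappa> \<otimes> \<rho>"
  have t4: "t \<in> Z 4" unfolding t_def using m4 A_closed by auto
  have G4: "a \<in> carrier G" "b \<in> carrier G" "r \<in> carrier G" "q \<in> carrier G" "\<beta> \<in> carrier G" "\<rho> \<in> carrier G" "\<zeta> \<in> carrier G" "\<kappa> \<in> carrier G"
    using m4 ZC by auto
  have ii: "inv (x \<otimes> y) = inv x \<otimes> inv y" if "x \<in> Z 4" "y \<in> Z 4" for x y
    using that ZC ab[OF A_closed(2)[OF that(1,1)] A_closed(2)[OF that(2,2)]] by (simp add: inv_mult_group)
  have sort1: "(a \<otimes> r) \<otimes> (b \<otimes> q) \<otimes> w \<otimes> \<kappa> \<otimes> \<rho> = (a \<otimes> b) \<otimes> (r \<otimes> \<rho>) \<otimes> ((q \<otimes> \<kappa>) \<otimes> w)" if "w \<in> Z 4" for w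
    using that m4 A_closed by (simp add: Am)
  have sort2: "(a \<otimes> r) \<otimes> (b \<otimes> q) \<otimes> ((b \<otimes> q) \<otimes> \<beta>) \<otimes> w \<otimes> \<kappa> \<otimes> \<rho>
      = (a \<otimes> b \<otimes> r \<otimes> \<rho> \<otimes> b \<otimes> \<beta> \<otimes> q) \<otimes> ((q \<otimes> \<kappa>) \<otimes> w)" if "w \<in> Z 4" for w
    using that m4 A_closed by (simp add: Am)
  have gt: "ac g t = ac d (ac g a)"
  proof -
    have "ac g t = (a \<otimes> r) \<otimes> (b \<otimes> q) \<otimes> inv (q \<otimes> \<kappa>) \<otimes> \<kappa> \<otimes> \<rho>"
      unfolding t_def using m4 A_closed g(1) by (simp add: ac_mult ac_inv acs ac1s)
    also have "\<dots> = (a \<otimes> b) \<otimes> (r \<otimes> \<rho>) \<otimes> ((q \<otimes> \<kappa>) \<otimes> inv (q \<otimes> \<kappa>))"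
      using sort1[OF A_closed(2)[of "q \<otimes> \<kappa>"]] m4 A_closed by simp
    also have "\<dots> = (a \<otimes> b) \<otimes> (r \<otimes> \<rho>)" using G4 by simp
    also have "\<dots> = ac d (ac g a)" using m4 A_closed dC by (simp add: ac_mult acs)
    finally show ?thesis .
  qed
  have dt: "ac d t = (a \<otimes> b) \<otimes> (b \<otimes> \<beta>) \<otimes> inv (q \<otimes> \<zeta>) \<otimes> \<kappa> \<otimes> \<rho>"
    unfolding t_def using m4 A_closed dC by (simp add: ac_mult ac_inv acs ac1s)
  have L: "ac e (ac d (ac g a)) = (a \<otimes> r) \<otimes> (b \<otimes> q) \<otimes> ((b \<otimes> q) \<otimes> \<beta>) \<otimes> inv ((q \<otimes> \<kappa>) \<otimes> \<zeta>) \<otimes> \<kappa> \<otimes> \<rho>"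
    unfolding gt[symmetric] eg[OF t4] dt using m4 A_closed g(1) by (simp add: ac_mult ac_inv acs ac1s)
  have "ac d (ac e (ac g a)) = ac d (ac g (a \<otimes> b))" by (simp only: eg[OF a(1)] acs(1))
  also have "\<dots> = ((a \<otimes> b) \<otimes> (r \<otimes> \<rho>)) \<otimes> ((b \<otimes> \<beta>) \<otimes> (q \<otimes> \<zeta>))"
    using m4 A_closed g(1) dC by (simp add: ac_mult acs)
  finally have "(a \<otimes> r) \<otimes> (b \<otimes> q) \<otimes> ((b \<otimes> q) \<otimes> \<beta>) \<otimes> inv ((q \<otimes> \<kappa>) \<otimes> \<zeta>) \<otimes> \<kappa> \<otimes> \<rho>
      = ((a \<otimes> b) \<otimes> (r \<otimes> \<rho>)) \<otimes> ((b \<otimes> \<beta>) \<otimes> (q \<otimes> \<zeta>))"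
    using commute[OF ac4[OF g(1) a(1)]] L by simp
  moreover have "(a \<otimes> r) \<otimes> (b \<otimes> q) \<otimes> ((b \<otimes> q) \<otimes> \<beta>) \<otimes> inv ((q \<otimes> \<kappa>) \<otimes> \<zeta>) \<otimes> \<kappa> \<otimes> \<rho>
      = (a \<otimes> b \<otimes> r \<otimes> \<rho> \<otimes> b \<otimes> \<beta> \<otimes> q) \<otimes> inv \<zeta>"
  proof -
    have w: "inv ((q \<otimes> \<kappa>) \<otimes> \<zeta>) \<in> Z 4"
      by (rule A_closed(2)[of _ a]) (use m4 A_closed(1) in simp_all)
    have "(q \<otimes> \<kappa>) \<otimes> inv ((q \<otimes> \<kappa>) \<otimes> \<zeta>) = inv \<zeta>"
      using G4 ii[of "q \<otimes> \<kappa>" \<zeta>] m4 A_closed by simp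
    then show ?thesis using sort2[OF w] by simp
  qed
  moreover have "((a \<otimes> b) \<otimes> (r \<otimes> \<rho>)) \<otimes> ((b \<otimes> \<beta>) \<otimes> (q \<otimes> \<zeta>)) = (a \<otimes> b \<otimes> r \<otimes> \<rho> \<otimes> b \<otimes> \<beta> \<otimes> q) \<otimes> \<zeta>"
    using G4 by (simp add: m_assoc)
  ultimately have "inv \<zeta> = \<zeta>" using G4 by simp
  then have "\<zeta> \<otimes> \<zeta> = \<one>" using G4 r_inv[of \<zeta>] by simp
  then have "\<zeta> = \<one>" using sq_one_odd[OF p_odd] G4 by blast
  then show False using z1 by simp
qed

end

section \<open>Powers of 1 + phi and the bound for elementary abelian central terms\<close>

context comm_group
begin

text \<open>The binomial theorem for (1 + phi)^m in the endomorphism ring of an abelian group, in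
  multiplicative notation; the induction step is Pascal's rule.\<close>

lemma hom_plus_one_funpow:
  assumes \<phi>: "\<phi> \<in> hom G G" and x: "x \<in> carrier G"
  shows "((\<lambda>x. x \<otimes> \<phi> x) ^^ m) x = (\<Otimes>i\<in>{..m}. (\<phi> ^^ i) x [^] (m choose i))"
  using x
proof (induction m arbitrary: x)
  case 0
  then show ?case by simp
next
  case (Suc m)
  define \<sigma> where "\<sigma> = (\<lambda>x. x \<otimes> \<phi> x)"
  have \<phi>c: "\<phi> y \<in> carrier G" if "y \<in> carrier G" for y using \<phi> that by (auto simp: hom_def)
  have \<phi>ic: "(\<phi> ^^ i) y \<in> carrier G" if "y \<in> carrier G" for i y using that \<phi>c by (induction i) auto
  have \<sigma>m: "\<sigma> (y \<otimes> z) = \<sigma> y \<otimes> \<sigma> z" "\<sigma> y \<in> carrier G" if "y \<in> carrier G" "z \<in> carrier G" for y z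
    unfolding \<sigma>_def using that \<phi>c \<phi> by (auto simp: hom_def m_ac)
  have \<sigma>k: "(\<sigma> ^^ k) (y \<otimes> z) = (\<sigma> ^^ k) y \<otimes> (\<sigma> ^^ k) z \<and> (\<sigma> ^^ k) y \<in> carrier G \<and> (\<sigma> ^^ k) z \<in> carrier G"
    if "y \<in> carrier G" "z \<in> carrier G" for y z k
    using that by (induction k) (use \<sigma>m in auto)
  define f where "f = (\<lambda>i. (\<phi> ^^ i) x)"
  have fc: "f i \<in> carrier G" for i unfolding f_def using \<phi>ic Suc by blast
  have f0: "f 0 = x" unfolding f_def by simp
  define Y where "Y = (\<Otimes>i\<in>{..m}. f (Suc i) [^] (m choose i))"
  define W where "W = (\<Otimes>i\<in>{..m}. f (Suc i) [^] (m choose Suc i))"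
  have C: "Y \<in> carrier G" "W \<in> carrier G" unfolding Y_def W_def using fc by (auto intro!: finprod_closed)
  have "(\<sigma> ^^ Suc m) x = (\<sigma> ^^ m) (x \<otimes> \<phi> x)" unfolding funpow_Suc_right comp_apply \<sigma>_def ..
  also have "\<dots> = (\<sigma> ^^ m) x \<otimes> (\<sigma> ^^ m) (\<phi> x)" using \<sigma>k[OF Suc(2) \<phi>c[OF Suc(2)]] by blast
  also have "(\<sigma> ^^ m) x = (\<Otimes>i\<in>{..m}. f i [^] (m choose i))" unfolding \<sigma>_def f_def by (rule Suc.IH[OF Suc(2)])
  also have "\<dots> = (\<Otimes>i\<in>{..Suc m}. f i [^] (m choose i))"
  proof -
    have "(\<Otimes>i\<in>{..m}. f i [^] (m choose i)) \<in> carrier G" by (rule finprod_closed) (use fc in auto)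
    then show ?thesis by (subst finprod_Suc) (use fc in \<open>auto simp: binomial_eq_0\<close>)
  qed
  also have "\<dots> = W \<otimes> x" unfolding W_def by (subst finprod_Suc2) (use fc f0 in auto)
  also have "(\<sigma> ^^ m) (\<phi> x) = Y"
    unfolding \<sigma>_def Suc.IH[OF \<phi>c[OF Suc(2)]] Y_def f_def by (simp add: funpow_swap1)
  finally have "(\<sigma> ^^ Suc m) x = (W \<otimes> x) \<otimes> Y" .
  moreover have "(\<Otimes>i\<in>{..Suc m}. f i [^] (Suc m choose i)) = (\<Otimes>i\<in>{..m}. f (Suc i) [^] (Suc m choose Suc i)) \<otimes> x"
    by (subst finprod_Suc2) (use fc f0 in auto)
  moreover have "(\<Otimes>i\<in>{..m}. f (Suc i) [^] (Suc m choose Suc i)) = (\<Otimes>i\<in>{..m}. f (Suc i) [^] (m choose i) \<otimes> f (Suc i) [^] (m choose Suc i))"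
    by (rule finprod_cong') (use fc in \<open>auto simp: nat_pow_mult\<close>)
  moreover have "\<dots> = Y \<otimes> W" unfolding Y_def W_def by (rule finprod_multf) (use fc in auto)
  ultimately have "(\<sigma> ^^ Suc m) x = (\<Otimes>i\<in>{..Suc m}. f i [^] (Suc m choose i))"
    using C Suc(2) by (simp add: m_ac)
  then show ?case unfolding \<sigma>_def f_def .
qed

text \<open>The inner binomial coefficients are divisible by q and vanish in exponent q, leaving (1
  + phi)^q = 1 + phi^q.\<close>

lemma hom_plus_one_funpow_prime:
  assumes \<phi>: "\<phi> \<in> hom G G" and x: "x \<in> carrier G" and q: "Factorial_Ring.prime (q::nat)"
    and e: "\<And>y. y \<in> carrier G \<Longrightarrow> y [^] q = \<one>"
  shows "((\<lambda>x. x \<otimes> \<phi> x) ^^ q) x = x \<otimes> (\<phi> ^^ q) x"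
proof -
  have \<phi>c: "\<phi> y \<in> carrier G" if "y \<in> carrier G" for y using \<phi> that by (auto simp: hom_def)
  have fc: "(\<phi> ^^ i) x \<in> carrier G" for i using x \<phi>c by (induction i) auto
  obtain m where m: "q = Suc (Suc m)" using prime_ge_2_nat[OF q] by (metis Suc_1 Suc_le_D add_2_eq_Suc le_Suc_ex)
  have "(\<Otimes>i\<in>{..q}. (\<phi> ^^ i) x [^] (q choose i))
      = (\<phi> ^^ q) x \<otimes> (\<Otimes>i\<in>{..Suc m}. (\<phi> ^^ i) x [^] (q choose i))"
    unfolding m by (subst finprod_Suc) (use fc in \<open>auto simp del: funpow.simps\<close>)
  also have "(\<Otimes>i\<in>{..Suc m}. (\<phi> ^^ i) x [^] (q choose i))
      = (\<Otimes>i\<in>{..m}. (\<phi> ^^ Suc i) x [^] (q choose Suc i)) \<otimes> x"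
    by (subst finprod_Suc2) (use fc x in auto)
  also have "(\<Otimes>i\<in>{..m}. (\<phi> ^^ Suc i) x [^] (q choose Suc i)) = \<one>"
  proof (rule finprod_one_eqI)
    fix i assume "i \<in> {..m}"
    then have "q dvd (q choose Suc i)" using q m by (intro dvd_choose_prime) auto
    then obtain k where k: "q choose Suc i = q * k" by (elim dvdE)
    show "(\<phi> ^^ Suc i) x [^] (q choose Suc i) = \<one>"
      unfolding k using e[OF fc[of "Suc i"]] fc[of "Suc i"] by (simp del: funpow.simps flip: nat_pow_pow)
  qed
  finally show ?thesis using hom_plus_one_funpow[OF \<phi> x, of q] fc[of q] x by (simp add: m_comm)
qed

end

context max_class_group
begin

text \<open>Modulo \<open>Z (n - 2)\<close> the group has order p^2 and each \<open>Cz i\<close> has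
  order p. Such subgroups cover the quotient only if there are p + 1 of them.\<close>

lemma Z_union_bound:
  assumes I: "I \<subseteq> {1..n - 3}" and c: "card (Cz ` I) \<le> p"
  obtains s where "s \<in> carrier G" "\<And>i. i \<in> I \<Longrightarrow> s \<notin> Cz i"
proof -
  let ?Z = "Z (n - 2)"
  have finI: "finite I" using I finite_subset by blast
  have cZ: "card ?Z = p ^ (n - 2)" using card_Z by simp
  have finZ: "finite ?Z" using fin_subgroup[OF ucs_subgroup] .
  define U where "U = (\<Union>T\<in>Cz ` I. T - ?Z)"
  have "card U \<le> (\<Sum>T\<in>Cz ` I. card (T - ?Z))" unfolding U_def by (rule card_UN_le) (use finI in simp)
  also have "\<dots> = (\<Sum>T\<in>Cz ` I. p ^ (n - 1) - p ^ (n - 2))"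
  proof (rule sum.cong)
    fix T assume "T \<in> Cz ` I"
    then obtain i where i: "i \<in> I" "T = Cz i" by blast
    then have "card T = p ^ (n - 1)" using card_Cz[of i] I by auto
    then show "card (T - ?Z) = p ^ (n - 1) - p ^ (n - 2)" using card_Diff_subset[OF finZ, of T] Z_sub_Cz i cZ by simp
  qed simp
  also have "\<dots> = card (Cz ` I) * (p ^ (n - 1) - p ^ (n - 2))" by simp
  also have "\<dots> \<le> p * (p ^ (n - 1) - p ^ (n - 2))" using c by simp
  finally have U: "card U \<le> p * (p ^ (n - 1) - p ^ (n - 2))" .
  have e: "p ^ n = p * p * p ^ (n - 2)" "p ^ (n - 1) = p * p ^ (n - 2)"
  proof -
    have "Suc (Suc (n - 2)) = n" "Suc (n - 2) = n - 1" using n6 by auto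
    then show "p ^ n = p * p * p ^ (n - 2)" "p ^ (n - 1) = p * p ^ (n - 2)"
      by (metis power_Suc mult.assoc, metis power_Suc)
  qed
  have "card (U \<union> ?Z) \<le> card U + card ?Z" by (rule card_Un_le)
  also have "\<dots> \<le> p * (p * p ^ (n - 2) - p ^ (n - 2)) + p ^ (n - 2)" using U cZ e by simp
  also have "\<dots> = (p * p - p + 1) * p ^ (n - 2)"
    using p_gt_1 by (simp add: algebra_simps diff_mult_distrib2)
  also have "\<dots> < p * p * p ^ (n - 2)"
  proof -
    have "p * 1 \<le> p * p" using p_gt_1 by (intro mult_le_mono) auto
    then have "p * p - p + 1 < p * p" using p_gt_1 by linarith
    then show ?thesis using p_gt_1 by (intro mult_less_mono1) auto
  qed
  finally have "card (U \<union> ?Z) < card (carrier G)" using ord e unfolding order_def by simp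
  then have "\<not> carrier G \<subseteq> U \<union> ?Z"
    using card_mono[of "U \<union> ?Z" "carrier G"] finI finZ fin_subgroup[OF Cz_subgroup] unfolding U_def by fastforce
  then obtain s where s: "s \<in> carrier G" "s \<notin> U" "s \<notin> ?Z" by blast
  then show ?thesis using that unfolding U_def by blast
qed

text \<open>The quotient by \<open>Z (n - 2)\<close> has order p^2 and is not cyclic, hence has
  exponent p.\<close>

lemma pow_p_in_Z: assumes s: "s \<in> carrier G" shows "s [^] p \<in> Z (n - 2)"
proof (rule ccontr)
  assume neg: "s [^] p \<notin> Z (n - 2)"
  have sZ: "s \<notin> Z (n - 2)"
  proof
    assume "s \<in> Z (n - 2)"
    then have "s [^] k \<in> Z (n - 2)" for k :: nat
      using subgroup.m_closed[OF ucs_subgroup] subgroup.one_closed[OF ucs_subgroup] by (induction k) auto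
    then show False using neg by blast
  qed
  define T where "T = generate G (insert s (Z (n - 2)))"
  have C: "insert s (Z (n - 2)) \<subseteq> carrier G" using s ucs_carrier by blast
  have sT: "subgroup T G" unfolding T_def by (rule generate_is_subgroup[OF C])
  have n3: "n - 2 = Suc (n - 3)" using n6 by simp
  have "T \<noteq> carrier G"
  proof (rule not_cyclic_over_Z[of s "n - 3", OF s _ sT])
    show "s \<notin> Z (Suc (n - 3))" using sZ n3 by simp
    show "T \<subseteq> T'" if "subgroup T' G" "s \<in> T'" "Z (Suc (n - 3)) \<subseteq> T'" for T'
      unfolding T_def by (rule generate_subgroup_incl) (use that n3 in auto)
  qed
  then have "T \<subset> carrier G" using subgroup.subset[OF sT] by blast
  then have l1: "card T * p \<le> p ^ n" using card_proper_subgroup[OF sT subgroup_self] ord unfolding order_def by simp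
  have ZT: "Z (n - 2) \<subset> T" unfolding T_def using sZ by (auto intro: generate.incl)
  have "card (Z (n - 2)) * p \<le> card T" using card_proper_subgroup[OF ucs_subgroup sT ZT] .
  then have l2: "p ^ (n - 2) * p \<le> card T" using card_Z[of "n - 2"] by simp
  have pn: "p ^ n = p ^ (n - 2) * p * p"
  proof -
    have "Suc (Suc (n - 2)) = n" using n6 by auto
    then show ?thesis by (metis power_Suc2)
  qed
  have cT: "card T = p ^ (n - 2) * p" using l1 l2 p_gt_1 unfolding pn by simp
  interpret N: normal "Z (n - 2)" "G\<lparr>carrier := T\<rparr>"
    using normal_restrict_supergroup[OF sT ucs_normal] ZT by blast
  interpret Q: group "G\<lparr>carrier := T\<rparr> Mod Z (n - 2)" by (rule N.factorgroup_is_group)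
  have sT2: "s \<in> T" unfolding T_def by (simp add: generate.incl)
  let ?x = "Z (n - 2) #>\<^bsub>G\<lparr>carrier := T\<rparr>\<^esub> s"
  have "order (G\<lparr>carrier := T\<rparr> Mod Z (n - 2)) * card (Z (n - 2)) = card T"
    using N.lagrange[OF N.subgroup_axioms] by (simp add: order_def FactGroup_def)
  then have oQ: "order (G\<lparr>carrier := T\<rparr> Mod Z (n - 2)) = p"
    using card_Z[of "n - 2"] cT p_gt_1 by (simp add: mult.commute)
  have "?x \<in> carrier (G\<lparr>carrier := T\<rparr> Mod Z (n - 2))" unfolding carrier_FactGroup using sT2 by simp
  then have "?x [^]\<^bsub>G\<lparr>carrier := T\<rparr> Mod Z (n - 2)\<^esub> p = Z (n - 2)"
    using Q.pow_order_eq_1[of ?x] oQ by simp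
  then have "Z (n - 2) #> (s [^] p) = Z (n - 2)"
    using N.FactGroup_pow[of s p] sT2 by (simp add: nat_pow_consistent[symmetric])
  then show False using neg coset_join1[of "Z (n - 2)" "s [^] p"] s ucs_subgroup subgroup.subset by blast
qed

text \<open>Two of the sets \<open>Cz 1\<close>, \<open>Cz 2\<close>, \<open>Cz 3\<close> coincide, so some \<open>s\<close> lies outside all of
  \<open>Cz 1, \<dots>, Cz p\<close> and outside one further \<open>Cz c\<close>, where \<open>Z\<^sub>c = C\<^sub>G(Z\<^sub>p\<^sub>+\<^sub>1)\<close>. It acts uniserially on
  \<open>Z\<^sub>p\<^sub>+\<^sub>1\<close>, hence \<open>s\<^sup>p\<close> acts there as the non-zero operator \<open>(s - 1)\<^sup>p\<close>. As \<open>s\<close> commutes with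
  \<open>s\<^sup>p \<in> Z\<^sub>c\<^sub>+\<^sub>1\<close>, it lies in \<open>Cz c\<close>.\<close>

lemma elementary_abelian_Z_bound:
  assumes k: "Suc p \<le> n - 2" and ea: "elementary_abelian p G (Z (Suc p))"
  shows False
proof -
  let ?N = "Z (Suc p)"
  have sN: "subgroup ?N G" by (rule ucs_subgroup)
  have NC: "\<And>x. x \<in> ?N \<Longrightarrow> x \<in> carrier G" using ucs_carrier by blast
  have ab: "a \<otimes> b = b \<otimes> a" if "a \<in> ?N" "b \<in> ?N" for a b using ea that unfolding elementary_abelian_iff by blast
  have np: "p \<le> n - 3" using k by linarith
  have twin: "\<exists>i i'. 1 \<le> i \<and> i < i' \<and> i' \<le> 3 \<and> Cz i = D \<and> Cz i' = D"
  proof -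
    \<comment> \<open>The index n - 3 qualifies. By \<open>D_spread\<close> a smaller index occurs
      as well unless i0 = 2, and by minimality it can only be 1, so i0 = 3. For i0 = 2
      \<open>D_neighbour\<close> supplies the twin.\<close>
    define i0 where "i0 = (LEAST i. 2 \<le> i \<and> D \<subseteq> Cz i)"
    have ex: "2 \<le> n - 3 \<and> D \<subseteq> Cz (n - 3)" using n6 by simp
    have i0: "2 \<le> i0 \<and> D \<subseteq> Cz i0" unfolding i0_def by (rule LeastI) (rule ex)
    have le: "i0 \<le> n - 3" unfolding i0_def by (rule Least_le) (rule ex)
    have min: "\<not> D \<subseteq> Cz i" if "2 \<le> i" "i < i0" for i
      using that not_less_Least[of i "\<lambda>i. 2 \<le> i \<and> D \<subseteq> Cz i"] unfolding i0_def by blast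
    have eq: "Cz i = D" if "1 \<le> i" "i \<le> 3" "D \<subseteq> Cz i" for i using Cz_eq[OF that(1) _ that(3)] that n6 by simp
    show ?thesis
    proof (cases "i0 = 2")
      case True
      have Z4: "Z 4 \<subseteq> ?N" using ucs_mono[of 4 "Suc p"] p3 by simp
      have "D \<subseteq> Cz 1 \<or> D \<subseteq> Cz 3" by (rule D_neighbour) (use ab Z4 i0 True in blast)+
      then show ?thesis
      proof
        assume "D \<subseteq> Cz 1"
        then show ?thesis using eq[of 1] eq[of 2] i0 True by (intro exI[of _ 1] exI[of _ 2]) simp
      next
        assume "D \<subseteq> Cz 3"
        then show ?thesis using eq[of 3] eq[of 2] i0 True by (intro exI[of _ 2] exI[of _ 3]) simp
      qed
    next
      case False
      then have g3: "3 \<le> i0" using i0 by simp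
      then have "D \<subseteq> Cz (i0 - 1) \<or> D \<subseteq> Cz (i0 - 2)" using D_spread le i0 by blast
      moreover have "\<not> D \<subseteq> Cz (i0 - 1)" by (rule min) (use g3 in linarith)+
      moreover have "\<not> D \<subseteq> Cz (i0 - 2)" if "i0 \<noteq> 3" by (rule min) (use g3 that in linarith)+
      ultimately have "i0 = 3 \<and> D \<subseteq> Cz 1" by (cases "i0 = 3") auto
      then show ?thesis using eq[of 1] eq[of 3] i0 by (intro exI[of _ 1] exI[of _ 3]) simp
    qed
  qed
  then obtain i1 i2 where i12: "1 \<le> i1" "i1 < i2" "i2 \<le> 3" "Cz i1 = Cz i2" by metis
  define C where "C = centralizer G ?N"
  have nC: "C \<lhd> G" unfolding C_def by (rule centralizer_normal[OF ucs_normal])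
  have sC: "subgroup C G" using nC normal_imp_subgroup by blast
  have NsC: "?N \<subseteq> C" unfolding C_def centralizer_def using NC ab by auto
  obtain c where c: "card C = p ^ c" using card_subgroup_pow[OF sC] .
  have cp: "Suc p \<le> c"
  proof -
    have "card ?N \<le> card C" using NsC fin_subgroup[OF sC] by (simp add: card_mono)
    then show ?thesis using card_Z[OF k] c p_gt_1 power_le_imp_le_exp by metis
  qed
  \<comment> \<open>Omitting i2, which gives the same centralizer as i1, makes room for c among the
    p subgroups that can be avoided simultaneously.\<close>
  define I where "I = {1..p} - {i2} \<union> (if c \<le> n - 3 then {c} else {})"
  have "card (Cz ` I) \<le> card I" by (rule card_image_le) (simp add: I_def)
  also have "\<dots> \<le> card ({1..p} - {i2}) + 1" unfolding I_def by (rule le_trans[OF card_Un_le]) simp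
  also have "card ({1..p} - {i2}) = p - 1" using i12 p3 by simp
  also have "p - 1 + 1 = p" using p3 by simp
  finally have cI: "card (Cz ` I) \<le> p" .
  have "I \<subseteq> {1..n - 3}" unfolding I_def using np cp by auto
  then obtain s where s: "s \<in> carrier G" "\<And>i. i \<in> I \<Longrightarrow> s \<notin> Cz i" using Z_union_bound cI by blast
  have sCz: "s \<notin> Cz i" if "i \<in> {1..p}" for i
  proof (cases "i = i2")
    case True
    have "i1 \<in> I" unfolding I_def using i12 p3 by auto
    then show ?thesis using s(2) i12 True by auto
  qed (use s(2) that I_def in auto)
  define h where "h = s [^] p"
  have hC: "h \<in> carrier G" unfolding h_def using s by simp
  define \<phi> where "\<phi> = (\<lambda>b. comm_elt G b s)"
  interpret A: comm_group "G\<lparr>carrier := ?N\<rparr>"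
    by (rule group.group_comm_groupI[OF subgroup_imp_group[OF sN]]) (use ab in simp)
  have comm_hom: "comm_elt G (a \<otimes> b) g = comm_elt G a g \<otimes> comm_elt G b g" if m: "a \<in> ?N" "b \<in> ?N" "g \<in> carrier G" for a b g
  proof -
    have "comm_elt G a g \<in> ?N" using normal_comm_elt[OF ucs_normal NC[OF m(1)] m(3)] m by blast
    then have "inv b \<otimes> comm_elt G a g \<otimes> b = comm_elt G a g" using ab m NC by (simp add: m_assoc)
    then show ?thesis using m NC by (simp add: comm_elt_mult_left)
  qed
  have \<phi>N: "\<phi> b \<in> ?N" if "b \<in> ?N" for b unfolding \<phi>_def using normal_comm_elt[OF ucs_normal NC[OF that] s(1)] that by blast
  have \<phi>h: "\<phi> \<in> hom (G\<lparr>carrier := ?N\<rparr>) (G\<lparr>carrier := ?N\<rparr>)"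
    by (rule homI) (use \<phi>N comm_hom s in \<open>auto simp: \<phi>_def\<close>)
  have \<sigma>: "((\<lambda>x. x \<otimes> \<phi> x) ^^ m) b = inv (s [^] m) \<otimes> b \<otimes> s [^] m \<and> inv (s [^] m) \<otimes> b \<otimes> s [^] m \<in> ?N" if b: "b \<in> ?N" for b m
  proof (induction m)
    case 0
    then show ?case using NC[OF b] b by simp
  next
    case (Suc m)
    let ?d = "inv (s [^] m) \<otimes> b \<otimes> s [^] m"
    have "?d \<otimes> \<phi> ?d = inv s \<otimes> ?d \<otimes> s" unfolding \<phi>_def using NC[OF b] s by (simp add: conj_eq_comm_elt)
    also have "\<dots> = inv (s [^] Suc m) \<otimes> b \<otimes> s [^] Suc m" using NC[OF b] s by (simp add: inv_mult_group m_assoc)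
    finally have "((\<lambda>x. x \<otimes> \<phi> x) ^^ Suc m) b = inv (s [^] Suc m) \<otimes> b \<otimes> s [^] Suc m" using Suc by simp
    then show ?case using normal_conj(1)[OF ucs_normal b] s nat_pow_closed[OF s(1), of "Suc m"] by metis
  qed
  have \<phi>pN: "(\<phi> ^^ i) b \<in> ?N" if "b \<in> ?N" for b i using that \<phi>N by (induction i) auto
  \<comment> \<open>On the abelian group \<open>?N\<close> of exponent p, s acts as 1 + phi, so its
    p-th power acts as 1 + phi^p.\<close>
  have comm_h: "comm_elt G b h = (\<phi> ^^ p) b" if b: "b \<in> ?N" for b
  proof -
    have "((\<lambda>x. x \<otimes> \<phi> x) ^^ p) b = b \<otimes> (\<phi> ^^ p) b"
      using A.hom_plus_one_funpow_prime[OF \<phi>h _ p, of b] b ea unfolding elementary_abelian_iff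
      by (simp add: nat_pow_consistent[symmetric])
    then have "b \<otimes> comm_elt G b h = b \<otimes> (\<phi> ^^ p) b"
      using \<sigma>[OF b, of p] NC[OF b] hC unfolding h_def by (simp add: conj_eq_comm_elt)
    then show ?thesis using NC[OF b] NC[OF \<phi>pN[OF b]] hC by simp
  qed
  have low: "(\<phi> ^^ i) b \<in> Z (l - i)" if "b \<in> Z l" for b i l
  proof (induction i)
    case (Suc i)
    then show ?case using ucs_comm[OF Suc s(1)] unfolding \<phi>_def by simp
  qed (use that in simp)
  obtain a where a: "a \<in> ?N" "a \<notin> Z p" by (rule Z_gap[of p]) (use k in linarith)
  \<comment> \<open>Since s avoids \<open>Cz 1\<close> up to \<open>Cz p\<close>, each application
    of phi to a drops by exactly one level.\<close>
  have strict: "i \<le> p \<Longrightarrow> (\<phi> ^^ i) a \<notin> Z (p - i)" for i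
  proof (induction i)
    case (Suc i)
    have m: "(\<phi> ^^ i) a \<in> Z (Suc (p - i))" using low[OF a(1), of i] Suc by (simp add: Suc_diff_le)
    have "(\<phi> ^^ i) a \<notin> Z (p - i)" using Suc by simp
    then have "comm_elt G ((\<phi> ^^ i) a) s \<notin> Z (p - i - 1)"
      using Cz_iff[OF _ m _ s(1)] sCz[of "p - i"] Suc(2) np by simp
    then show ?case unfolding \<phi>_def by simp
  qed (use a in simp)
  have ah: "comm_elt G a h \<noteq> \<one>" using comm_h[OF a(1)] strict[of p] by auto
  have bh1: "comm_elt G b h \<in> Z 1" if "b \<in> ?N" for b using comm_h[OF that] low[OF that, of p] by simp
  have bh0: "comm_elt G b h = \<one>" if "b \<in> Z p" for b
    using comm_h[of b] low[OF that, of p] that ucs_Suc_subset[of p] by auto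
  have hnC: "h \<notin> C"
  proof
    assume "h \<in> C"
    then have "a \<otimes> h = h \<otimes> a" unfolding C_def centralizer_def using a by auto
    then show False using ah comm_elt_eq_one_iff[OF NC[OF a(1)] hC] by blast
  qed
  \<comment> \<open>Otherwise \<open>C\<close> contains \<open>Z (n - 2)\<close> and with it the
    p-th power h of s.\<close>
  have cn: "c \<le> n - 3"
  proof (rule ccontr)
    assume "\<not> c \<le> n - 3"
    then have "n - 2 \<le> c" by linarith
    then have "p ^ (n - 2) \<le> card C" unfolding c using p_gt_1 by (intro power_increasing) auto
    then have "Z (n - 2) \<subseteq> C" using Z_sub_normal[OF nC] by simp
    then show False using pow_p_in_Z[OF s(1)] hnC unfolding h_def by blast
  qed
  have CZ: "C = Z c" using normal_eq_Z[OF nC c] cn by linarith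
  \<comment> \<open>h acts on \<open>?N\<close> as a transvection with centre in \<open>Z 1\<close>
    and \<open>Z p\<close> in its kernel. As \<open>G\<close> acts trivially on \<open>Z 1\<close>
    and on the top section, h and its conjugates act alike. So h is central modulo C = Z_c, that is,
    it lies in Z_(c+1).\<close>
  have "comm_elt G h g \<in> C" if g: "g \<in> carrier G" for g
  proof -
    let ?k = "comm_elt G h g"
    have kC: "?k \<in> carrier G" using hC g by simp
    have same: "inv (inv g \<otimes> h \<otimes> g) \<otimes> b \<otimes> (inv g \<otimes> h \<otimes> g) = inv h \<otimes> b \<otimes> h" if b: "b \<in> ?N" for b
    proof -
      let ?b = "g \<otimes> b \<otimes> inv g"
      let ?u = "comm_elt G b (inv g)"
      have bC: "b \<in> carrier G" using NC[OF b] .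
      have uZ: "?u \<in> Z p" using ucs_comm[OF b, of "inv g"] g by simp
      have uN: "?u \<in> ?N" using uZ ucs_Suc_subset by blast
      have bu: "?b = b \<otimes> ?u" using bC g conj_eq_comm_elt[of b "inv g"] by simp
      have ch: "comm_elt G ?b h = comm_elt G b h" unfolding bu comm_hom[OF b uN hC] bh0[OF uZ] using bC hC by simp
      have cen: "inv g \<otimes> comm_elt G b h \<otimes> g = comm_elt G b h"
        using ucs_comm[OF bh1[OF b] g] bC hC g by (simp add: conj_eq_comm_elt)
      have "inv (inv g \<otimes> h \<otimes> g) \<otimes> b \<otimes> (inv g \<otimes> h \<otimes> g) = inv g \<otimes> (inv h \<otimes> ?b \<otimes> h) \<otimes> g"
        using bC g hC by (simp add: inv_mult_group m_assoc)
      also have "inv h \<otimes> ?b \<otimes> h = ?b \<otimes> comm_elt G ?b h" using bC g hC by (simp add: conj_eq_comm_elt)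
      also have "\<dots> = ?b \<otimes> comm_elt G b h" unfolding ch ..
      also have "inv g \<otimes> (?b \<otimes> comm_elt G b h) \<otimes> g = b \<otimes> (inv g \<otimes> comm_elt G b h \<otimes> g)"
        using bC g hC by (simp add: m_assoc)
      also have "\<dots> = inv h \<otimes> b \<otimes> h" unfolding cen using bC hC by (simp add: conj_eq_comm_elt)
      finally show ?thesis .
    qed
    have "?k \<otimes> b = b \<otimes> ?k" if b: "b \<in> ?N" for b
    proof -
      have bC: "b \<in> carrier G" using NC[OF b] .
      let ?b = "h \<otimes> b \<otimes> inv h"
      have bN: "?b \<in> ?N" using normal_conj(2)[OF ucs_normal b hC] .
      have "inv ?k \<otimes> b \<otimes> ?k = inv (inv g \<otimes> h \<otimes> g) \<otimes> ?b \<otimes> (inv g \<otimes> h \<otimes> g)"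
        using bC g hC by (simp add: word_simps)
      also have "\<dots> = b" unfolding same[OF bN] using bC hC by (simp add: m_assoc)
      finally have "?k \<otimes> (inv ?k \<otimes> b \<otimes> ?k) = ?k \<otimes> b" by simp
      then show ?thesis using kC bC by (simp add: m_assoc)
    qed
    then show ?thesis unfolding C_def centralizer_def using kC by blast
  qed
  then have hS: "h \<in> Z (Suc c)" unfolding CZ using hC by (simp add: ucs.simps)
  have "h \<otimes> s = s \<otimes> h" unfolding h_def using nat_pow_comm[OF s(1), of p 1] s by simp
  then have "comm_elt G h s = \<one>" using comm_elt_eq_one_iff[OF hC s(1)] by blast
  then have "s \<in> Cz c" using Cz_iff[OF cn hS _ s(1)] hnC subgroup.one_closed[OF ucs_subgroup] unfolding CZ by simp
  moreover have "c \<in> I" unfolding I_def using cn by simp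
  ultimately show False using s(2) by blast
qed

end

section \<open>Offenders in groups of maximal class\<close>

context ps_module
begin

lemma dl_pow_of_quad:
  assumes "quad y" "y \<in> carrier G" "v \<in> carrier V"
  shows "dl (y [^] (i::nat)) v = dl y v [^]\<^bsub>V\<^esub> i"
  unfolding dl_def[of "y [^] i"] quad_pow_act[OF assms] using assms by (simp add: V.m_assoc)

lemma quad_pow:
  assumes "quad y" "y \<in> carrier G" shows "quad (y [^] (i::nat))"
proof -
  have "dl (y [^] i) (dl (y [^] i) v) = \<epsilon>" if v: "v \<in> carrier V" for v
  proof -
    interpret h: group_hom V V "dl y"
      using dl_hom[OF assms(2)] by (simp add: group_hom_def group_hom_axioms_def)
    have "dl y (dl y v) = \<epsilon>" using assms v unfolding quad_def by (simp add: dl_eq_one_iff)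
    then have "dl y (dl y v [^]\<^bsub>V\<^esub> i) = \<epsilon>" using h.hom_nat_pow[of "dl y v" i] assms v by simp
    then show ?thesis using assms v by (simp add: dl_pow_of_quad)
  qed
  then show ?thesis unfolding quad_def using assms by (simp add: dl_eq_one_iff)
qed

text \<open>Write gy - 1 = A + B with A = g - 1 and B = g(y - 1). These commute and B^2 = 0, so (A +
  B)^(m+1) = A^(m+1) + (m+1) A^m B, which vanishes with A^m.\<close>

lemma dl_funpow_mult_quad:
  assumes g: "g \<in> carrier G" and y: "y \<in> carrier G" "quad y" and c: "g \<otimes> y = y \<otimes> g"
    and m: "\<And>v. v \<in> carrier V \<Longrightarrow> (dl g ^^ m) v = \<epsilon>" and v: "v \<in> carrier V"
  shows "(dl (g \<otimes> y) ^^ Suc m) v = \<epsilon>"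
proof -
  define B where "B = (\<lambda>v. \<rho> g (dl y v))"
  have BC: "B u \<in> carrier V" if "u \<in> carrier V" for u unfolding B_def using that g y by simp
  have gy: "g \<otimes> y \<in> carrier G" using g y by simp
  have dly: "dl y (dl y u) = \<epsilon>" if "u \<in> carrier V" for u using y that unfolding quad_def by (simp add: dl_eq_one_iff)
  have BB: "B (B u) = \<epsilon>" if u: "u \<in> carrier V" for u
  proof -
    have "dl y (\<rho> g (dl y u)) = \<rho> g (dl y (dl y u))" using act_dl_comm[OF g y(1) c, of "dl y u"] u y by simp
    then show ?thesis unfolding B_def dly[OF u] using g by simp
  qed
  have AB: "dl g (B u) = B (dl g u)" if u: "u \<in> carrier V" for u
  proof -
    have "dl g (\<rho> g (dl y u)) = \<rho> g (dl g (dl y u))" using act_dl_comm[OF g g refl] u y by simp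
    also have "dl g (dl y u) = dl y (dl g u)"
      using act_dl_comm[OF g y(1) c u] u g y by (simp add: dl_def[of g] dl_vmult dl_vinv)
    finally show ?thesis unfolding B_def .
  qed
  have key: "(dl (g \<otimes> y) ^^ Suc k) v = (dl g ^^ Suc k) v \<star> B ((dl g ^^ k) v) [^]\<^bsub>V\<^esub> Suc k" for k
  proof (induction k)
    case 0
    then show ?case unfolding B_def using g y v by (simp add: dl_mult V.m_comm)
  next
    case (Suc k)
    interpret h: group_hom V V "dl (g \<otimes> y)"
      using dl_hom[OF gy] by (simp add: group_hom_def group_hom_axioms_def)
    define a b where "a = (dl g ^^ Suc k) v" and "b = B ((dl g ^^ k) v)"
    have ab: "a \<in> carrier V" "b \<in> carrier V" unfolding a_def b_def using BC g v by (auto simp del: funpow.simps)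
    have bk: "(dl g ^^ k) v \<in> carrier V" using g v by simp
    have db: "dl (g \<otimes> y) b = B a"
    proof -
      have "dl (g \<otimes> y) b = B b \<star> dl g b" using g y ab by (simp add: dl_mult B_def)
      moreover have "B b = \<epsilon>" unfolding b_def by (rule BB[OF bk])
      moreover have "dl g b = B a" unfolding a_def b_def using AB[OF bk] by simp
      ultimately show ?thesis using ab BC by simp
    qed
    have "(dl (g \<otimes> y) ^^ Suc (Suc k)) v = dl (g \<otimes> y) (a \<star> b [^]\<^bsub>V\<^esub> Suc k)"
      using Suc unfolding a_def b_def by simp
    also have "\<dots> = dl (g \<otimes> y) a \<star> B a [^]\<^bsub>V\<^esub> Suc k"
      using ab h.hom_mult[of a "b [^]\<^bsub>V\<^esub> Suc k"] h.hom_nat_pow[of b "Suc k"] db by simp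
    also have "dl (g \<otimes> y) a = dl g a \<star> B a" using g y ab BC by (simp add: dl_mult V.m_comm B_def)
    also have "dl g a \<star> B a \<star> B a [^]\<^bsub>V\<^esub> Suc k = dl g a \<star> B a [^]\<^bsub>V\<^esub> Suc (Suc k)"
      using ab BC g by (simp add: V.m_assoc V.m_comm V.m_lcomm)
    finally show ?case unfolding a_def by simp
  qed
  have "B \<epsilon> = \<epsilon>" unfolding B_def using g y by simp
  then show ?thesis unfolding key using m[OF v] g by simp
qed

text \<open>Choose a counterexample a as low as possible in the upper central series. Then w =
  [a, e] is lower and commutes with e, and it commutes with a inside \<open>A\<close>; so w is
  quadratic. \<open>W\<close> is any set known to confine these commutators and to contain no
  non-trivial quadratic element.\<close>

lemma quad_centralizes_abelian_normal:
  assumes A: "A \<lhd> G" and ab: "\<And>a b. a \<in> A \<Longrightarrow> b \<in> A \<Longrightarrow> a \<otimes> b = b \<otimes> a"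
    and e: "e \<in> carrier G" "quad e" and W: "\<And>a. a \<in> A \<Longrightarrow> comm_elt G a e \<in> W"
    and noq: "\<And>w. w \<in> W \<Longrightarrow> w \<in> carrier G \<Longrightarrow> quad w \<Longrightarrow> w = \<one>" and a: "a \<in> A"
  shows "a \<otimes> e = e \<otimes> a"
proof (rule ccontr)
  assume neg: "a \<otimes> e \<noteq> e \<otimes> a"
  have AC: "\<And>a. a \<in> A \<Longrightarrow> a \<in> carrier G" using A normal_imp_subgroup subgroup.mem_carrier by metis
  obtain c where c: "G.ucs c = carrier G" using G.ucs_top .
  define T where "T = (\<lambda>l. \<exists>a\<in>A. comm_elt G a e \<noteq> \<one> \<and> a \<in> G.ucs l)"
  have "T c" unfolding T_def using neg a AC c e G.comm_elt_eq_one_iff by blast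
  define l where "l = (LEAST l. T l)"
  have Tl: "T l" unfolding l_def by (rule LeastI) fact
  have less: "\<not> T i" if "i < l" for i using that not_less_Least unfolding l_def by blast
  obtain a where a: "a \<in> A" "comm_elt G a e \<noteq> \<one>" "a \<in> G.ucs l" using Tl unfolding T_def by blast
  have aC: "a \<in> carrier G" using a AC by blast
  have l0: "l \<noteq> 0"
  proof
    assume "l = 0"
    then have "a = \<one>" using a(3) by simp
    then show False using a(2) e by simp
  qed
  define w where "w = comm_elt G a e"
  have wA: "w \<in> A" unfolding w_def using G.normal_comm_elt[OF A aC e(1)] a by blast
  have wC: "w \<in> carrier G" using wA AC by blast
  have "w \<in> G.ucs (l - 1)" unfolding w_def using G.ucs_comm[OF a(3) e(1)] .
  then have "comm_elt G w e = \<one>" using less[of "l - 1"] l0 wA unfolding T_def by auto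
  then have we: "w \<otimes> e = e \<otimes> w" using G.comm_elt_eq_one_iff[OF wC e(1)] by blast
  have iw: "inv w = comm_elt G e a" unfolding w_def using aC e by (simp add: G.inv_comm_elt)
  have "quad (inv w)"
    by (rule quad_comm_elt[OF e(1) aC e(2) iw])
      (use G.commute_inv[OF wC e(1) we] G.commute_inv[OF wC aC ab[OF wA a(1)]] in auto)
  then have "quad w" using quad_inv[of "inv w"] wC by simp
  then have "w = \<one>" using noq W[OF a(1)] wC unfolding w_def by blast
  then show False using a(2) unfolding w_def by blast
qed

text \<open>A subgroup of order p^m generated stepwise by quadratic elements of \<open>R\<close>
  satisfies (g - 1)^(m+1) = 0 for all its elements g. A maximal such subgroup contains all quadratic
  elements of \<open>R\<close>, hence the normal closure of x, hence a central element z;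
  \<open>ps\<close> then gives m + 1 > p - 1.\<close>

lemma normal_of_quads_card:
  assumes R: "R \<lhd> G" and eR: "elementary_abelian p G R" and x: "x \<in> R" "quad x" "x \<noteq> \<one>"
    and cR: "card R = p ^ r"
  shows "p - 1 \<le> r"
proof -
  have sR: "subgroup R G" and ab: "\<And>a b. a \<in> R \<Longrightarrow> b \<in> R \<Longrightarrow> a \<otimes> b = b \<otimes> a" and eR': "\<And>a. a \<in> R \<Longrightarrow> a [^] p = \<one>"
    using eR unfolding G.elementary_abelian_iff by auto
  have RC: "\<And>a. a \<in> R \<Longrightarrow> a \<in> carrier G" using subgroup.mem_carrier[OF sR] .
  have xC: "x \<in> carrier G" using x RC by blast
  define QQ where "QQ = {Q. subgroup Q G \<and> Q \<subseteq> R \<and>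
    (\<exists>m. card Q = p ^ m \<and> (\<forall>g\<in>Q. \<forall>v\<in>carrier V. (dl g ^^ Suc m) v = \<epsilon>))}"
  have "finite QQ" by (rule finite_subset[of _ "Pow R"]) (use G.fin_subgroup[OF sR] QQ_def in auto)
  moreover have "{\<one>} \<in> QQ"
  proof -
    have "(dl \<one> ^^ Suc 0) v = \<epsilon>" if "v \<in> carrier V" for v using that by (simp add: dl_def)
    then show ?thesis unfolding QQ_def using G.triv_subgroup subgroup.one_closed[OF sR] by (auto intro!: exI[of _ 0])
  qed
  ultimately obtain Q where Q: "Q \<in> QQ" and max: "\<forall>Q'\<in>QQ. Q \<subseteq> Q' \<longrightarrow> Q = Q'"
    using finite_has_maximal[of QQ] by blast
  obtain m where sQ: "subgroup Q G" "Q \<subseteq> R" and m: "card Q = p ^ m"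
    and nil: "\<And>g v. g \<in> Q \<Longrightarrow> v \<in> carrier V \<Longrightarrow> (dl g ^^ Suc m) v = \<epsilon>" using Q unfolding QQ_def by blast
  have conj: "y \<in> Q" if y: "y \<in> R" "quad y" for y
  proof (rule ccontr)
    assume yQ: "y \<notin> Q"
    have yC: "y \<in> carrier G" using y RC by blast
    define Y where "Y = generate G {y}"
    have gen: "Y = {y [^] k | k. k \<in> (UNIV::nat set)}" unfolding Y_def using G.generate_pow_on_finite_carrier[OF G.fin yC] .
    have sY: "subgroup Y G" unfolding Y_def using G.generate_is_subgroup yC by blast
    have YR: "Y \<subseteq> R" unfolding Y_def using G.generate_subgroup_incl[OF _ sR] y by blast
    define Q' where "Q' = Q <#> Y"
    have sQ': "subgroup Q' G" unfolding Q'_def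
      by (rule G.set_mult_subgroup_commute[OF sQ(1) sY]) (use ab sQ YR in blast)
    have yY: "y \<in> Y" unfolding Y_def by (simp add: generate.incl)
    have QQ': "Q \<subseteq> Q'" "Y \<subseteq> Q'"
      unfolding Q'_def using set_mult_memI[of _ Q \<one> Y G] set_mult_memI[of \<one> Q _ Y G]
        subgroup.one_closed[OF sY] subgroup.one_closed[OF sQ(1)] subgroup.mem_carrier[OF sY] subgroup.mem_carrier[OF sQ(1)] by auto
    have Q'R: "Q' \<subseteq> R" unfolding Q'_def set_mult_def using sQ YR subgroup.m_closed[OF sR] by blast
    have cY: "card Y \<le> p"
    proof -
      have "Y \<subseteq> (\<lambda>k. y [^] k) ` {..<p}"
      proof
        fix w assume "w \<in> Y"
        then obtain k :: nat where "w = y [^] k" unfolding gen by blast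
        also have "\<dots> = y [^] (k mod p)"
          by (rule G.pow_eq_of_cong[OF yC eR'[OF y(1)]]) (simp add: cong_def)
        finally show "w \<in> (\<lambda>k. y [^] k) ` {..<p}" using G.p_gt_1 by simp
      qed
      then have "card Y \<le> card ((\<lambda>k. y [^] k) ` {..<p})" by (intro card_mono) auto
      also have "\<dots> \<le> p" using card_image_le[of "{..<p}" "\<lambda>k. y [^] k"] by simp
      finally show ?thesis .
    qed
    have "Q \<subset> Q'" using QQ' yY yQ by blast
    then have ge: "card Q * p \<le> card Q'" using G.card_proper_subgroup[OF sQ(1) sQ'] by blast
    have "card Q' * card (Q \<inter> Y) = card Q * card Y"
      unfolding Q'_def using G.card_set_mult_Int[OF sQ(1) sY] G.fin_subgroup sQ(1) sY by blast
    moreover have "card (Q \<inter> Y) > 0" using G.card_subgroup_pos[OF G.subgroups_Inter_pair[OF sQ(1) sY]] .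
    ultimately have "card Q' \<le> card Q * card Y" by (metis One_nat_def Suc_leI mult.right_neutral mult_le_mono2)
    also have "\<dots> \<le> card Q * p" using cY by simp
    finally have cQ': "card Q' = p ^ Suc m" using ge m by (simp add: mult.commute)
    have "(dl g ^^ Suc (Suc m)) v = \<epsilon>" if g: "g \<in> Q'" and v: "v \<in> carrier V" for g v
    proof -
      obtain h k where h: "h \<in> Q" "g = h \<otimes> y [^] (k::nat)" using g unfolding Q'_def set_mult_def gen by blast
      have "y [^] k \<in> Y" unfolding gen by blast
      then have "h \<otimes> y [^] k = y [^] k \<otimes> h" using ab h sQ YR by blast
      moreover have "h \<in> carrier G" using h sQ RC by blast
      ultimately show ?thesis unfolding h(2)
        using dl_funpow_mult_quad[OF _ _ quad_pow[OF y(2) yC] _ nil[OF h(1)] v] yC by blast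
    qed
    then have "Q' \<in> QQ" unfolding QQ_def using sQ' Q'R cQ' by blast
    then have "Q = Q'" using max QQ' by blast
    then show False using QQ' yY yQ by blast
  qed
  define K where "K = generate G {inv g \<otimes> x \<otimes> g | g. g \<in> carrier G}"
  have KC: "{inv g \<otimes> x \<otimes> g | g. g \<in> carrier G} \<subseteq> carrier G" using xC by auto
  have sK: "subgroup K G" unfolding K_def by (rule G.generate_is_subgroup[OF KC])
  have KQ: "K \<subseteq> Q" unfolding K_def
  proof (rule G.generate_subgroup_incl[OF _ sQ(1)], clarify)
    fix g assume g: "g \<in> carrier G"
    show "inv g \<otimes> x \<otimes> g \<in> Q" using conj[OF G.normal_conj(1)[OF R x(1) g] quad_conj[OF x(2) xC g]] .
  qed
  have xK: "x \<in> K"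
  proof -
    have "x = inv \<one> \<otimes> x \<otimes> \<one>" using xC by simp
    then show ?thesis unfolding K_def by (intro generate.incl) blast
  qed
  have "K \<lhd> G" unfolding K_def
  proof (rule G.normal_generate_conj[OF KC], clarify)
    fix h g assume g: "g \<in> carrier G" and h: "h \<in> carrier G"
    have "inv h \<otimes> (inv g \<otimes> x \<otimes> g) \<otimes> h = inv (g \<otimes> h) \<otimes> x \<otimes> (g \<otimes> h)" using g h xC by (simp add: G.m_assoc G.inv_mult_group)
    then show "\<exists>k. inv h \<otimes> (inv g \<otimes> x \<otimes> g) \<otimes> h = inv k \<otimes> x \<otimes> k \<and> k \<in> carrier G" using g h by blast
  qed
  moreover have "K \<noteq> {\<one>}" using xK x(3) by blast
  ultimately obtain z where z: "z \<in> K" "z \<noteq> \<one>" and zc: "\<And>g. g \<in> carrier G \<Longrightarrow> z \<otimes> g = g \<otimes> z"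
    using G.normal_meets_center by blast
  have zC: "z \<in> carrier G" using z subgroup.mem_carrier[OF sK] by blast
  obtain v where v: "v \<in> carrier V" "(dl z ^^ (p - 1)) v \<noteq> \<epsilon>" using ps[OF zC zc z(2)] by blast
  have "(dl z ^^ Suc m) v = \<epsilon>" using nil z KQ v by blast
  then have "\<not> Suc m \<le> p - 1" using dl_funpow_ge[OF zC v(1)] v(2) by blast
  then have "p - 1 \<le> m" by linarith
  moreover have "p ^ m \<le> p ^ r" using m cR sQ(2) G.fin_subgroup[OF sR] card_mono by metis
  then have "m \<le> r" using G.p_gt_1 power_le_imp_le_exp by blast
  ultimately show ?thesis by linarith
qed

text \<open>If r < k, then r = p - 1 and k = p. Commutation with some a in Z_p outside Z_r is a
  homomorphism on \<open>E\<close> with image of order at most p and kernel of order at most p^2. So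
  |E| <= p^3, against the lower bound p^(p-1) with p >= 5.\<close>

lemma no_offender_max_class:
  assumes mc: "max_class_group G p n" and nmet: "\<not> metabelian G"
    and E: "subgroup E G" "E \<noteq> {\<one>}"
    and q: "\<And>e. e \<in> E \<Longrightarrow> quad e" and off: "card (carrier V) \<le> j E"
  shows False
proof -
  interpret M: max_class_group G p n by fact
  let ?Z = "G.ucs"
  have EC: "\<And>e. e \<in> E \<Longrightarrow> e \<in> carrier G" using subgroup.mem_carrier[OF E(1)] .
  have ZC: "\<And>x i. x \<in> ?Z i \<Longrightarrow> x \<in> carrier G" using G.ucs_carrier by blast
  \<comment> \<open>An abelian normal subgroup of order at least p^(n-2) contains Z_(n-2) and thus
    the derived subgroup.\<close>
  have small: "b < n - 2" if B: "B \<lhd> G" "card B = p ^ b" and abB: "\<And>x y. x \<in> B \<Longrightarrow> y \<in> B \<Longrightarrow> x \<otimes> y = y \<otimes> x" for B b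
  proof (rule ccontr)
    assume "\<not> b < n - 2"
    then have "p ^ (n - 2) \<le> card B" unfolding B using G.p_gt_1 by (intro power_increasing) auto
    then have ZB: "?Z (n - 2) \<subseteq> B" using M.Z_sub_normal[OF B(1)] by simp
    have "derived_set G (carrier G) \<subseteq> ?Z (n - 2)"
    proof
      fix w assume "w \<in> derived_set G (carrier G)"
      then obtain g h where gh: "g \<in> carrier G" "h \<in> carrier G" "w = g \<otimes> h \<otimes> inv g \<otimes> inv h" by blast
      then have "w = comm_elt G (inv g) (inv h)" by (simp add: comm_elt_def)
      then show "w \<in> ?Z (n - 2)" using M.comm_in_Z gh by simp
    qed
    then have dZ: "derived G (carrier G) \<subseteq> ?Z (n - 2)"
      unfolding derived_def by (rule G.generate_subgroup_incl[OF _ G.ucs_subgroup])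
    have "x \<otimes> y = y \<otimes> x" if "x \<in> derived G (carrier G)" "y \<in> derived G (carrier G)" for x y
      using that dZ ZB abB by blast
    then have "metabelian G" unfolding metabelian_def
      by (intro group.group_comm_groupI[OF G.subgroup_imp_group[OF G.derived_is_subgroup]]) simp_all
    then show False using nmet by blast
  qed
  define ea where "ea = (\<lambda>i. elementary_abelian p G (?Z i))"
  have eaD: "a \<otimes> b = b \<otimes> a" if "ea i" "a \<in> ?Z i" "b \<in> ?Z i" for i a b
    using that unfolding ea_def G.elementary_abelian_iff by blast
  have ea_mono: "ea i" if "ea k" "i \<le> k" for i k
    using that G.ucs_mono[OF that(2)] G.ucs_subgroup[of i] unfolding ea_def G.elementary_abelian_iff by blast
  define k where "k = (GREATEST i. i \<le> n - 2 \<and> ea i)"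
  have ex: "0 \<le> n - 2 \<and> ea 0" unfolding ea_def G.elementary_abelian_iff using G.triv_subgroup by simp
  have k: "k \<le> n - 2 \<and> ea k" unfolding k_def by (rule GreatestI_nat[of _ 0 "n - 2"]) (use ex in auto)
  have kmax: "i \<le> k" if "i \<le> n - 2" "ea i" for i
    unfolding k_def by (rule Greatest_le_nat[of _ _ "n - 2"]) (use that in auto)
  have alpha: "x \<in> ?Z k" if "x \<in> centralizer G (?Z k)" "x [^] p = \<one>" for x
  proof (rule G.maximal_elementary_abelian_normal[OF p_odd G.ucs_normal _ _ that])
    show "elementary_abelian p G (?Z k)" using k unfolding ea_def by blast
    fix B assume B: "B \<lhd> G" "elementary_abelian p G B" "?Z k \<subseteq> B"
    have sB: "subgroup B G" using B(1) normal_imp_subgroup by blast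
    obtain b where b: "card B = p ^ b" using G.card_subgroup_pow[OF sB] .
    have "b < n - 2" by (rule small[OF B(1) b]) (use B(2) G.elementary_abelian_iff in blast)
    then have "B = ?Z b" "b \<le> n - 2" using M.normal_eq_Z[OF B(1) b] by auto
    then have "b \<le> k" using kmax B(2) unfolding ea_def by blast
    then show "B = ?Z k" using G.ucs_mono B(3) \<open>B = ?Z b\<close> by blast
  qed
  \<comment> \<open>r will be the lowest level with a non-trivial quadratic element, so Z_(r-1) can
    serve as \<open>W\<close> in \<open>quad_centralizes_abelian_normal\<close>.\<close>
  define P where "P = (\<lambda>r. \<exists>x\<in>?Z r. quad x \<and> x \<noteq> \<one>)"
  have "\<exists>e\<in>E. e \<noteq> \<one>" using E subgroup.one_closed[OF E(1)] by blast
  then have "P (n - 1)" unfolding P_def using q EC M.Z_top by blast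
  define r where "r = (LEAST r. P r)"
  have Pr: "P r" unfolding r_def by (rule LeastI) fact
  have noq: "e = \<one>" if "e \<in> ?Z i" "i < r" "quad e" for e i
    using that not_less_Least[of i P] unfolding r_def P_def by blast
  obtain x where x: "x \<in> ?Z r" "quad x" "x \<noteq> \<one>" using Pr unfolding P_def by blast
  have xC: "x \<in> carrier G" using x ZC by blast
  have Z1: "w \<otimes> g = g \<otimes> w" if "w \<in> ?Z 1" "g \<in> carrier G" for w g
    using G.ucs_comm[OF that] G.comm_elt_eq_one_iff[OF ZC[OF that(1)] that(2)] by simp
  \<comment> \<open>A quadratic element of Z_2 has central commutators, so it is central and
    trivial.\<close>
  have r3: "3 \<le> r"
  proof (rule ccontr)
    assume "\<not> 3 \<le> r"
    then have "x \<in> ?Z 2" using x(1) G.ucs_mono[of r 2] by auto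
    then have "x \<otimes> g = g \<otimes> x" if "g \<in> carrier G" for g
      using quad_comm_central[OF xC x(2) that] Z1 G.ucs_comm[of x 2 g] that by simp
    then show False using central_quad[OF xC _ x(2)] x(3) by blast
  qed
  have late: "a \<otimes> e = e \<otimes> a"
    if "ea i" "a \<in> ?Z i" "e \<in> carrier G" "quad e" "\<And>a. a \<in> ?Z i \<Longrightarrow> comm_elt G a e \<in> ?Z (r - 1)" for i a e
    by (rule quad_centralizes_abelian_normal[OF G.ucs_normal _ that(3,4,5) _ that(2)])
      (use eaD[OF that(1)] noq[of _ "r - 1"] r3 in auto)
  have "a \<otimes> x = x \<otimes> a" if "a \<in> ?Z k" for a
  proof (rule late[OF _ that xC x(2)])
    fix a assume "a \<in> ?Z k"
    then show "comm_elt G a x \<in> ?Z (r - 1)" using M.comm_flip[OF G.ucs_comm[OF x(1)] xC] ZC by blast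
  qed (use k in blast)
  then have "x \<in> centralizer G (?Z k)" unfolding centralizer_def using xC by auto
  then have xk: "x \<in> ?Z k" using alpha quad_order[OF x(2) xC] by blast
  have rk: "r \<le> k"
  proof (rule ccontr)
    assume "\<not> r \<le> k"
    then show False using noq[OF xk _ x(2)] x(3) by simp
  qed
  have ear: "ea r" using ea_mono k rk by blast
  have Er: "a \<otimes> e = e \<otimes> a" if "e \<in> E" "a \<in> ?Z r" for e a
    by (rule late[OF ear that(2) EC[OF that(1)] q[OF that(1)]]) (rule G.ucs_comm[OF _ EC[OF that(1)]])
  have rn: "r \<le> n - 2" using rk k by linarith
  have rp: "p - 1 \<le> r"
    by (rule normal_of_quads_card[OF G.ucs_normal _ x]) (use ear M.card_Z[OF rn] ea_def in auto)
  have kp: "k \<le> p"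
  proof (rule ccontr)
    assume "\<not> k \<le> p"
    then have "Suc p \<le> k" by simp
    then show False using M.elementary_abelian_Z_bound ea_mono[of k "Suc p"] k unfolding ea_def by auto
  qed
  \<comment> \<open>If \<open>E\<close> centralized Z_k, its elements, having p-th power one, would
    lie in Z_k by \<open>alpha\<close>, making \<open>E\<close> an offender in an abelian normal
    subgroup.\<close>
  have notall: "\<exists>e\<in>E. \<exists>a\<in>?Z k. a \<otimes> e \<noteq> e \<otimes> a"
  proof (rule ccontr)
    assume neg: "\<not> ?thesis"
    have "E \<subseteq> ?Z k"
    proof
      fix e assume e: "e \<in> E"
      then have "e \<in> centralizer G (?Z k)" unfolding centralizer_def using neg EC by force
      then show "e \<in> ?Z k" using alpha quad_order[OF q[OF e] EC[OF e]] by blast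
    qed
    then show False
      using no_offender_in_abelian_normal[OF G.ucs_normal _ E(1) _ E(2) off] eaD k by blast
  qed
  have "r \<noteq> k" using notall Er by blast
  then have rk': "r = p - 1" "k = p" using rk rp kp by auto
  \<comment> \<open>r >= 3 excludes p = 3; this makes p^(p-1) larger than p^3 at the end.\<close>
  have p5: "5 \<le> p" using r3 rk' p_odd by presburger
  have eak: "ea p" "p \<le> n - 2" using k rk' by auto
  obtain a where "a \<in> ?Z (Suc (p - 1))" "a \<notin> ?Z (p - 1)" by (rule M.Z_gap[of "p - 1"]) (use eak p5 in linarith)
  then have a: "a \<in> ?Z p" "a \<notin> ?Z r" using p5 rk' by auto
  have aC: "a \<in> carrier G" using a ZC by blast
  define \<theta> where "\<theta> = (\<lambda>e. comm_elt G a e)"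
  have \<theta>r: "\<theta> e \<in> ?Z r" if "e \<in> E" for e unfolding \<theta>_def rk' using G.ucs_comm[OF a(1) EC[OF that]] .
  have \<theta>mult: "\<theta> (e \<otimes> f) = \<theta> f \<otimes> \<theta> e" if ef: "e \<in> E" "f \<in> E" for e f
  proof -
    have "inv f \<otimes> \<theta> e \<otimes> f = \<theta> e" using Er[OF ef(2) \<theta>r[OF ef(1)]] ZC[OF \<theta>r[OF ef(1)]] EC[OF ef(2)] by (simp add: G.m_assoc)
    then show ?thesis unfolding \<theta>_def using ef EC aC by (simp add: G.comm_elt_mult_right)
  qed
  have \<theta>comm: "\<theta> e \<otimes> \<theta> f = \<theta> f \<otimes> \<theta> e" if "e \<in> E" "f \<in> E" for e f using eaD[OF ear] \<theta>r that by blast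
  have "group_hom (G\<lparr>carrier := E\<rparr>) G \<theta>"
    using G.subgroup_imp_group[OF E(1)] \<theta>mult \<theta>comm \<theta>r ZC
    by (auto simp: group_hom_def group_hom_axioms_def intro!: homI) blast
  then interpret \<theta>: group_hom "G\<lparr>carrier := E\<rparr>" G \<theta> .
  have sT: "subgroup (\<theta> ` E) G" using \<theta>.img_is_subgroup by simp
  have \<theta>q: "quad (\<theta> e)" if e: "e \<in> E" for e
  proof -
    have tC: "\<theta> e \<in> carrier G" using ZC \<theta>r[OF e] by blast
    have i: "inv (\<theta> e) = comm_elt G e a" unfolding \<theta>_def using aC EC[OF e] by (simp add: G.inv_comm_elt)
    have "\<theta> e \<in> ?Z p" using \<theta>r[OF e] G.ucs_mono[of r p] rk' by auto
    then have ta: "\<theta> e \<otimes> a = a \<otimes> \<theta> e" using eaD[OF eak(1)] a by blast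
    have "quad (inv (\<theta> e))"
      by (rule quad_comm_elt[OF EC[OF e] aC q[OF e] i])
        (use G.commute_inv[OF tC EC[OF e] Er[OF e \<theta>r[OF e]]] G.commute_inv[OF tC aC ta] in auto)
    then show ?thesis using quad_inv[of "inv (\<theta> e)"] tC by simp
  qed
  \<comment> \<open>A subgroup of quadratic elements meets Z_(r-1) trivially, so it fits into Z_i
    only beside Z_(r-1).\<close>
  have low: "card H * p ^ (r - 1) \<le> card (?Z i)"
    if H: "subgroup H G" "H \<subseteq> ?Z i" "\<And>h. h \<in> H \<Longrightarrow> quad h" and i: "r - 1 \<le> i" for H i
  proof -
    have "H \<inter> ?Z (r - 1) = {\<one>}"
      using noq[of _ "r - 1"] H(3) r3 subgroup.one_closed[OF H(1)] subgroup.one_closed[OF G.ucs_subgroup] by fastforce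
    then have "card (H <#> ?Z (r - 1)) = card H * card (?Z (r - 1))"
      using G.card_set_mult_Int[OF H(1) G.ucs_subgroup G.fin_subgroup[OF H(1)] G.fin_subgroup[OF G.ucs_subgroup], of "r - 1"] by simp
    moreover have "H <#> ?Z (r - 1) \<subseteq> ?Z i"
      unfolding set_mult_def using H(2) G.ucs_mono[OF i] subgroup.m_closed[OF G.ucs_subgroup] by blast
    then have "card (H <#> ?Z (r - 1)) \<le> card (?Z i)" using G.fin_subgroup[OF G.ucs_subgroup] by (simp add: card_mono)
    moreover have "card (?Z (r - 1)) = p ^ (r - 1)" using M.card_Z rn by simp
    ultimately show ?thesis by simp
  qed
  have c1: "card (\<theta> ` E) \<le> p"
  proof -
    have "card (\<theta> ` E) * p ^ (r - 1) \<le> p ^ r"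
      using low[OF sT, of r] \<theta>r \<theta>q M.card_Z[OF rn] by auto
    also have "p ^ r = p * p ^ (r - 1)" using r3 by (simp flip: power_Suc)
    finally show ?thesis using G.p_gt_1 by simp
  qed
  have sI: "subgroup (E \<inter> ?Z p) G" using G.subgroups_Inter_pair[OF E(1) G.ucs_subgroup] .
  have c2: "card (E \<inter> ?Z p) \<le> p * p"
  proof -
    have "card (E \<inter> ?Z p) * p ^ (r - 1) \<le> p ^ p"
      using low[OF sI, of p] q M.card_Z[OF eak(2)] rk' by auto
    also have "p ^ p = p * p * p ^ (r - 1)"
    proof -
      have "Suc (Suc (r - 1)) = p" using rk' p5 by simp
      then show ?thesis by (metis power_Suc mult.assoc)
    qed
    finally show ?thesis using G.p_gt_1 by simp
  qed
  \<comment> \<open>Two elements of \<open>E\<close> with equal image differ by an element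
    centralizing a and Z_r. These generate Z_p, so by \<open>alpha\<close> the difference lies in
    Z_p.\<close>
  have cE: "card E \<le> card (\<theta> ` E) * card (E \<inter> ?Z p)"
  proof (rule card_le_fibers[where f = \<theta>])
    show "finite E" "finite (\<theta> ` E)" using G.fin_subgroup[OF E(1)] by auto
    fix y
    show "card {e \<in> E. \<theta> e = y} \<le> card (E \<inter> ?Z p)"
    proof (cases "{e \<in> E. \<theta> e = y} = {}")
      case True
      show ?thesis unfolding True by simp
    next
      case False
      then obtain f where f: "f \<in> E" "\<theta> f = y" by blast
      have "e \<otimes> inv f \<in> E \<inter> ?Z p" if e: "e \<in> E" "\<theta> e = y" for e
      proof -
        let ?g = "e \<otimes> inv f"
        have gE: "?g \<in> E" using e f subgroup.m_closed[OF E(1)] subgroup.m_inv_closed[OF E(1)] by blast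
        have gC: "?g \<in> carrier G" using gE EC by blast
        have "\<theta> (?g \<otimes> f) = \<theta> f \<otimes> \<theta> ?g" using \<theta>mult gE f by blast
        moreover have "?g \<otimes> f = e" using e f EC by (simp add: G.m_assoc)
        ultimately have "\<theta> f = \<theta> f \<otimes> \<theta> ?g" using e f by simp
        then have "\<theta> ?g = \<one>" using ZC[OF \<theta>r[OF f(1)]] ZC[OF \<theta>r[OF gE]] by simp
        then have ag: "a \<otimes> ?g = ?g \<otimes> a" unfolding \<theta>_def using G.comm_elt_eq_one_iff[OF aC gC] by blast
        define T where "T = ?Z p \<inter> centralizer G {?g}"
        have sT': "subgroup T G" unfolding T_def
          using G.subgroups_Inter_pair[OF G.ucs_subgroup G.centralizer_subgroup] gC by blast
        have "?Z r \<subseteq> T" unfolding T_def centralizer_def using Er[OF gE] G.ucs_mono[of r p] rk' ZC by auto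
        moreover have "a \<in> T" unfolding T_def centralizer_def using ag a aC by auto
        ultimately have "?Z r \<subset> T" using a by blast
        then have "card (?Z r) * p \<le> card T" using G.card_proper_subgroup[OF G.ucs_subgroup sT'] by blast
        moreover have "card (?Z r) * p = card (?Z p)"
        proof -
          have "Suc r = p" using rk' p5 by simp
          then show ?thesis using M.card_Z[OF rn] M.card_Z[OF eak(2)] by (metis power_Suc2)
        qed
        ultimately have "T = ?Z p" using G.eq_if_card_le[OF G.ucs_subgroup, of T p] unfolding T_def by auto
        then have "b \<otimes> ?g = ?g \<otimes> b" if "b \<in> ?Z p" for b using that unfolding T_def centralizer_def by blast
        then have "?g \<in> centralizer G (?Z k)" unfolding centralizer_def rk' using gC by auto
        then have "?g \<in> ?Z p" using alpha quad_order[OF q[OF gE] gC] rk' by simp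
        then show ?thesis using gE by blast
      qed
      then show ?thesis
        using f EC by (intro card_inj_on_le[of "\<lambda>e. e \<otimes> inv f"]) (auto simp: inj_on_def G.fin_subgroup[OF sI])
    qed
  qed simp
  have "p ^ (p - 1) \<le> card E" using offender_card[OF E off] .
  also have "\<dots> \<le> p * (p * p)" using cE c1 c2 by (meson le_trans mult_le_mono)
  also have "\<dots> = p ^ 3" by (simp add: power3_eq_cube)
  finally have "p - 1 \<le> 3" using G.p_gt_1 power_le_imp_le_exp by blast
  then show False using p5 by linarith
qed

end

section \<open>The Oliver subgroup\<close>

context group
begin

lemma iter_comm_mono: "H \<subseteq> H' \<Longrightarrow> K \<subseteq> K' \<Longrightarrow> iter_comm G H K n \<subseteq> iter_comm G H' K' n"
proof (induction n)
  case (Suc n)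
  then show ?case unfolding iter_comm.simps comm_subgroup_def by (intro mono_generate) blast
qed simp

lemma iter_comm_subset_normal:
  assumes "W \<lhd> G" "H \<subseteq> W" "K \<subseteq> carrier G"
  shows "iter_comm G H K n \<subseteq> W"
proof (induction n)
  case (Suc n)
  have sub: "subgroup W G" using assms(1) normal_imp_subgroup by blast
  have "comm_elt G h k \<in> W" if "h \<in> iter_comm G H K n" "k \<in> K" for h k
    using normal_comm_elt[OF assms(1)] that Suc assms(3) subgroup.mem_carrier[OF sub] by blast
  then show ?case
    unfolding iter_comm.simps comm_subgroup_def by (intro generate_subgroup_incl[OF _ sub]) blast
qed (use assms in simp)

lemma iter_comm_trivial_mono:
  assumes "iter_comm G H K n \<subseteq> {\<one>}" "K \<subseteq> carrier G" "n \<le> m"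
  shows "iter_comm G H K m \<subseteq> {\<one>}"
  using assms(3)
proof (induction m rule: dec_induct)
  case (step m)
  have "comm_elt G h k = \<one>" if "h \<in> iter_comm G H K m" "k \<in> K" for h k
    proof -
    have "h = \<one>" "k \<in> carrier G" using that step.IH assms(2) by blast+
    then show ?thesis by simp
  qed
  then show ?case
    unfolding iter_comm.simps comm_subgroup_def by (intro generate_subgroup_incl[OF _ triv_subgroup]) blast
qed (use assms in simp)

text \<open>Since \<open>Q\<close> centralizes \<open>W\<close>, [w, qt] = [w, t] for every w in the
  iterated commutators, which stay in the normal subgroup \<open>W\<close>.\<close>

lemma iter_comm_set_mult:
  assumes W: "W \<lhd> G" and Q: "Q \<subseteq> carrier G" and T: "T \<subseteq> carrier G"
    and c: "\<And>w q. w \<in> W \<Longrightarrow> q \<in> Q \<Longrightarrow> w \<otimes> q = q \<otimes> w"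
  shows "iter_comm G W (Q <#> T) n \<subseteq> iter_comm G W T n"
proof (induction n)
  case (Suc n)
  have WC: "W \<subseteq> carrier G" using W normal_imp_subgroup subgroup.subset by blast
  have "comm_elt G w (q \<otimes> t) = comm_elt G w t" if "w \<in> iter_comm G W T n" "q \<in> Q" "t \<in> T" for w q t
  proof -
    have w: "w \<in> W" using that iter_comm_subset_normal[OF W subset_refl T] by blast
    then have C: "w \<in> carrier G" "q \<in> carrier G" "t \<in> carrier G" using that Q T WC by auto
    have "comm_elt G w q = \<one>" using c[OF w that(2)] comm_elt_eq_one_iff C by blast
    then show ?thesis using C by (simp add: comm_elt_mult_right)
  qed
  then have "{comm_elt G h k |h k. h \<in> iter_comm G W (Q <#> T) n \<and> k \<in> Q <#> T}
      \<subseteq> {comm_elt G h k |h k. h \<in> iter_comm G W T n \<and> k \<in> T}"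
    using Suc unfolding set_mult_def by blast
  then show ?case unfolding iter_comm.simps comm_subgroup_def by (rule mono_generate)
qed simp

lemma Omega1_mono: "P \<subseteq> P' \<Longrightarrow> Omega1 q G P \<subseteq> Omega1 q G P'"
  unfolding Omega1_def by (rule mono_generate) blast

lemma Omega1_subset: "subgroup P G \<Longrightarrow> Omega1 q G P \<subseteq> P"
  unfolding Omega1_def by (rule generate_subgroup_incl) auto

lemma Omega1_normal:
  assumes "P \<lhd> G" shows "Omega1 q G P \<lhd> G"
  unfolding Omega1_def
proof (rule normal_generateI)
  have sub: "subgroup P G" using assms normal_imp_subgroup by blast
  then show "{x \<in> P. x [^] q = \<one>} \<subseteq> carrier G" using subgroup.subset by blast
  fix x g assume x: "x \<in> {x \<in> P. x [^] q = \<one>}" and g: "g \<in> carrier G"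
  then have "x \<in> carrier G" using subgroup.mem_carrier[OF sub] by blast
  then have "(g \<otimes> x \<otimes> inv g) [^] q = \<one>" using conj_pow[of x "inv g" q] x g by simp
  then show "g \<otimes> x \<otimes> inv g \<in> {x \<in> P. x [^] q = \<one>}" using normal_conj(2)[OF assms] x g by blast
qed

lemma centralizer_antimono: "A \<subseteq> B \<Longrightarrow> centralizer G B \<subseteq> centralizer G A"
  unfolding centralizer_def by blast

end

lemma has_Q_seriesE:
  assumes "has_Q_series q G Q"
  obtains n :: nat and F :: "nat \<Rightarrow> _" where "n \<ge> 1" "F 0 = {\<one>\<^bsub>G\<^esub>}" "F n = Q" "\<And>i. i \<le> n \<Longrightarrow> F i \<lhd> G"
    "\<And>i. i \<in> {1..n} \<Longrightarrow> F (i - 1) \<subseteq> F i"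
    "\<And>i. i \<in> {1..n} \<Longrightarrow> iter_comm G (Omega1 q G (centralizer G (F (i - 1)))) (F i) (q - 1) = {\<one>\<^bsub>G\<^esub>}"
  using assms unfolding has_Q_series_def
proof (elim exE conjE, goal_cases)
  case (1 n F)
  show ?case by (rule that[of n F]) (use 1 in simp_all)
qed

context p_group
begin

text \<open>The series of \<open>Q\<close> is continued by the products of \<open>Q\<close> with the
  terms for \<open>R\<close>. In the second half the relevant centralizers lie in C(Q), so the
  factor \<open>Q\<close> contributes nothing to the commutators.\<close>

lemma has_Q_series_set_mult:
  assumes Q: "Q \<lhd> G" "has_Q_series p G Q" and R: "R \<lhd> G" "has_Q_series p G R"
  shows "has_Q_series p G (Q <#> R)"
proof (rule has_Q_seriesE[OF Q(2)], rule has_Q_seriesE[OF R(2)])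
  let ?O = "\<lambda>A. Omega1 p G (centralizer G A)"
  fix n m :: nat and F H :: "nat \<Rightarrow> 'a set"
  assume F: "n \<ge> 1" "F 0 = {\<one>}" "F n = Q" "\<And>i. i \<le> n \<Longrightarrow> F i \<lhd> G"
      "\<And>i. i \<in> {1..n} \<Longrightarrow> F (i - 1) \<subseteq> F i"
      "\<And>i. i \<in> {1..n} \<Longrightarrow> iter_comm G (?O (F (i - 1))) (F i) (p - 1) = {\<one>}"
  assume H: "m \<ge> 1" "H 0 = {\<one>}" "H m = R" "\<And>i. i \<le> m \<Longrightarrow> H i \<lhd> G"
      "\<And>i. i \<in> {1..m} \<Longrightarrow> H (i - 1) \<subseteq> H i"
      "\<And>i. i \<in> {1..m} \<Longrightarrow> iter_comm G (?O (H (i - 1))) (H i) (p - 1) = {\<one>}"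
  have QC: "Q \<subseteq> carrier G" using Q(1) normal_imp_subgroup subgroup.subset by blast
  have oQ: "\<one> \<in> Q" using Q(1) normal_imp_subgroup subgroup.one_closed by blast
  define K where "K i = (if i \<le> n then F i else Q <#> H (i - n))" for i
  have Q1: "Q <#> {\<one>} = Q" unfolding set_mult_def using QC by force
  have K2: "K i = Q <#> H (i - n)" if "n \<le> i" for i
    unfolding K_def using that F(3) H(2) Q1 by auto
  have Kn: "K i \<lhd> G" if "i \<le> n + m" for i
    unfolding K_def using F(4) normal_subgroup_set_mult_closed[OF Q(1)] H(4) that by auto
  have Ki: "K (i - 1) \<subseteq> K i \<and> iter_comm G (?O (K (i - 1))) (K i) (p - 1) = {\<one>}" if i: "i \<in> {1..n + m}" for i
  proof (cases "i \<le> n")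
    case True
    then show ?thesis unfolding K_def using F(5,6) i by auto
  next
    case False
    define l where "l = i - n"
    have l: "l \<in> {1..m}" "i - n = l" "i - 1 - n = l - 1" "n \<le> i - 1" "n \<le> i" unfolding l_def using False i by auto
    have Ke: "K i = Q <#> H l" "K (i - 1) = Q <#> H (l - 1)" using K2 l by auto
    have nH: "H l \<lhd> G" "H (l - 1) \<lhd> G" using H(4) l by auto
    have HC: "H l \<subseteq> carrier G" "H (l - 1) \<subseteq> carrier G" using nH normal_imp_subgroup subgroup.subset by blast+
    have oH: "\<one> \<in> H (l - 1)" using nH normal_imp_subgroup subgroup.one_closed by blast
    have s1: "Q \<subseteq> K (i - 1)" unfolding Ke set_mult_def using oH QC by force
    have s2: "H (l - 1) \<subseteq> K (i - 1)" unfolding Ke set_mult_def using oQ HC by force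
    have nK: "K (i - 1) \<lhd> G" using Kn[of "i - 1"] i by auto
    have nC: "centralizer G (K (i - 1)) \<lhd> G" using centralizer_normal[OF nK] .
    let ?W = "?O (K (i - 1))"
    have nW: "?W \<lhd> G" using Omega1_normal[OF nC] .
    have WC: "?W \<subseteq> centralizer G (K (i - 1))" using Omega1_subset nC normal_imp_subgroup by blast
    have "iter_comm G ?W (Q <#> H l) (p - 1) \<subseteq> iter_comm G ?W (H l) (p - 1)"
      by (rule iter_comm_set_mult[OF nW QC HC(1)]) (use WC s1 in \<open>auto simp: centralizer_def\<close>)
    also have "\<dots> \<subseteq> iter_comm G (?O (H (l - 1))) (H l) (p - 1)"
      by (intro iter_comm_mono Omega1_mono centralizer_antimono s2 subset_refl)
    also have "\<dots> = {\<one>}" using H(6) l by blast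
    finally have le: "iter_comm G ?W (K i) (p - 1) \<subseteq> {\<one>}" unfolding Ke .
    have "p - 1 = Suc (p - 2)" using p_gt_1 by simp
    then have "\<one> \<in> iter_comm G ?W (K i) (p - 1)" by (simp add: comm_subgroup_def generate.one)
    moreover have "K (i - 1) \<subseteq> K i" unfolding Ke set_mult_def using H(5) l(1) by blast
    ultimately show ?thesis using le by blast
  qed
  have "K 0 = {\<one>}" "K (n + m) = Q <#> R" unfolding K_def using F H by auto
  moreover have "n + m \<ge> 1" using F by simp
  ultimately show ?thesis
    unfolding has_Q_series_def using Kn Ki by (intro exI[of _ "n + m"] exI[of _ K] conjI ballI allI impI) auto
qed

text \<open>A maximal member of the family is the greatest one, because products of members are
  members. This justifies the use of \<open>GREATEST\<close>.\<close>

lemma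
  shows oliver_normal: "oliver_subgroup p G \<lhd> G"
    and oliver_has_Q_series: "has_Q_series p G (oliver_subgroup p G)"
    and oliver_greatest: "\<And>Q. Q \<lhd> G \<Longrightarrow> has_Q_series p G Q \<Longrightarrow> Q \<subseteq> oliver_subgroup p G"
proof -
  let ?P = "\<lambda>Q. Q \<lhd> G \<and> has_Q_series p G Q"
  have one: "?P {\<one>}"
  proof
    show "{\<one>} \<lhd> G" by (rule one_is_normal)
    have "p - 1 = Suc (p - 2)" using p_gt_1 by simp
    moreover have "iter_comm G A {\<one>} (Suc k) = {\<one>}" if "A \<lhd> G" for A k
    proof -
      have AC: "A \<subseteq> carrier G" using that normal_imp_subgroup subgroup.subset by blast
      have "iter_comm G A {\<one>} k \<subseteq> A" by (rule iter_comm_subset_normal[OF that]) auto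
      then have "iter_comm G A {\<one>} (Suc k) \<subseteq> {\<one>}"
        unfolding iter_comm.simps comm_subgroup_def using AC by (intro generate_subgroup_incl[OF _ triv_subgroup]) auto
      then show ?thesis by (auto simp: comm_subgroup_def generate.one)
    qed
    ultimately show "has_Q_series p G {\<one>}"
      unfolding has_Q_series_def using one_is_normal Omega1_normal[OF centralizer_normal[OF one_is_normal], of p]
      by (intro exI[of _ 1] exI[of _ "\<lambda>_. {\<one>}"]) simp
  qed
  have "finite {Q. ?P Q}"
  proof (rule finite_subset)
    show "{Q. ?P Q} \<subseteq> Pow (carrier G)" using normal_imp_subgroup subgroup.subset by blast
  qed (use fin in simp)
  then obtain M where M: "?P M" "\<And>Q. ?P Q \<Longrightarrow> M \<subseteq> Q \<Longrightarrow> M = Q"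
    using finite_has_maximal[of "{Q. ?P Q}"] one by blast
  have g: "Q \<subseteq> M" if Q: "?P Q" for Q
  proof -
    have C: "M \<subseteq> carrier G" "Q \<subseteq> carrier G" "\<one> \<in> M" "\<one> \<in> Q"
      using M(1) Q normal_imp_subgroup subgroup.subset subgroup.one_closed by blast+
    have s: "M \<subseteq> M <#> Q" "Q \<subseteq> M <#> Q" unfolding set_mult_def using C by force+
    have "?P (M <#> Q)" using has_Q_series_set_mult normal_subgroup_set_mult_closed M(1) Q by blast
    then have "M = M <#> Q" using M(2) s(1) by blast
    then show ?thesis using s(2) by blast
  qed
  have "oliver_subgroup p G = M"
    unfolding oliver_subgroup_def by (rule Greatest_equality) (use M(1) g in auto)
  then show "oliver_subgroup p G \<lhd> G" "has_Q_series p G (oliver_subgroup p G)"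
    "\<And>Q. Q \<lhd> G \<Longrightarrow> has_Q_series p G Q \<Longrightarrow> Q \<subseteq> oliver_subgroup p G" using M(1) g by auto
qed

text \<open>Appends \<open>Q\<close> to a series of the Oliver subgroup as one further term.\<close>

lemma oliver_maximal:
  assumes Q: "Q \<lhd> G" "oliver_subgroup p G \<subseteq> Q"
    and t: "iter_comm G (Omega1 p G (centralizer G (oliver_subgroup p G))) Q (p - 1) \<subseteq> {\<one>}"
  shows "Q \<subseteq> oliver_subgroup p G"
proof (rule oliver_greatest[OF Q(1)], rule has_Q_seriesE[OF oliver_has_Q_series])
  let ?O = "\<lambda>A. Omega1 p G (centralizer G A)"
  fix n :: nat and F :: "nat \<Rightarrow> 'a set"
  assume F: "n \<ge> 1" "F 0 = {\<one>}" "F n = oliver_subgroup p G" "\<And>i. i \<le> n \<Longrightarrow> F i \<lhd> G"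
      "\<And>i. i \<in> {1..n} \<Longrightarrow> F (i - 1) \<subseteq> F i"
      "\<And>i. i \<in> {1..n} \<Longrightarrow> iter_comm G (?O (F (i - 1))) (F i) (p - 1) = {\<one>}"
  define K where "K i = (if i \<le> n then F i else Q)" for i
  have "p - 1 = Suc (p - 2)" using p_gt_1 by simp
  then have "\<one> \<in> iter_comm G (?O (F n)) Q (p - 1)" by (simp add: comm_subgroup_def generate.one)
  then have t': "iter_comm G (?O (F n)) Q (p - 1) = {\<one>}" using t F(3) by auto
  have "K (i - 1) \<subseteq> K i \<and> iter_comm G (?O (K (i - 1))) (K i) (p - 1) = {\<one>}" if i: "i \<in> {1..Suc n}" for i
  proof (cases "i \<le> n")
    case True
    then show ?thesis unfolding K_def using F(5,6) i by auto
  next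
    case False
    then have "i = Suc n" using i by auto
    then show ?thesis unfolding K_def using t' Q(2) F(3) by simp
  qed
  moreover have "K 0 = {\<one>}" "K (Suc n) = Q" unfolding K_def using F by auto
  moreover have "K i \<lhd> G" if "i \<le> Suc n" for i unfolding K_def using F(4) Q(1) by auto
  ultimately show "has_Q_series p G Q"
    unfolding has_Q_series_def by (intro exI[of _ "Suc n"] exI[of _ K] conjI ballI allI impI) auto
qed

end

section \<open>Ranks of elementary abelian subgroups expressed by orders\<close>

lemma (in vectorspace) card_carrier_eq_power_dim:
  assumes "finite (carrier V)" shows "card (carrier V) = card (carrier K) ^ dim"
proof -
  have "span (carrier V) = carrier V"
    using in_own_span[of "carrier V"] span_is_subset2[of "carrier V"] by blast
  then have "fin_dim" unfolding fin_dim_def using assms by blast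
  then obtain B where B: "finite B" "basis B" using finite_basis_exists by blast
  then have BV: "B \<subseteq> carrier V" unfolding basis_def by blast
  have "bij_betw (\<lambda>a. lincomb a B) (B \<rightarrow>\<^sub>E carrier K) (carrier V)"
    unfolding bij_betw_def
  proof
    have u: "\<exists>!a. a \<in> B \<rightarrow>\<^sub>E carrier K \<and> lincomb a B = v" if "v \<in> carrier V" for v
      using basis_criterion[OF B(1) BV] B(2) that by blast
    have c: "lincomb a B \<in> carrier V" if "a \<in> B \<rightarrow>\<^sub>E carrier K" for a
      using that BV by (intro lincomb_closed) (auto simp: PiE_def)
    show "inj_on (\<lambda>a. lincomb a B) (B \<rightarrow>\<^sub>E carrier K)"
    proof (rule inj_onI)
      fix a b assume "a \<in> B \<rightarrow>\<^sub>E carrier K" "b \<in> B \<rightarrow>\<^sub>E carrier K" "lincomb a B = lincomb b B"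
      then show "a = b" using u[OF c[of a]] by metis
    qed
    show "(\<lambda>a. lincomb a B) ` (B \<rightarrow>\<^sub>E carrier K) = carrier V"
    proof
      show "(\<lambda>a. lincomb a B) ` (B \<rightarrow>\<^sub>E carrier K) \<subseteq> carrier V" using c by blast
      show "carrier V \<subseteq> (\<lambda>a. lincomb a B) ` (B \<rightarrow>\<^sub>E carrier K)"
      proof
        fix v assume "v \<in> carrier V"
        then show "v \<in> (\<lambda>a. lincomb a B) ` (B \<rightarrow>\<^sub>E carrier K)" using u[of v] by blast
      qed
    qed
  qed
  then have "card (carrier V) = card (B \<rightarrow>\<^sub>E carrier K)" by (metis bij_betw_same_card)
  then show ?thesis using B by (simp add: card_PiE dim_basis)
qed

lemma (in p_group) card_eq_power_elab_rank:
  assumes E: "elementary_abelian p G E" shows "card E = p ^ elab_rank p G E"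
proof -
  interpret E: vectorspace "residue_ring (int p)" "F_p_space G E"
    using vectorspace_F_p_space[OF is_group p E] .
  have c: "carrier (F_p_space G E) = E" by (simp add: F_p_space_def)
  have "finite E" using E fin_subgroup unfolding elementary_abelian_iff by blast
  moreover have "card (carrier (residue_ring (int p))) = p" using p_gt_1 by (simp add: residue_ring_def)
  ultimately show ?thesis using E.card_carrier_eq_power_dim unfolding elab_rank_def c by simp
qed

section \<open>The quotient by the Oliver subgroup\<close>

locale odd_p_group = p_group + assumes p_odd: "odd p"
begin

abbreviation Ol where "Ol \<equiv> oliver_subgroup p G"
abbreviation C where "C \<equiv> centralizer G Ol"
abbreviation V where "V \<equiv> Omega1 p G C"

lemma p_ge_3: "p \<ge> 3" using p_odd p_gt_1 by presburger

lemma Ol_subgroup: "subgroup Ol G" using oliver_normal normal_imp_subgroup by blast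
lemma Ol_carrier: "x \<in> Ol \<Longrightarrow> x \<in> carrier G" using Ol_subgroup by (rule subgroup.mem_carrier)
lemma C_normal: "C \<lhd> G" using centralizer_normal[OF oliver_normal] .
lemma C_subgroup: "subgroup C G" using C_normal normal_imp_subgroup by blast
lemma C_carrier: "x \<in> C \<Longrightarrow> x \<in> carrier G" using C_subgroup by (rule subgroup.mem_carrier)
lemma C_comm: "c \<in> C \<Longrightarrow> x \<in> Ol \<Longrightarrow> c \<otimes> x = x \<otimes> c" unfolding centralizer_def by blast
lemma V_normal: "V \<lhd> G" using Omega1_normal[OF C_normal] .
lemma V_subgroup: "subgroup V G" using V_normal normal_imp_subgroup by blast
lemma V_subset_C: "V \<subseteq> C" using Omega1_subset[OF C_subgroup] .
lemma V_carrier: "v \<in> V \<Longrightarrow> v \<in> carrier G" using V_subgroup by (rule subgroup.mem_carrier)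

text \<open>Let \<open>T\<close> be the part of \<open>C\<close> that is central modulo X. Then
  [V, T] <= X, and T centralizes X, so [V, T; 2] = 1 with 2 <= p - 1. The factor X of XT does not
  matter because it centralizes V. So T <= X, whereas \<open>C\<close> outside X would give T
  outside X.\<close>

lemma centralizer_oliver_subset: "C \<subseteq> Ol"
proof (rule ccontr)
  assume "\<not> C \<subseteq> Ol"
  then obtain n where n: "n \<in> C" "n \<notin> Ol" "\<And>g. g \<in> carrier G \<Longrightarrow> comm_elt G n g \<in> Ol"
    using central_step[OF oliver_normal C_normal] by blast
  define T where "T = C \<inter> {g \<in> carrier G. \<forall>h\<in>carrier G. comm_elt G g h \<in> Ol}"
  have nT: "T \<lhd> G" unfolding T_def using normal_subgroup_intersect[OF C_normal central_over_normal[OF oliver_normal]] .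
  have TC: "T \<subseteq> carrier G" unfolding T_def by blast
  have OC: "Ol \<subseteq> carrier G" using Ol_carrier by blast
  have o: "\<one> \<in> Ol" "\<one> \<in> T" using subgroup.one_closed Ol_subgroup nT normal_imp_subgroup by blast+
  have nQ: "Ol <#> T \<lhd> G" using normal_subgroup_set_mult_closed[OF oliver_normal nT] .
  have s: "Ol \<subseteq> Ol <#> T" "T \<subseteq> Ol <#> T" unfolding set_mult_def using o TC OC by force+
  have 1: "iter_comm G V T 1 \<subseteq> Ol"
    unfolding One_nat_def iter_comm.simps comm_subgroup_def
  proof (rule generate_subgroup_incl[OF _ Ol_subgroup], safe)
    fix v t assume v: "v \<in> V" and t: "t \<in> T"
    have "comm_elt G t v \<in> Ol" using t V_carrier[OF v] unfolding T_def by blast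
    then show "comm_elt G v t \<in> Ol"
      using normal_comm_elt_subst(3)[OF oliver_normal, of t v v] V_carrier[OF v] t TC by blast
  qed
  have "comm_elt G h t = \<one>" if "h \<in> iter_comm G V T 1" "t \<in> T" for h t
  proof -
    have h: "h \<in> Ol" "t \<in> C" using that 1 unfolding T_def by auto
    then have "h \<otimes> t = t \<otimes> h" using C_comm by metis
    then show ?thesis using comm_elt_eq_one_iff Ol_carrier C_carrier h by blast
  qed
  then have "iter_comm G V T 2 \<subseteq> {\<one>}"
    unfolding numeral_2_eq_2 iter_comm.simps(2)[of _ _ _ "Suc 0"] comm_subgroup_def
    by (intro generate_subgroup_incl[OF _ triv_subgroup]) auto
  moreover have "2 \<le> p - 1" using p_ge_3 by simp
  ultimately have "iter_comm G V T (p - 1) \<subseteq> {\<one>}" by (rule iter_comm_trivial_mono[OF _ TC])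
  moreover have "iter_comm G V (Ol <#> T) (p - 1) \<subseteq> iter_comm G V T (p - 1)"
    using iter_comm_set_mult[OF V_normal OC TC] C_comm V_subset_C by blast
  ultimately have "Ol <#> T \<subseteq> Ol" using oliver_maximal[OF nQ s(1)] by blast
  moreover have "n \<in> T" unfolding T_def using n C_carrier by blast
  ultimately show False using n s(2) by blast
qed

text \<open>\<open>C\<close> is abelian because it lies in X and centralizes X; its elements with
  p-th power one already form a subgroup.\<close>

lemma V_eq: "V = {x \<in> C. x [^] p = \<one>}"
proof
  have ab: "a \<otimes> b = b \<otimes> a" if "a \<in> C" "b \<in> C" for a b using that C_comm centralizer_oliver_subset by blast
  have "subgroup {x \<in> C. x [^] p = \<one>} G"
  proof (rule subgroupI)
    show "{x \<in> C. x [^] p = \<one>} \<noteq> {}" using subgroup.one_closed[OF C_subgroup] by force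
    fix a assume a: "a \<in> {x \<in> C. x [^] p = \<one>}"
    then show "inv a \<in> {x \<in> C. x [^] p = \<one>}"
      using subgroup.m_inv_closed[OF C_subgroup] C_carrier[of a] by (simp add: nat_pow_inv)
    fix b assume b: "b \<in> {x \<in> C. x [^] p = \<one>}"
    have "(a \<otimes> b) [^] p = a [^] p \<otimes> b [^] p"
      by (rule pow_mult_distrib) (use a b ab C_carrier in auto)
    then show "a \<otimes> b \<in> {x \<in> C. x [^] p = \<one>}" using a b subgroup.m_closed[OF C_subgroup] by simp
  qed (use C_carrier in blast)
  then show "V \<subseteq> {x \<in> C. x [^] p = \<one>}" unfolding Omega1_def by (rule generate_subgroup_incl[OF subset_refl])
  show "{x \<in> C. x [^] p = \<one>} \<subseteq> V" unfolding Omega1_def by (auto intro: generate.incl)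
qed

lemma V_comm: "v \<in> V \<Longrightarrow> w \<in> V \<Longrightarrow> v \<otimes> w = w \<otimes> v"
  using V_subset_C centralizer_oliver_subset C_comm by blast

lemma V_elementary_abelian: "elementary_abelian p G V"
  unfolding elementary_abelian_iff using V_subgroup V_comm V_eq by blast

text \<open>[V, C_S(V)] = 1, so C_S(V) can be appended to a series of X. This is the faithfulness of
  the action on \<open>V\<close>.\<close>

lemma centralizer_V: "centralizer G V = Ol"
proof
  show s: "Ol \<subseteq> centralizer G V" using C_comm V_subset_C Ol_carrier unfolding centralizer_def by fastforce
  have n: "centralizer G V \<lhd> G" using centralizer_normal[OF V_normal] .
  have "comm_elt G v q = \<one>" if "v \<in> V" "q \<in> centralizer G V" for v q
    using that comm_elt_eq_one_iff[of v q] V_carrier unfolding centralizer_def by auto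
  then have "iter_comm G V (centralizer G V) 1 \<subseteq> {\<one>}"
    unfolding One_nat_def iter_comm.simps comm_subgroup_def
    by (intro generate_subgroup_incl[OF _ triv_subgroup]) auto
  then have "iter_comm G V (centralizer G V) (p - 1) \<subseteq> {\<one>}"
    by (rule iter_comm_trivial_mono) (use p_ge_3 centralizer_def[of G V] in auto)
  then show "centralizer G V \<subseteq> Ol" using oliver_maximal[OF n s] by blast
qed

abbreviation H where "H \<equiv> G Mod Ol"

text \<open>Conjugation by an arbitrary representative of the coset; the choice is immaterial since
  X centralizes \<open>V\<close>, see \<open>act_coset\<close>.\<close>

definition act :: "'a set \<Rightarrow> 'a \<Rightarrow> 'a" where
  "act A v = (let g = SOME g. g \<in> A in g \<otimes> v \<otimes> inv g)"

lemma conj_V: "g \<in> carrier G \<Longrightarrow> v \<in> V \<Longrightarrow> g \<otimes> v \<otimes> inv g \<in> V"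
  using normal_conj(2)[OF V_normal] by blast

lemma act_coset:
  assumes g: "g \<in> carrier G" and v: "v \<in> V" shows "act (Ol #> g) v = g \<otimes> v \<otimes> inv g"
proof -
  define h where "h = (SOME h. h \<in> Ol #> g)"
  have "h \<in> Ol #> g" unfolding h_def by (rule someI[of _ g]) (rule rcos_self[OF g Ol_subgroup])
  then obtain x where x: "x \<in> Ol" "h = x \<otimes> g" unfolding r_coset_def by blast
  have xC: "x \<in> carrier G" "v \<in> carrier G" using x Ol_carrier V_carrier v by auto
  have w: "g \<otimes> v \<otimes> inv g \<in> C" using conj_V[OF g v] V_subset_C by blast
  have "h \<otimes> v \<otimes> inv h = (x \<otimes> (g \<otimes> v \<otimes> inv g)) \<otimes> inv x" using x xC g by (simp add: m_assoc inv_mult_group)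
  also have "x \<otimes> (g \<otimes> v \<otimes> inv g) = (g \<otimes> v \<otimes> inv g) \<otimes> x" using C_comm[OF w x(1)] by simp
  finally show ?thesis unfolding act_def h_def[symmetric] Let_def using xC g by (simp add: m_assoc)
qed

lemma coset_cases:
  assumes "A \<in> carrier H" obtains g where "g \<in> carrier G" "A = Ol #> g"
  using assms unfolding FactGroup_def RCOSETS_def by auto

lemma coset_closed [simp]: "g \<in> carrier G \<Longrightarrow> Ol #> g \<in> carrier H"
  unfolding FactGroup_def RCOSETS_def by auto

lemma coset_mult [simp]: "g \<in> carrier G \<Longrightarrow> h \<in> carrier G \<Longrightarrow> (Ol #> g) \<otimes>\<^bsub>H\<^esub> (Ol #> h) = Ol #> (g \<otimes> h)"
  using normal.rcos_sum[OF oliver_normal] by simp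

lemma coset_eq_one_iff: "g \<in> carrier G \<Longrightarrow> Ol #> g = \<one>\<^bsub>H\<^esub> \<longleftrightarrow> g \<in> Ol"
  using coset_join1[of Ol g] coset_join2[OF _ Ol_subgroup, of g] Ol_subgroup Ol_carrier by auto

lemma H_p_group: "p_group H p"
proof -
  have "group H" using normal.factorgroup_is_group[OF oliver_normal] .
  moreover have "\<exists>n. order H = p ^ n"
  proof -
    obtain n where n: "order G = p ^ n" using order_pow by blast
    have "card (rcosets Ol) * card Ol = p ^ n" using lagrange[OF Ol_subgroup] n by simp
    then have "card (rcosets Ol) dvd p ^ n" by (metis dvd_triv_left)
    then show ?thesis using divides_primepow_nat[OF p] unfolding order_def FactGroup_def by auto
  qed
  ultimately show ?thesis using p unfolding p_group_def p_group_axioms_def by blast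
qed

sublocale M: p_module H p "G\<lparr>carrier := V\<rparr>" act
proof -
  interpret H: p_group H p by (rule H_p_group)
  have cgr: "comm_group (G\<lparr>carrier := V\<rparr>)" using V_elementary_abelian unfolding elementary_abelian_def by blast
  show "p_module H p (G\<lparr>carrier := V\<rparr>) act"
  proof (intro p_module.intro p_module_axioms.intro H_p_group cgr p_odd, goal_cases)
    case 1
    obtain m where "card V = p ^ m" using card_subgroup_pow[OF V_subgroup] .
    then show ?case by (auto simp: order_def)
  next
    case (2 v)
    then show ?case using V_eq nat_pow_consistent[of v p V] by auto
  next
    case (3 A)
    then obtain g where g: "g \<in> carrier G" "A = Ol #> g" using coset_cases by blast
    show ?case
      by (rule homI) (use g conj_V V_carrier subgroup.m_closed[OF V_subgroup] in \<open>auto simp: act_coset m_assoc\<close>)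
  next
    case (4 v)
    have "\<one>\<^bsub>H\<^esub> = Ol #> \<one>" using coset_eq_one_iff[of \<one>] subgroup.one_closed[OF Ol_subgroup] by auto
    then show ?case using 4 act_coset[of \<one> v] V_carrier[of v] by simp
  next
    case (5 A B v)
    then obtain g h where g: "g \<in> carrier G" "A = Ol #> g" "h \<in> carrier G" "B = Ol #> h" by (meson coset_cases)
    have v: "v \<in> V" "v \<in> carrier G" using 5 V_carrier by auto
    show ?case using g v conj_V[OF g(3) v(1)] by (simp add: act_coset inv_mult_group m_assoc del: mult_FactGroup)
  next
    case (6 A)
    then obtain g where g: "g \<in> carrier G" "A = Ol #> g" using coset_cases by blast
    have "g \<otimes> v = v \<otimes> g" if v: "v \<in> V" for v
    proof -
      have "g \<otimes> v \<otimes> inv g = v" using 6(2)[of v] v g act_coset by simp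
      then have "g \<otimes> v \<otimes> inv g \<otimes> g = v \<otimes> g" by simp
      then show ?thesis using g V_carrier[OF v] by (simp add: m_assoc)
    qed
    then have "g \<in> Ol" using g centralizer_V unfolding centralizer_def by blast
    then show ?case using coset_eq_one_iff g by blast
  qed
qed

end

section \<open>Powers of central elements and offenders in the quotient\<close>

context p_module
begin

text \<open>The operator z^l - 1 is a multiple of z - 1 by an operator commuting with it.\<close>

lemma dl_pow_funpow:
  assumes z: "z \<in> carrier G" and w: "w \<in> carrier V"
  obtains u where "u \<in> carrier V" "dl (z [^] (l::nat)) ((dl z ^^ n) w) = (dl z ^^ Suc n) u"
proof -
  have "\<exists>u\<in>carrier V. dl (z [^] l) ((dl z ^^ n) w) = (dl z ^^ Suc n) u"
  proof (induction l)
    case 0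
    have "dl (z [^] (0::nat)) ((dl z ^^ n) w) = (dl z ^^ Suc n) \<epsilon>" using z w by (simp add: dl_def del: funpow.simps)
    then show ?case using V.one_closed by blast
  next
    case (Suc l)
    then obtain u where u: "u \<in> carrier V" "dl (z [^] l) ((dl z ^^ n) w) = (dl z ^^ Suc n) u" by blast
    have c: "z \<otimes> z [^] l = z [^] l \<otimes> z" using z G.nat_pow_comm[of z 1 l] by simp
    have a: "\<rho> (z [^] l) w \<in> carrier V" using z w by simp
    have "dl (z [^] Suc l) ((dl z ^^ n) w) = \<rho> (z [^] l) ((dl z ^^ Suc n) w) \<star> (dl z ^^ Suc n) u"
      using z w u by (simp add: dl_mult)
    also have "\<dots> = (dl z ^^ Suc n) (\<rho> (z [^] l) w \<star> u)"
      using act_dl_funpow[OF z _ c w, of "Suc n"] dl_funpow_vmult[OF z a u(1), of "Suc n"] z by (simp del: funpow.simps)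
    finally show ?case using a u(1) V.m_closed by blast
  qed
  then show ?thesis using that by blast
qed

end

context odd_p_group
begin

lemma coset_one: "Ol #> \<one> = \<one>\<^bsub>H\<^esub>"
  using coset_eq_one_iff[of \<one>] subgroup.one_closed[OF Ol_subgroup] by simp

lemma coset_inv: "h \<in> carrier G \<Longrightarrow> inv\<^bsub>H\<^esub> (Ol #> h) = Ol #> inv h"
  by (rule M.G.inv_equality) (simp_all add: coset_one del: mult_FactGroup)

text \<open>The preimage \<open>Q\<close> of the subgroup generated by z is normal since z is
  central, and [V, Q; i] lies in (z - 1)^i V. If (z - 1)^(p-1) = 0, then \<open>Q\<close> is
  contained in X.\<close>

lemma central_power_acts:
  assumes z: "z \<in> carrier H" and c: "\<And>A. A \<in> carrier H \<Longrightarrow> z \<otimes>\<^bsub>H\<^esub> A = A \<otimes>\<^bsub>H\<^esub> z"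
    and nil: "\<And>v. v \<in> V \<Longrightarrow> (M.dl z ^^ (p - 1)) v = \<one>"
  shows "z = \<one>\<^bsub>H\<^esub>"
proof -
  obtain g where g: "g \<in> carrier G" "z = Ol #> g" using coset_cases[OF z] .
  define Q where "Q = {h \<in> carrier G. \<exists>l::nat. Ol #> h = z [^]\<^bsub>H\<^esub> l}"
  have sQ: "subgroup Q G"
  proof (rule subgroupI)
    have "Ol #> \<one> = z [^]\<^bsub>H\<^esub> (0::nat)" using coset_one by simp
    then show "Q \<noteq> {}" unfolding Q_def by blast
    fix a assume a: "a \<in> Q"
    then obtain k :: nat where k: "a \<in> carrier G" "Ol #> a = z [^]\<^bsub>H\<^esub> k" unfolding Q_def by blast
    let ?y = "z [^]\<^bsub>H\<^esub> k"
    have y: "?y \<in> carrier H" using z by simp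
    \<comment> \<open>\<open>Q\<close> is described by non-negative powers only, so the inverse of y
      is produced as its power with exponent |H| - 1.\<close>
    have "order H = Suc (order H - 1)" using M.G.fin M.G.order_gt_0_iff_finite by simp
    then have "?y [^]\<^bsub>H\<^esub> (order H - 1) \<otimes>\<^bsub>H\<^esub> ?y = \<one>\<^bsub>H\<^esub>"
      using M.G.pow_order_eq_1[OF y] M.G.nat_pow_Suc by metis
    then have "inv\<^bsub>H\<^esub> ?y = z [^]\<^bsub>H\<^esub> (k * (order H - 1))"
      using M.G.inv_equality[of "?y [^]\<^bsub>H\<^esub> (order H - 1)" ?y] y z by (simp add: M.G.nat_pow_pow)
    then show "inv a \<in> Q" unfolding Q_def using coset_inv[OF k(1)] k by auto
    fix b assume "b \<in> Q"
    then obtain l :: nat where l: "b \<in> carrier G" "Ol #> b = z [^]\<^bsub>H\<^esub> l" unfolding Q_def by blast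
    have "Ol #> (a \<otimes> b) = z [^]\<^bsub>H\<^esub> (k + l)"
      using coset_mult[OF k(1) l(1)] k l M.G.nat_pow_mult[OF z] by simp
    then show "a \<otimes> b \<in> Q" unfolding Q_def using k l by blast
  qed (auto simp: Q_def)
  have "Q \<lhd> G"
  proof (rule normalI'[OF sQ])
    fix h x assume h: "h \<in> Q" and x: "x \<in> carrier G"
    obtain l :: nat where l: "h \<in> carrier G" "Ol #> h = z [^]\<^bsub>H\<^esub> l" using h unfolding Q_def by blast
    have xc: "Ol #> x \<in> carrier H" using x by simp
    have "z [^]\<^bsub>H\<^esub> l \<otimes>\<^bsub>H\<^esub> (Ol #> x) = (Ol #> x) \<otimes>\<^bsub>H\<^esub> z [^]\<^bsub>H\<^esub> l"
      by (rule M.G.group_commutes_pow[OF c[OF xc] z xc])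
    then have "(Ol #> inv x) \<otimes>\<^bsub>H\<^esub> (Ol #> h) \<otimes>\<^bsub>H\<^esub> (Ol #> x) = (Ol #> inv x) \<otimes>\<^bsub>H\<^esub> (Ol #> x) \<otimes>\<^bsub>H\<^esub> z [^]\<^bsub>H\<^esub> l"
      unfolding l(2) using z xc x by (simp add: M.G.m_assoc del: mult_FactGroup coset_mult)
    then have "Ol #> (inv x \<otimes> h \<otimes> x) = z [^]\<^bsub>H\<^esub> l"
      using x l(1) z by (simp add: coset_one del: mult_FactGroup one_FactGroup)
    then show "inv x \<otimes> h \<otimes> x \<in> Q" unfolding Q_def using x l by blast
  qed
  \<comment> \<open>On \<open>V\<close> the commutator [v, h] is the value of h^-1 - 1 at v, and
    h^-1 acts as a power of z; so each commutator with \<open>Q\<close> gains a factor z -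
    1.\<close>
  have it: "iter_comm G V Q n \<subseteq> (M.dl z ^^ n) ` V" for n
  proof (induction n)
    case (Suc n)
    interpret h: group_hom "G\<lparr>carrier := V\<rparr>" "G\<lparr>carrier := V\<rparr>" "M.dl z ^^ Suc n"
    proof (unfold group_hom_def group_hom_axioms_def, intro conjI homI)
      show "(M.dl z ^^ Suc n) x \<in> carrier (G\<lparr>carrier := V\<rparr>)" if "x \<in> carrier (G\<lparr>carrier := V\<rparr>)" for x
        by (rule M.dl_funpow_closed[OF z that])
      show "(M.dl z ^^ Suc n) (x \<otimes>\<^bsub>G\<lparr>carrier := V\<rparr>\<^esub> y) = (M.dl z ^^ Suc n) x \<otimes>\<^bsub>G\<lparr>carrier := V\<rparr>\<^esub> (M.dl z ^^ Suc n) y"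
        if "x \<in> carrier (G\<lparr>carrier := V\<rparr>)" "y \<in> carrier (G\<lparr>carrier := V\<rparr>)" for x y
        by (rule M.dl_funpow_vmult[OF z that])
    qed (rule M.V.is_group)+
    have sI: "subgroup ((M.dl z ^^ Suc n) ` V) G"
      using incl_subgroup[OF V_subgroup] h.img_is_subgroup by simp
    have "comm_elt G v h \<in> (M.dl z ^^ Suc n) ` V" if v: "v \<in> iter_comm G V Q n" and h: "h \<in> Q" for v h
    proof -
      obtain w where w: "w \<in> V" "v = (M.dl z ^^ n) w" using Suc v by blast
      have vV: "v \<in> V" using M.dl_funpow_closed[OF z, of w n] w by simp
      have hC: "h \<in> carrier G" "v \<in> carrier G" using h vV V_carrier unfolding Q_def by auto
      obtain l :: nat where l: "Ol #> inv h = z [^]\<^bsub>H\<^esub> l"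
        using subgroup.m_inv_closed[OF sQ h] unfolding Q_def by blast
      have c1: "inv h \<otimes> v \<otimes> h \<in> V" using conj_V[of "inv h" v] hC vV by simp
      have "M.dl (Ol #> inv h) v = inv h \<otimes> v \<otimes> h \<otimes> inv v"
        unfolding M.dl_def using act_coset[of "inv h" v] hC vV m_inv_consistent[OF V_subgroup vV] by simp
      also have "\<dots> = inv v \<otimes> (inv h \<otimes> v \<otimes> h)" using V_comm[OF c1] subgroup.m_inv_closed[OF V_subgroup vV] by simp
      also have "\<dots> = comm_elt G v h" using hC by (simp add: word_simps)
      finally have e: "comm_elt G v h = M.dl (z [^]\<^bsub>H\<^esub> l) ((M.dl z ^^ n) w)" unfolding l w(2) by simp
      obtain u where "u \<in> V" "M.dl (z [^]\<^bsub>H\<^esub> l) ((M.dl z ^^ n) w) = (M.dl z ^^ Suc n) u"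
        using M.dl_pow_funpow[OF z, of w l n] w(1) by auto
      then show ?thesis unfolding e by blast
    qed
    then show ?case
      unfolding iter_comm.simps comm_subgroup_def by (intro generate_subgroup_incl[OF _ sI]) blast
  qed simp
  have "Ol #> h = z [^]\<^bsub>H\<^esub> (0::nat)" if "h \<in> Ol" for h using coset_eq_one_iff[OF Ol_carrier[OF that]] that by simp
  then have "Ol \<subseteq> Q" unfolding Q_def using Ol_carrier by blast
  moreover have "iter_comm G V Q (p - 1) \<subseteq> {\<one>}" using it[of "p - 1"] nil by blast
  ultimately have "Q \<subseteq> Ol" using oliver_maximal[OF \<open>Q \<lhd> G\<close>] by blast
  moreover have "Ol #> g = z [^]\<^bsub>H\<^esub> (1::nat)" unfolding M.G.nat_pow_eone[OF z] using g(2) by (rule sym)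
  then have "g \<in> Q" unfolding Q_def using g(1) by blast
  ultimately show ?thesis using coset_eq_one_iff g by blast
qed

sublocale M: ps_module H p "G\<lparr>carrier := V\<rparr>" act
proof
  fix z assume "z \<in> carrier H" "\<And>g. g \<in> carrier H \<Longrightarrow> z \<otimes>\<^bsub>H\<^esub> g = g \<otimes>\<^bsub>H\<^esub> z" "z \<noteq> \<one>\<^bsub>H\<^esub>"
  then show "\<exists>v\<in>carrier (G\<lparr>carrier := V\<rparr>). (M.dl z ^^ (p - 1)) v \<noteq> \<one>\<^bsub>G\<lparr>carrier := V\<rparr>\<^esub>"
    using central_power_acts by auto
qed

text \<open>With B = A \<inter> X the product BV is elementary abelian, so |BV| <= |A|, and B
  \<inter> V is fixed by \<open>A\<close>. Hence |B| |V| = |BV| |B \<inter> V| <= |A| |C_V(A)| <=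
  |B| |E| |C_V(E)|.\<close>

lemma large_elementary_abelian_offender:
  assumes A: "elementary_abelian p G A" "\<not> A \<subseteq> Ol"
    and max: "\<And>B. elementary_abelian p G B \<Longrightarrow> card B \<le> card A"
  defines "E \<equiv> (\<lambda>a. Ol #> a) ` A"
  shows "subgroup E H" "E \<noteq> {\<one>\<^bsub>H\<^esub>}" "\<And>e f. e \<in> E \<Longrightarrow> f \<in> E \<Longrightarrow> e \<otimes>\<^bsub>H\<^esub> f = f \<otimes>\<^bsub>H\<^esub> e"
    and "card V \<le> M.j E"
proof -
  have sA: "subgroup A G" and ab: "\<And>a b. a \<in> A \<Longrightarrow> b \<in> A \<Longrightarrow> a \<otimes> b = b \<otimes> a" and ex: "\<And>a. a \<in> A \<Longrightarrow> a [^] p = \<one>"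
    using A(1) unfolding elementary_abelian_iff by auto
  have AC: "\<And>a. a \<in> A \<Longrightarrow> a \<in> carrier G" using subgroup.mem_carrier[OF sA] .
  interpret h: group_hom "G\<lparr>carrier := A\<rparr>" H "\<lambda>a. Ol #> a"
    using subgroup_imp_group[OF sA] M.G.is_group AC
    by (auto simp: group_hom_def group_hom_axioms_def intro!: homI simp del: mult_FactGroup)
  show sE: "subgroup E H" using h.img_is_subgroup unfolding E_def by simp
  obtain a where a: "a \<in> A" "a \<notin> Ol" using A(2) by blast
  then show "E \<noteq> {\<one>\<^bsub>H\<^esub>}" unfolding E_def using coset_eq_one_iff[of a] AC by blast
  show "e \<otimes>\<^bsub>H\<^esub> f = f \<otimes>\<^bsub>H\<^esub> e" if "e \<in> E" "f \<in> E" for e f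
  proof -
    obtain b c where "b \<in> A" "c \<in> A" "e = Ol #> b" "f = Ol #> c" using \<open>e \<in> E\<close> \<open>f \<in> E\<close> unfolding E_def by blast
    then show ?thesis using ab[of b c] AC by (simp del: mult_FactGroup)
  qed
  define B where "B = A \<inter> Ol"
  have sB: "subgroup B G" unfolding B_def using subgroups_Inter_pair[OF sA Ol_subgroup] .
  have fin: "finite A" "finite B" "finite V" "finite E"
    using fin_subgroup sA sB V_subgroup M.G.fin_subgroup sE by auto
  have fib: "card {b \<in> A. Ol #> b = y} \<le> card B" for y
  proof (cases "{b \<in> A. Ol #> b = y} = {}")
    case False
    then obtain c where c: "c \<in> A" "Ol #> c = y" by blast
    have "inj_on (\<lambda>b. b \<otimes> inv c) {b \<in> A. Ol #> b = y}"
      by (rule inj_onI) (use c AC r_cancel in auto)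
    moreover have "(\<lambda>b. b \<otimes> inv c) ` {b \<in> A. Ol #> b = y} \<subseteq> B"
    proof safe
      fix b assume b: "b \<in> A" "y = Ol #> b"
      have "Ol #> (b \<otimes> inv c) = (Ol #> b) \<otimes>\<^bsub>H\<^esub> inv\<^bsub>H\<^esub> (Ol #> c)"
        unfolding coset_inv[OF AC[OF c(1)]] using coset_mult[of b "inv c"] AC b(1) c(1) by simp
      also have "\<dots> = \<one>\<^bsub>H\<^esub>" using b c AC M.G.r_inv[of "Ol #> c"] by (simp del: mult_FactGroup)
      finally have "b \<otimes> inv c \<in> Ol" using coset_eq_one_iff b c AC by simp
      then show "b \<otimes> inv c \<in> B"
        unfolding B_def using subgroup.m_closed[OF sA b(1) subgroup.m_inv_closed[OF sA c(1)]] by blast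
    qed
    ultimately show ?thesis using card_inj_on_le fin(2) by blast
  next
    case True
    then show ?thesis by (simp only: card.empty)
  qed
  have cA: "card A \<le> card E * card B"
    by (rule card_le_fibers[OF fin(1,4) _ fib]) (simp add: E_def)
  have eB: "elementary_abelian p G B" using sB ab ex unfolding elementary_abelian_iff B_def by blast
  have "elementary_abelian p G (B <#> V)"
    by (rule set_mult_elementary_abelian[OF eB V_elementary_abelian]) (use C_comm V_subset_C B_def in fastforce)
  then have "card (B <#> V) \<le> card A" by (rule max)
  have "B \<inter> V \<subseteq> M.Fix E"
  proof
    fix v assume v: "v \<in> B \<inter> V"
    have "act (Ol #> b) v = v" if b: "b \<in> A" for b
    proof -
      have "b \<otimes> v \<otimes> inv b = v \<otimes> b \<otimes> inv b" using ab[OF b, of v] v unfolding B_def by simp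
      then show ?thesis using act_coset[of b v] AC[OF b] v V_carrier by (simp add: m_assoc)
    qed
    then show "v \<in> M.Fix E" unfolding M.Fix_def E_def using v by auto
  qed
  moreover have "finite (M.Fix E)" by (rule finite_subset[OF _ fin(3)]) (auto simp: M.Fix_def)
  ultimately have f: "card (B \<inter> V) \<le> card (M.Fix E)" by (rule card_mono[rotated])
  have "card B * card V = card (B <#> V) * card (B \<inter> V)" using card_set_mult_Int[OF sB V_subgroup fin(2,3)] by simp
  also have "\<dots> \<le> card A * card (M.Fix E)" using \<open>card (B <#> V) \<le> card A\<close> f by (rule mult_le_mono)
  also have "\<dots> \<le> (card E * card B) * card (M.Fix E)" using cA by (rule mult_le_mono1)
  finally have "card B * card V \<le> card B * M.j E" unfolding M.j_def by (simp add: ac_simps)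
  then show "card V \<le> M.j E" using card_subgroup_pos[OF sB] by simp
qed

end

theorem theorem1p1:
  fixes p :: nat and S :: "('a, 'b) monoid_scheme"
  assumes "Factorial_Ring.prime p" and "odd p"
    and "finite_p_group p S"
    and "nilpotency_class (S Mod oliver_subgroup p S) \<le> 4
       \<or> metabelian (S Mod oliver_subgroup p S)
       \<or> maximal_class p (S Mod oliver_subgroup p S)
       \<or> p_rank p (S Mod oliver_subgroup p S) \<le> p"
  shows "thompson_subgroup p S \<subseteq> oliver_subgroup p S"
proof -
  interpret S: odd_p_group S p
    using assms unfolding finite_p_group_def odd_p_group_def odd_p_group_axioms_def p_group_def p_group_axioms_def by blast
  let ?H = "S Mod oliver_subgroup p S"
  have "A \<subseteq> oliver_subgroup p S"
    if A: "elementary_abelian p S A" and max: "\<forall>E. elementary_abelian p S E \<longrightarrow> elab_rank p S E \<le> elab_rank p S A" for A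
  proof (rule ccontr)
    assume nA: "\<not> A \<subseteq> oliver_subgroup p S"
    have "card B \<le> card A" if "elementary_abelian p S B" for B
      using S.card_eq_power_elab_rank[OF that] S.card_eq_power_elab_rank[OF A] max that S.p_gt_1
      by (simp add: power_increasing)
    note off = S.large_elementary_abelian_offender[OF A nA this]
    obtain E where E: "subgroup E ?H" "E \<noteq> {\<one>\<^bsub>?H\<^esub>}" "S.M.j E \<ge> card S.V" "\<And>e. e \<in> E \<Longrightarrow> S.M.quad e"
      and ab: "\<And>e f. e \<in> E \<Longrightarrow> f \<in> E \<Longrightarrow> e \<otimes>\<^bsub>?H\<^esub> f = f \<otimes>\<^bsub>?H\<^esub> e"
    proof -
      obtain Q where Q: "subgroup Q ?H" "Q \<subseteq> (\<lambda>a. oliver_subgroup p S #>\<^bsub>S\<^esub> a) ` A" "Q \<noteq> {\<one>\<^bsub>?H\<^esub>}"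
          "card (carrier (S\<lparr>carrier := S.V\<rparr>)) \<le> S.M.j Q" "\<And>e. e \<in> Q \<Longrightarrow> S.M.quad e"
        using S.M.quadratic_offender[OF off(1,3,2)] off(4) by auto
      show ?thesis
      proof (rule that[OF Q(1,3) _ Q(5)])
        show "S.M.j Q \<ge> card S.V" using Q(4) by simp
        show "e \<otimes>\<^bsub>?H\<^esub> f = f \<otimes>\<^bsub>?H\<^esub> e" if "e \<in> Q" "f \<in> Q" for e f
          by (rule off(3)) (use that Q(2) in blast)+
      qed
    qed
    have off': "card (carrier (S\<lparr>carrier := S.V\<rparr>)) \<le> S.M.j E" using E(3) by simp
    have class4: False if "nilpotency_class ?H \<le> 4"
    proof -
      have "iter_comm ?H (carrier ?H) (carrier ?H) 4 \<subseteq> {\<one>\<^bsub>?H\<^esub>}"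
        by (rule S.M.G.iter_comm_trivial_mono[OF _ _ that]) (use S.M.G.nilpotency_class_correct(1) in auto)
      then have "iter_comm ?H (carrier ?H) (carrier ?H) 4 = {\<one>\<^bsub>?H\<^esub>}"
        using subgroup.one_closed[OF normal_imp_subgroup[OF S.M.G.iter_comm_normal]] by blast
      then show False
        using S.M.no_offender_if_quads_centralize_commutators[OF S.M.quad_centralizes_commutators_class4 E(1,2) ab E(4) off'] by blast
    qed
    have metab: False if "metabelian ?H"
      using S.M.no_offender_if_quads_centralize_commutators[OF S.M.quad_centralizes_commutators_metabelian[OF that] E(1,2) ab E(4) off'] by blast
    consider "maximal_class p ?H" | "p_rank p ?H \<le> p" using class4 metab assms(4) by blast
    then show False
    proof cases
      case 1
      then obtain n where n: "n \<ge> 2" "order ?H = p ^ n" "nilpotency_class ?H = n - 1" unfolding maximal_class_def by blast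
      have "\<not> nilpotency_class ?H \<le> 4" using class4 by blast
      \<comment> \<open>Class four and metabelian quotients are settled first, because this case
        relies on n - 1 > 4 and on the quotient not being metabelian.\<close>
      then have "n \<ge> 6" using n by linarith
      then have mc: "max_class_group ?H p n"
        using S.M.G.p_group_axioms n S.p_odd unfolding max_class_group_def max_class_group_axioms_def by blast
      have "\<not> metabelian ?H" using metab by blast
      then show False using S.M.no_offender_max_class[OF mc _ E(1,2,4) off'] by blast
    next
      case 2
      have "card B \<le> p ^ p" if B: "elementary_abelian p ?H B" for B
      proof -
        have "finite {B. elementary_abelian p ?H B}"
          by (rule finite_subset[of _ "Pow (carrier ?H)"])
            (use S.M.G.fin subgroup.subset in \<open>auto simp: elementary_abelian_def\<close>)
        then have "elab_rank p ?H B \<le> p_rank p ?H" unfolding p_rank_def using B by (intro Max_ge) auto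
        then have "elab_rank p ?H B \<le> p" using 2 by linarith
        then show ?thesis using S.M.G.card_eq_power_elab_rank[OF B] S.p_gt_1 by (simp add: power_increasing)
      qed
      then show False using S.M.no_offender_if_rank_le_p[OF _ E(1,2) ab E(4) off'] by blast
    qed
  qed
  then show ?thesis
    unfolding thompson_subgroup_def by (intro S.generate_subgroup_incl[OF _ S.Ol_subgroup]) blast
qed

end
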